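(* For any dimension $d\ge 2$ there exist constants $0<c<C<\infty$, depending only on $d$, such that for every $L$ large enough (i.e. for all $L\ge L_0$ for some $L_0$), $$cL^{-2}\le \lambda_{c,u}(L)\le CL^{-2}.$$
   Context: Poisson stick model in $\mathbb{R}^d$, $d\ge 2$. Let $\mathbb{S}=\{p\in\mathbb{R}^d:\Vert p\Vert=1\}$ (Euclidean norm). For $(x,p)\in\mathbb{R}^d\times\mathbb{S}$ and $L>0$ let $\ell_{x,p,L}=\{x+tp:-L/2\le t\le L/2\}$ and let the stick be $S_{x,p,L}=\{y\in\mathbb{R}^d:\mathrm{dist}(y,\ell_{x,p,L})\le 1\}$. For a probability measure $\Theta$ on $\mathbb{S}$ (the orientation distribution) and $\lambda>0$ let $\Pi^\lambda$ be a Poisson point process on $\mathbb{R}^d\times\mathbb{S}$ with intensity measure $\mu_\lambda=\lambda\,\mathrm{Leb}\otimes\Theta$, where $\mathrm{Leb}$ is Lebesgue measure on $\mathbb{R}^d$. Let $\mathcal{C}(\Pi^\lambda)=\bigcup_{(x,p)\in\Pi^\lambda}S_{x,p,L}$. One says $\mathcal{C}(\Pi^\lambda)$ percolates if it contains an unbounded connected component; this event has probability $0$ or $1$. Define $\lambda_{c,\Theta}(L)=\inf\{\lambda>0:\mathbb{P}(\mathcal{C}(\Pi^\lambda)\text{ percolates})=1\}$. Uniform case: $\lambda_{c,u}(L)$ denotes $\lambda_{c,\Theta}(L)$ when $\Theta=\mathcal{H}$, the $(d-1)$-dimensional Hausdorff measure on $\mathbb{S}$ normalized so that $\mathcal{H}(\mathbb{S})=1$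 (the uniform distribution on the sphere). *)

theory Defs
  imports "HOL-Probability.Probability"
begin

section \<open>Hausdorff measure and the uniform distribution on the sphere\<close>

text \<open>
  The guard \<open>bounded (U i)\<close> is needed because \<open>diameter\<close> has no meaningful value on unbounded
  sets. Empty covering sets contribute nothing, also for \<open>k = 0\<close>. There is no dimensional
  prefactor; it cancels in the normalized measure on the sphere.
\<close>

definition hausdorff_content :: "nat \<Rightarrow> real \<Rightarrow> 'a::metric_space set \<Rightarrow> ennreal" where
  "hausdorff_content k \<delta> A =
    (INF U \<in> {U :: nat \<Rightarrow> 'a set. A \<subseteq> (\<Union>i. U i) \<and> (\<forall>i. bounded (U i) \<and> diameter (U i) \<le> \<delta>)}.
       \<Sum>i. if U i = {} then 0 else ennreal (diameter (U i) ^ k))"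

definition hausdorff_measure :: "nat \<Rightarrow> 'a::metric_space measure" where
  "hausdorff_measure k = measure_of UNIV (sets borel) (\<lambda>A. SUP \<delta>\<in>{0<..}. hausdorff_content k \<delta> A)"

definition uniform_sphere :: "'a::euclidean_space measure" where
  "uniform_sphere =
    uniform_measure (restrict_space (hausdorff_measure (DIM('a) - 1)) (sphere 0 1)) (sphere 0 1)"

section \<open>Poisson point processes\<close>

definition num_points :: "'b set \<Rightarrow> 'b set \<Rightarrow> ennreal" where
  "num_points \<omega> A = emeasure (count_space UNIV) (\<omega> \<inter> A)"

text \<open>
  Point processes are random sets, which is adequate for intensity measures without atoms:
  the corresponding Poisson processes are almost surely simple.
\<close>

definition poisson_point_process :: "'w measure \<Rightarrow> 'b measure \<Rightarrow> ('w \<Rightarrow> 'b set) \<Rightarrow> bool" where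
  "poisson_point_process M \<mu> \<eta> \<longleftrightarrow>
     prob_space M \<and>
     (\<forall>\<omega>\<in>space M. \<eta> \<omega> \<subseteq> space \<mu>) \<and>
     (\<forall>A\<in>sets \<mu>. (\<lambda>\<omega>. num_points (\<eta> \<omega>) A) \<in> borel_measurable M) \<and>
     (\<forall>A\<in>sets \<mu>. emeasure \<mu> A < \<infinity> \<longrightarrow>
        (\<forall>k::nat. measure M {\<omega>\<in>space M. num_points (\<eta> \<omega>) A = of_nat k} =
           exp (- measure \<mu> A) * measure \<mu> A ^ k / fact k)) \<and>
     (\<forall>(A :: nat \<Rightarrow> 'b set) n. (\<forall>i<n. A i \<in> sets \<mu>) \<and> disjoint_family_on A {..<n} \<longrightarrow>
        prob_space.indep_vars M (\<lambda>_. borel) (\<lambda>i \<omega>. num_points (\<eta> \<omega>) (A i)) {..<n})"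

text \<open>
  The canonical process: a measure on configurations under which the identity is a Poisson
  process. For \<open>\<sigma>\<close>-finite \<open>\<mu>\<close> the defining conditions determine it on the \<open>\<sigma>\<close>-algebra generated
  by the counting variables, so the choice made by \<open>SOME\<close> is immaterial for events that, up to
  a null set, belong to that \<open>\<sigma>\<close>-algebra.
\<close>

definition poisson_law :: "'b measure \<Rightarrow> 'b set measure" where
  "poisson_law \<mu> = (SOME P. poisson_point_process P \<mu> (\<lambda>\<omega>. \<omega>))"

section \<open>The stick model\<close>

definition stick_axis :: "real \<Rightarrow> 'a::euclidean_space \<Rightarrow> 'a \<Rightarrow> 'a set" where
  "stick_axis L x p = {x + t *\<^sub>R p | t. - L / 2 \<le> t \<and> t \<le> L / 2}"

definition stick :: "real \<Rightarrow> 'a::euclidean_space \<Rightarrow> 'a \<Rightarrow> 'a set" where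
  "stick L x p = {y. infdist y (stick_axis L x p) \<le> 1}"

definition covered_set :: "real \<Rightarrow> ('a::euclidean_space \<times> 'a) set \<Rightarrow> 'a set" where
  "covered_set L \<omega> = (\<Union>(x, p)\<in>\<omega>. stick L x p)"

definition percolates :: "'a::euclidean_space set \<Rightarrow> bool" where
  "percolates S \<longleftrightarrow> (\<exists>K\<in>components S. \<not> bounded K)"

definition stick_intensity :: "'a::euclidean_space measure \<Rightarrow> real \<Rightarrow> ('a \<times> 'a) measure" where
  "stick_intensity \<Theta> u = scale_measure (ennreal u) (lborel \<Otimes>\<^sub>M \<Theta>)"

text \<open>
  \<open>\<Theta>\<close> is meant to be a probability measure whose space is the unit sphere. The infimum is taken
  in the extended reals, so that the infimum of the empty set is infinite. \<open>AE\<close> expresses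
  probability one: percolation lies in the \<open>\<sigma>\<close>-algebra generated by the counting variables once
  the null set of configurations that are not locally finite is removed.
\<close>

definition critical_intensity :: "'a::euclidean_space measure \<Rightarrow> real \<Rightarrow> ereal" where
  "critical_intensity \<Theta> L =
    Inf (ereal ` {u. u > 0 \<and>
      (AE \<omega> in poisson_law (stick_intensity \<Theta> u). percolates (covered_set L \<omega>))})"

definition critical_intensity_uniform :: "'a::euclidean_space itself \<Rightarrow> real \<Rightarrow> ereal" where
  "critical_intensity_uniform _ L = critical_intensity (uniform_sphere :: 'a measure) L"

end

theory Submission
  imports Defs
begin

text \<open>
  Lower bound: the sticks meeting a given stick are centred, for each direction, in the
  neighbourhood of a parallelogram of area at most \<open>L\<^sup>2\<close>, so their expected number is
  \<open>O(u L\<^sup>2)\<close>. After cutting the space of sticks into small cells, the occupied cells form an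
  independent site percolation, in which the expected number of self-avoiding paths of length \<open>n\<close>
  decays geometrically when \<open>u L\<^sup>2\<close> is small.

  Upper bound: take disjoint balls of radius \<open>L / 8\<close> centred at the points of a planar grid. A stick
  centred in one of them is hit by a stick centred in a neighbouring one except with probability
  \<open>exp (- const u L\<^sup>2)\<close>, since uniformly many directions point to the neighbour transversally
  to the given stick. In high dimension two given sticks have no common neighbour, so the grid has
  to be explored dynamically; each exploration step then fails with conditional
  probability at most \<open>\<epsilon>\<close>, and a set \<open>F\<close> of grid points consists of failures with probability at most
  \<open>\<epsilon> ^ card F\<close>. Percolation of the non-failures needs no contours: call a block of side
  \<open>3 ^ (n + 1)\<close> good if at most one of its nine subblocks is bad. Good blocks contain connected sets
  that adjacent good blocks join, and bad blocks are super-exponentially rare.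
\<close>

section \<open>Hausdorff measure is a Borel measure\<close>

text \<open>Both halves cut the sticks into cells of diameter of order 1 / L: a parameter change of
  that size moves axis points by a bounded amount. For the lower bound two cells are linked if some
  of their sticks are near each other, for the upper bound if all of their sticks meet, so
  discretization errs on the safe side; the process then enters through void probabilities and
  independence of disjoint cells. Two preliminaries come from the definitions.
  \<open>poisson_law\<close> is a choice, about which nothing is known before some Poisson process
  with the given intensity has been constructed. The uniform distribution is a normalized Hausdorff
  measure, so the contents must be shown to give a Borel measure, the sphere to have finite measure,
  and caps of a given radius to have mass bounded below uniformly in the centre; the last property
  provides transversal directions in every situation. The threshold \<epsilon> = 1 / 324 comes from
  81 = 9 * 9 ordered pairs of subblocks and a factor 4 that makes the union bound decay. Through
  void probabilities it asks for intensity ln 324 divided by a constant times L squared.\<close>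

lemma diff_pos_frac: "0 < x \<Longrightarrow> 0 < 1 / x - 1 / (x + 1)" for x :: real
  using frac_less2[of 1 1 x "x + 1"] by simp

section \<open>Caratheodory's criterion for metric outer measures\<close>

lemma outer_measure_subadditive:
  fixes f :: "'a set \<Rightarrow> ennreal"
  assumes om: "outer_measure_space UNIV f" and XY: "X \<inter> Y = {}"
  shows "f (X \<union> Y) \<le> f X + f Y"
proof -
  have "disjoint_family (binaryset X Y)"
    using XY by (auto simp: disjoint_family_on_def binaryset_def)
  then have "f (\<Union>i. binaryset X Y i) \<le> (\<Sum>i. f (binaryset X Y i))"
    using om by (auto simp: outer_measure_space_def countably_subadditive_def)
  also have "\<dots> = f X + f Y"
    using om by (intro suminf_binaryset_eq) (auto simp: outer_measure_space_def positive_def)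
  finally show ?thesis by (simp add: UN_binaryset_eq)
qed

text \<open>\<open>A - F\<close> is exhausted by the sets \<open>S n\<close> at distance at least 1
  / (n + 1) from \<open>F\<close>, to which additivity on separated sets applies; the shells
  \<open>R k\<close> with k \<ge> n make up the rest. Shells whose indices differ by two or more are
  a positive distance apart, so the even and the odd ones each have total at most
  \<open>f A\<close>. If this is finite, the tail of the series vanishes.\<close>

lemma metric_outer_measure_closed:
  fixes f :: "'a::metric_space set \<Rightarrow> ennreal"
  assumes om: "outer_measure_space UNIV f"
    and sep: "\<And>A B e. 0 < e \<Longrightarrow> (\<And>a b. a \<in> A \<Longrightarrow> b \<in> B \<Longrightarrow> e \<le> dist a b) \<Longrightarrow> f A + f B \<le> f (A \<union> B)"
    and F: "closed F"
  shows "f (F \<inter> A) + f (A - F) \<le> f A"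
proof (cases "F = {} \<or> f A = \<infinity>")
  case True
  then show ?thesis using om by (auto simp: outer_measure_space_def positive_def)
next
  case False
  then have Fne: "F \<noteq> {}" and fin: "f A < \<infinity>" by (auto simp: less_top)
  have mono: "f X \<le> f Y" if "X \<subseteq> Y" for X Y
    using om that by (auto simp: outer_measure_space_def increasing_def)
  have f0: "f {} = 0" using om by (auto simp: outer_measure_space_def positive_def)
  have csub: "f (\<Union>i. X i) \<le> (\<Sum>i. f (X i))" if "disjoint_family X" for X :: "nat \<Rightarrow> 'a set"
    using om that by (auto simp: outer_measure_space_def countably_subadditive_def)
  define S where "S n = {x \<in> A - F. 1 / real (n + 1) \<le> infdist x F}" for n :: nat
  define R where "R n = S (Suc n) - S n" for n
  have lower: "f (F \<inter> A) + f (S n) \<le> f A" for n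
  proof -
    have "f (F \<inter> A) + f (S n) \<le> f ((F \<inter> A) \<union> S n)"
    proof (rule sep[of "1 / real (n+1)"])
      fix a b assume "a \<in> F \<inter> A" "b \<in> S n"
      then show "1 / real (n+1) \<le> dist a b"
        using infdist_le[of a F b] by (auto simp: S_def dist_commute)
    qed simp
    also have "\<dots> \<le> f A" by (rule mono) (auto simp: S_def)
    finally show ?thesis .
  qed
  have Sup: "S n \<subseteq> S m" if "n \<le> m" for n m
  proof -
    have "1 / real (m+1) \<le> 1 / real (n+1)" using that by (simp add: frac_le)
    then show ?thesis by (auto simp: S_def)
  qed
  \<comment> \<open>The offset \<open>c\<close> is 0 or 1 and selects the even or the odd
    shells.\<close>
  have part: "(\<Sum>k<n. f (R (2*k+c))) \<le> f (\<Union>k<n. R (2*k+c))" for n c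
  proof (induction n)
    case (Suc n)
    have "(\<Sum>k<Suc n. f (R (2*k+c))) \<le> f (\<Union>k<n. R (2*k+c)) + f (R (2*n+c))"
      using Suc by (simp add: add_right_mono)
    also have "\<dots> \<le> f ((\<Union>k<n. R (2*k+c)) \<union> R (2*n+c))"
    proof (cases n)
      case (Suc m)
      show ?thesis
      \<comment> \<open>\<open>a\<close> lies in \<open>S (2 * n + c - 1)\<close>, hence at least 1
        / (2n + c) away from \<open>F\<close>, while \<open>b\<close> lies outside
        \<open>S (2 * n + c)\<close>, hence closer than 1 / (2n + c + 1). The difference is the
        gap.\<close>
      proof (rule sep[of "1 / real (2*n+c) - 1 / real (2*n+c+1)"])
        show "0 < 1 / real (2*n+c) - 1 / real (2*n+c+1)" using Suc diff_pos_frac[of "real (2*n+c)"] by simp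
        fix a b assume a: "a \<in> (\<Union>k<n. R (2*k+c))" and b: "b \<in> R (2*n+c)"
        from a obtain k where k: "k < n" "a \<in> S (Suc (2*k+c))" by (auto simp: R_def)
        have "S (Suc (2*k+c)) \<subseteq> S (2*n+c-1)" using k(1) by (intro Sup) auto
        with k(2) have "a \<in> S (2*n+c-1)" by blast
        then have 1: "1 / real (2*n+c) \<le> infdist a F" using Suc by (auto simp: S_def)
        have 2: "infdist b F < 1 / real (2*n+c+1)" using b by (auto simp: R_def S_def)
        have "infdist a F \<le> infdist b F + dist a b" by (rule infdist_triangle)
        then show "1 / real (2*n+c) - 1 / real (2*n+c+1) \<le> dist a b" using 1 2 by linarith
      qed
    qed (simp add: f0)
    also have "(\<Union>k<n. R (2*k+c)) \<union> R (2*n+c) = (\<Union>k<Suc n. R (2*k+c))"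
      by (auto simp: lessThan_Suc)
    finally show ?case .
  qed simp
  have partA: "(\<Sum>k<n. f (R (2*k+c))) \<le> f A" for n c
    by (rule order.trans[OF part mono]) (auto simp: R_def S_def)
  have "(\<Sum>k<n. f (R k)) \<le> f A + f A" for n
  proof -
    have "(\<Sum>k<n. f (R k)) \<le> (\<Sum>k<2*n. f (R k))" by (intro sum_mono2) auto
    also have "\<dots> = (\<Sum>k<n. f (R (2*k+0))) + (\<Sum>k<n. f (R (2*k+1)))"
      by (induction n) (auto simp: ac_simps)
    also have "\<dots> \<le> f A + f A" by (intro add_mono partA)
    finally show ?thesis .
  qed
  then have "(\<Sum>k. f (R k)) \<le> f A + f A" by (intro suminf_le_const) auto
  then have sumfin: "(\<Sum>k. f (R k)) < \<infinity>" using fin by (auto simp: less_top[symmetric] top_unique)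
  have infpos: "0 < infdist x F" if "x \<notin> F" for x
    using that F Fne infdist_nonneg[of x F] in_closed_iff_infdist_zero[of F x] by force
  have cover: "A - F \<subseteq> S n \<union> (\<Union>k. R (k + n))" for n
  proof
    fix x assume x: "x \<in> A - F"
    then have "0 < infdist x F" using infpos by auto
    then obtain m where "inverse (real (Suc m)) < infdist x F" using reals_Archimedean by blast
    then have ex: "x \<in> S m" using x by (auto simp: S_def inverse_eq_divide add.commute)
    define l where "l = (LEAST l. x \<in> S l)"
    have l: "x \<in> S l" "\<And>j. j < l \<Longrightarrow> x \<notin> S j"
      using ex unfolding l_def by (auto intro: LeastI dest: not_less_Least)
    show "x \<in> S n \<union> (\<Union>k. R (k + n))"
    proof (cases "l \<le> n")
      case True then show ?thesis using Sup l by blast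
    next
      case False
      then obtain j where j: "l = Suc j" "n \<le> j" by (cases l) auto
      then have "x \<in> R ((j - n) + n)" using l by (auto simp: R_def)
      then show ?thesis by blast
    qed
  qed
  have Rdisj: "disjoint_family (\<lambda>k. R (k + n))" for n
  proof -
    have "R i \<inter> R j = {}" if "i < j" for i j
      using Sup[of "Suc i" j] that by (auto simp: R_def)
    then have "R i \<inter> R j = {}" if "i \<noteq> j" for i j
      using that by (metis Int_commute linorder_neq_iff)
    then show ?thesis by (auto simp: disjoint_family_on_def)
  qed
  have SR: "S n \<inter> (\<Union>k. R (k + n)) = {}" for n
  proof -
    have "S n \<inter> R (k + n) = {}" for k using Sup[of n "k + n"] by (auto simp: R_def)
    then show ?thesis by blast
  qed
  have upper: "f (A - F) \<le> f (S n) + (\<Sum>k. f (R (k + n)))" for n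
    using mono[OF cover[of n]] outer_measure_subadditive[OF om SR[of n]] csub[OF Rdisj[of n]]
    by (metis (no_types, lifting) add_left_mono order_trans)
  show ?thesis
  proof (rule ennreal_le_epsilon)
    fix e :: real assume e: "0 < e" 
    have "\<exists>n. (\<Sum>k. f (R k)) \<le> (\<Sum>k<n. f (R k)) + ennreal e"
    proof (rule ccontr)
      assume "\<not> ?thesis"
      then have "(\<Sum>k<n. f (R k)) + ennreal e \<le> (\<Sum>k. f (R k))" for n by (simp add: less_imp_le not_le)
      then have "(SUP n. (\<Sum>k<n. f (R k)) + ennreal e) \<le> (\<Sum>k. f (R k))" by (intro SUP_least)
      moreover have "(SUP n. (\<Sum>k<n. f (R k)) + ennreal e) = (SUP n. (\<Sum>k<n. f (R k))) + ennreal e"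
        by (subst ennreal_SUP_add_left) auto
      ultimately have "(\<Sum>k. f (R k)) + ennreal e \<le> (\<Sum>k. f (R k)) + 0" by (simp add: suminf_eq_SUP)
      then show False using sumfin e
        by (subst (asm) ennreal_add_left_cancel_le) auto
    qed
    then obtain n where n: "(\<Sum>k. f (R k)) \<le> (\<Sum>k<n. f (R k)) + ennreal e" ..
    have "(\<Sum>k. f (R k)) = (\<Sum>k. f (R (k + n))) + (\<Sum>k<n. f (R k))"
      by (rule suminf_offset) auto
    then have "(\<Sum>k<n. f (R k)) + (\<Sum>k. f (R (k + n))) \<le> (\<Sum>k<n. f (R k)) + ennreal e"
      using n by (simp add: add.commute)
    moreover have "(\<Sum>k<n. f (R k)) < \<infinity>"
      by (rule le_less_trans[OF sum_le_suminf sumfin]) auto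
    ultimately have "(\<Sum>k. f (R (k + n))) \<le> ennreal e"
      by (metis ennreal_add_left_cancel_le less_irrefl)
    then have "f (F \<inter> A) + f (A - F) \<le> f (F \<inter> A) + (f (S n) + ennreal e)"
      using upper[of n] by (meson add_left_mono order_trans)
    also have "\<dots> \<le> f A + ennreal e" using lower[of n] by (simp add: add.assoc[symmetric] add_right_mono)
    finally show "f (F \<inter> A) + f (A - F) \<le> f A + ennreal e" .
  qed
qed

lemma metric_outer_measure_borel:
  fixes f :: "'a::metric_space set \<Rightarrow> ennreal"
  assumes om: "outer_measure_space UNIV f"
    and sep: "\<And>A B e. 0 < e \<Longrightarrow> (\<And>a b. a \<in> A \<Longrightarrow> b \<in> B \<Longrightarrow> e \<le> dist a b) \<Longrightarrow> f A + f B \<le> f (A \<union> B)"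
  shows "measure_space UNIV (sets borel) f"
proof -
  interpret sigma_algebra UNIV "Pow UNIV :: 'a set set" by (rule sigma_algebra_Pow)
  have om': "outer_measure_space (Pow UNIV) f" using om by simp
  have ms: "measure_space UNIV (lambda_system UNIV (Pow UNIV) f) f"
    by (rule caratheodory_lemma[OF om'])
  have "closed F \<Longrightarrow> F \<in> lambda_system UNIV (Pow UNIV) f" for F
  proof -
    assume F: "closed F"
    have "f (F \<inter> x) + f (x - F) = f x" for x
    proof (rule antisym)
      show "f (F \<inter> x) + f (x - F) \<le> f x" by (rule metric_outer_measure_closed[OF om sep F])
      have "(F \<inter> x) \<union> (x - F) = x" by auto
      then show "f x \<le> f (F \<inter> x) + f (x - F)" using outer_measure_subadditive[OF om, of "F \<inter> x" "x - F"] by auto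
    qed
    then show "F \<in> lambda_system UNIV (Pow UNIV) f"
      by (auto simp: lambda_system_def Diff_eq Int_commute)
  qed
  then have "sets (borel :: 'a measure) \<subseteq> lambda_system UNIV (Pow UNIV) f"
    using ms sigma_algebra.sigma_sets_subset[of UNIV "lambda_system UNIV (Pow UNIV) f" "Collect closed"]
    unfolding borel_eq_closed measure_space_def by (auto simp: subset_eq)
  moreover have "sigma_algebra UNIV (sets (borel :: 'a measure))"
    using sets.sigma_algebra_axioms[of "borel :: 'a measure"] by simp
  ultimately show ?thesis using ms measure_down by blast
qed

section \<open>Hausdorff contents and the Borel measure they define\<close>

lemma hausdorff_content_le:
  assumes "A \<subseteq> (\<Union>i::nat. U i)" "\<And>i. bounded (U i)" "\<And>i. diameter (U i) \<le> \<delta>"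
  shows "hausdorff_content k \<delta> A \<le> (\<Sum>i. if U i = {} then 0 else ennreal (diameter (U i) ^ k))"
  unfolding hausdorff_content_def using assms by (intro INF_lower) auto

lemma hausdorff_content_antimono:
  "\<delta> \<le> \<delta>' \<Longrightarrow> hausdorff_content k \<delta>' A \<le> hausdorff_content k \<delta> A"
  unfolding hausdorff_content_def by (intro INF_superset_mono) (auto intro: order_trans)

lemma hausdorff_content_mono:
  "A \<subseteq> B \<Longrightarrow> hausdorff_content k \<delta> A \<le> hausdorff_content k \<delta> B"
  unfolding hausdorff_content_def by (intro INF_superset_mono) auto

lemma hausdorff_content_empty: "0 \<le> \<delta> \<Longrightarrow> hausdorff_content k \<delta> {} = 0"
  using hausdorff_content_le[of "{}" "\<lambda>i. {}" \<delta> k] by auto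

lemma hausdorff_content_countable_subadditive:
  fixes A :: "nat \<Rightarrow> 'a::metric_space set"
  shows "hausdorff_content k \<delta> (\<Union>n. A n) \<le> (\<Sum>n. hausdorff_content k \<delta> (A n))"
proof (cases "(\<Sum>n. hausdorff_content k \<delta> (A n)) = \<infinity>")
  case False
  let ?h = "\<lambda>U :: 'a set. if U = {} then 0 else ennreal (diameter U ^ k)"
  have fin: "hausdorff_content k \<delta> (A n) \<noteq> \<infinity>" for n
  proof -
    have "hausdorff_content k \<delta> (A n) \<le> (\<Sum>n. hausdorff_content k \<delta> (A n))"
      using sum_le_suminf[of "\<lambda>n. hausdorff_content k \<delta> (A n)" "{n}"] by simp
    then show ?thesis using False by (auto simp: top_unique)
  qed
  show ?thesis
  proof (rule ennreal_le_epsilon)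
    fix e :: real assume e: "0 < e"
    define d where "d n = e * (1/2) ^ Suc n" for n
    have dpos: "0 < d n" for n using e by (simp add: d_def)
    have "\<exists>U. A n \<subseteq> (\<Union>i. U i) \<and> (\<forall>i. bounded (U i) \<and> diameter (U i) \<le> \<delta>) \<and>
        (\<Sum>i. ?h (U i)) < hausdorff_content k \<delta> (A n) + ennreal (d n)" for n
    proof -
      have "hausdorff_content k \<delta> (A n) < hausdorff_content k \<delta> (A n) + ennreal (d n)"
        using fin[of n] dpos[of n] by (simp add: ennreal_add_left_cancel_less top.not_eq_extremum)
      then show ?thesis
        by (subst (asm) hausdorff_content_def) (auto simp: INF_less_iff)
    qed
    then have "\<forall>n. \<exists>U. A n \<subseteq> (\<Union>i. U i) \<and> (\<forall>i. bounded (U i) \<and> diameter (U i) \<le> \<delta>) \<and>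
        (\<Sum>i. ?h (U i)) < hausdorff_content k \<delta> (A n) + ennreal (d n)" by blast
    from choice[OF this] obtain U where U: "\<And>n. A n \<subseteq> (\<Union>i. U n i)" "\<And>n i. bounded (U n i)" "\<And>n i. diameter (U n i) \<le> \<delta>"
      "\<And>n. (\<Sum>i. ?h (U n i)) < hausdorff_content k \<delta> (A n) + ennreal (d n)"
      by blast
    define V where "V j = (case prod_decode j of (n, i) \<Rightarrow> U n i)" for j
    have "(\<Union>n. A n) \<subseteq> (\<Union>j. V j)"
    proof
      fix x assume "x \<in> (\<Union>n. A n)"
      then obtain n i where "x \<in> U n i" using U(1) by blast
      then have "x \<in> V (prod_encode (n, i))" by (simp add: V_def)
      then show "x \<in> (\<Union>j. V j)" by blast
    qed
    then have "hausdorff_content k \<delta> (\<Union>n. A n) \<le> (\<Sum>j. ?h (V j))"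
      by (rule hausdorff_content_le) (auto simp: V_def U split: prod.split)
    also have "\<dots> = (\<Sum>j. (\<lambda>(n, i). ?h (U n i)) (prod_decode j))"
      by (intro suminf_cong) (auto simp: V_def split: prod.split)
    also have "\<dots> = (\<Sum>n. \<Sum>i. ?h (U n i))"
      by (subst suminf_ennreal_2dimen[where f = "\<lambda>(n, i). ?h (U n i)" and g = "\<lambda>n. \<Sum>i. ?h (U n i)"]) (auto simp: comp_def)
    also have "\<dots> \<le> (\<Sum>n. hausdorff_content k \<delta> (A n) + ennreal (d n))"
      by (intro suminf_le less_imp_le U) auto
    also have "\<dots> = (\<Sum>n. hausdorff_content k \<delta> (A n)) + (\<Sum>n. ennreal (d n))"
      by (rule suminf_add[symmetric]) auto
    also have "(\<Sum>n. ennreal (d n)) = ennreal e"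
    proof -
      have "d sums (e * 1)" unfolding d_def by (rule sums_mult) (rule power_half_series)
      then show ?thesis using dpos e by (subst suminf_ennreal2) (auto simp: sums_iff less_imp_le)
    qed
    finally show "hausdorff_content k \<delta> (\<Union>n. A n) \<le> (\<Sum>n. hausdorff_content k \<delta> (A n)) + ennreal e" .
  qed
qed auto

text \<open>A set of diameter below the gap \<open>e\<close> meets at most one of \<open>A\<close>
  and \<open>B\<close>, so a cover of the union splits into two covers that share no nonempty
  member.\<close>

lemma hausdorff_content_separated:
  assumes "0 < e" "\<delta> < e" "\<And>a b. a \<in> A \<Longrightarrow> b \<in> B \<Longrightarrow> e \<le> dist a b"
  shows "hausdorff_content k \<delta> A + hausdorff_content k \<delta> B \<le> hausdorff_content k \<delta> (A \<union> B)"
proof -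
  let ?h = "\<lambda>U. if U = {} then 0 else ennreal (diameter U ^ k)"
  have "hausdorff_content k \<delta> A + hausdorff_content k \<delta> B \<le> (\<Sum>i. ?h (U i))"
    if U: "A \<union> B \<subseteq> (\<Union>i. U i)" "\<And>i. bounded (U i)" "\<And>i. diameter (U i) \<le> \<delta>" for U :: "nat \<Rightarrow> _"
  proof -
    \<comment> \<open>The empty set will replace members that miss \<open>X\<close>, so its diameter
      0 has to be admissible.\<close>
    have d0: "0 \<le> \<delta>" using diameter_ge_0[OF U(2)[of 0]] U(3)[of 0] by linarith
    define V where "V X i = (if U i \<inter> X = {} then {} else U i)" for X i
    have V: "hausdorff_content k \<delta> X \<le> (\<Sum>i. ?h (V X i))" if X: "X \<subseteq> A \<union> B" for X
    proof (rule hausdorff_content_le)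
      show "X \<subseteq> (\<Union>i. V X i)" using X U(1) by (fastforce simp: V_def)
    qed (auto simp: V_def U d0)
    have disj: "U i \<inter> A = {} \<or> U i \<inter> B = {}" for i
    proof (rule ccontr)
      assume "\<not> ?thesis"
      then obtain a b where ab: "a \<in> A" "a \<in> U i" "b \<in> B" "b \<in> U i" by auto
      then have "dist a b \<le> diameter (U i)" using U(2) by (intro diameter_bounded_bound) auto
      then show False using assms(3)[OF ab(1,3)] U(3)[of i] assms(2) by linarith
    qed
    then have le: "?h (V A i) + ?h (V B i) \<le> ?h (U i)" for i
      using disj[of i] by (auto simp: V_def)
    have "hausdorff_content k \<delta> A + hausdorff_content k \<delta> B \<le> (\<Sum>i. ?h (V A i)) + (\<Sum>i. ?h (V B i))"
      by (intro add_mono V) auto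
    also have "\<dots> = (\<Sum>i. ?h (V A i) + ?h (V B i))" by (rule suminf_add) auto
    also have "\<dots> \<le> (\<Sum>i. ?h (U i))" by (intro suminf_le le) auto
    finally show ?thesis .
  qed
  then show ?thesis by (subst (3) hausdorff_content_def) (auto intro!: INF_greatest)
qed

lemma measure_space_hausdorff:
  "measure_space (UNIV :: 'a::metric_space set) (sets borel) (\<lambda>A. SUP \<delta>\<in>{0<..}. hausdorff_content k \<delta> A)"
  (is "measure_space _ _ ?H")
proof (rule metric_outer_measure_borel)
  have sub: "?H (\<Union>n. A n) \<le> (\<Sum>n. ?H (A n))" for A :: "nat \<Rightarrow> 'a set"
  proof (rule SUP_least)
    fix \<delta> :: real assume d: "\<delta> \<in> {0<..}"
    have "hausdorff_content k \<delta> (\<Union>n. A n) \<le> (\<Sum>n. hausdorff_content k \<delta> (A n))"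
      by (rule hausdorff_content_countable_subadditive)
    also have "\<dots> \<le> (\<Sum>n. ?H (A n))" by (intro suminf_le SUP_upper d) auto
    finally show "hausdorff_content k \<delta> (\<Union>n. A n) \<le> (\<Sum>n. ?H (A n))" .
  qed
  show "outer_measure_space UNIV ?H"
    unfolding outer_measure_space_def positive_def increasing_def countably_subadditive_def
    using sub by (auto simp: hausdorff_content_empty intro!: SUP_mono' hausdorff_content_mono)
next
  fix A B :: "'a set" and e :: real
  assume e: "0 < e" and sep: "\<And>a b. a \<in> A \<Longrightarrow> b \<in> B \<Longrightarrow> e \<le> dist a b"
  show "?H A + ?H B \<le> ?H (A \<union> B)"
  proof -
    have "?H A + ?H B = (SUP \<delta>\<in>{0<..}. hausdorff_content k \<delta> A + hausdorff_content k \<delta> B)"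
    proof (rule SUP_add_directed_ennreal[symmetric])
      fix i j :: real assume "i \<in> {0<..}" "j \<in> {0<..}"
      then show "\<exists>l\<in>{0<..}. hausdorff_content k i A + hausdorff_content k j B
          \<le> hausdorff_content k l A + hausdorff_content k l B"
        by (intro bexI[of _ "min i j"] add_mono hausdorff_content_antimono) auto
    qed
    also have "\<dots> \<le> ?H (A \<union> B)"
    proof (rule SUP_least)
      fix \<delta> :: real assume d: "\<delta> \<in> {0<..}"
      \<comment> \<open>Separation acts on scales below \<open>e\<close>; passing to the smaller
        scale \<open>min \<delta> (e/2)\<close> can only increase the contents.\<close>
      have "hausdorff_content k \<delta> A + hausdorff_content k \<delta> B
          \<le> hausdorff_content k (min \<delta> (e/2)) A + hausdorff_content k (min \<delta> (e/2)) B"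
        by (intro add_mono hausdorff_content_antimono) auto
      also have "\<dots> \<le> hausdorff_content k (min \<delta> (e/2)) (A \<union> B)"
        using e sep by (intro hausdorff_content_separated[of e]) auto
      also have "\<dots> \<le> ?H (A \<union> B)" using d e by (intro SUP_upper) auto
      finally show "hausdorff_content k \<delta> A + hausdorff_content k \<delta> B \<le> ?H (A \<union> B)" .
    qed
    finally show ?thesis .
  qed
qed

lemma space_hausdorff_measure [simp]: "space (hausdorff_measure k) = UNIV"
  by (simp add: hausdorff_measure_def)

lemma sets_hausdorff_measure [simp, measurable_cong]: "sets (hausdorff_measure k) = sets borel"
proof -
  have "sigma_sets UNIV (sets (borel :: 'a measure)) = sets borel"
    using sets.sigma_sets_eq[of "borel :: 'a measure"] by simp
  then show ?thesis by (simp add: hausdorff_measure_def)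
qed

lemma emeasure_hausdorff_measure:
  assumes "A \<in> sets borel"
  shows "emeasure (hausdorff_measure k) A = (SUP \<delta>\<in>{0<..}. hausdorff_content k \<delta> A)"
proof (rule emeasure_measure_of[OF hausdorff_measure_def])
  show "positive (sets (hausdorff_measure k)) (\<lambda>A::'a set. SUP \<delta>\<in>{0<..}. hausdorff_content k \<delta> A)"
    "countably_additive (sets (hausdorff_measure k)) (\<lambda>A::'a set. SUP \<delta>\<in>{0<..}. hausdorff_content k \<delta> A)"
    using measure_space_hausdorff[where 'a = 'a and k = k] unfolding measure_space_def sets_hausdorff_measure by blast+
qed (use assms in auto)

section \<open>The uniform distribution on the sphere\<close>

lemma measure_separated_balls:
  fixes T :: "'a::euclidean_space set"
  assumes "finite T" "0 \<le> r" "\<And>s t. s \<in> T \<Longrightarrow> t \<in> T \<Longrightarrow> s \<noteq> t \<Longrightarrow> 2 * r \<le> dist s t"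
  shows "measure lborel (\<Union>t\<in>T. ball t r) = card T * (unit_ball_vol (DIM('a)) * r ^ DIM('a))"
proof -
  have "disjoint_family_on (\<lambda>t. ball t r) T"
    unfolding disjoint_family_on_def
  proof (intro ballI impI, rule ccontr)
    fix s t assume st: "s \<in> T" "t \<in> T" "s \<noteq> t" "ball s r \<inter> ball t r \<noteq> {}"
    then obtain x where "dist s x < r" "dist t x < r" by auto
    then have "dist s t < 2 * r" using dist_triangle2[of s t x] by simp
    then show False using assms(3)[OF st(1-3)] by simp
  qed
  then have "measure lborel (\<Union>t\<in>T. ball t r) = (\<Sum>t\<in>T. measure lborel (ball t r))"
    using assms(1) emeasure_lborel_ball_finite[of _ r]
    by (intro measure_finite_Union) (auto simp: less_top)
  then show ?thesis using assms(2) by (simp add: content_ball)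
qed

lemma power_diff_le:
  fixes a b :: real
  assumes "0 \<le> b" "b \<le> a"
  shows "a ^ n - b ^ n \<le> real n * (a - b) * a ^ (n - 1)"
proof -
  have "a ^ n - b ^ n = (a - b) * (\<Sum>i<n. b ^ (n - Suc i) * a ^ i)" by (rule power_diff_sumr2)
  also have "\<dots> \<le> (a - b) * (\<Sum>i<n. a ^ (n - 1))"
  proof (intro mult_left_mono sum_mono)
    fix i assume "i \<in> {..<n}"
    then have "b ^ (n - Suc i) * a ^ i \<le> a ^ (n - Suc i) * a ^ i" using assms
      by (intro mult_right_mono power_mono) auto
    also have "\<dots> = a ^ (n - 1)" using \<open>i \<in> {..<n}\<close> by (simp flip: power_add)
    finally show "b ^ (n - Suc i) * a ^ i \<le> a ^ (n - 1)" .
  qed (use assms in auto)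
  finally show ?thesis by (simp add: mult.commute mult.left_commute)
qed

text \<open>Balls of radius h / 2 about the points of \<open>T\<close> are disjoint and lie in the
  shell between the radii 1 - h / 2 and 1 + h / 2, whose volume is of order \<open>h\<close>.
  Comparing volumes costs one power of \<open>h\<close>.\<close>

lemma sphere_packing:
  fixes T :: "'a::euclidean_space set" and h :: real
  assumes T: "finite T" "T \<subseteq> sphere 0 1" and h: "0 < h" "h \<le> 1"
    and sep: "\<And>s t. s \<in> T \<Longrightarrow> t \<in> T \<Longrightarrow> s \<noteq> t \<Longrightarrow> h \<le> dist s t"
  shows "card T * h ^ (DIM('a) - 1) \<le> DIM('a) * 4 ^ DIM('a)"
proof -
  let ?d = "DIM('a)" and ?V = "unit_ball_vol (real DIM('a))"
  have V: "0 < ?V" by simp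
  obtain k where k: "?d = Suc k" using DIM_positive[where 'a = 'a] by (metis gr0_implies_Suc)
  let ?S = "cball (0::'a) (1 + h/2) - ball 0 (1 - h/2)"
  have sub: "(\<Union>t\<in>T. ball t (h/2)) \<subseteq> ?S"
  proof
    fix x assume "x \<in> (\<Union>t\<in>T. ball t (h/2))"
    then obtain t where t: "t \<in> T" "norm (t - x) < h/2" by (auto simp: dist_norm)
    then have "norm t = 1" using T by auto
    then have "norm x \<le> 1 + h/2" "1 - h/2 \<le> norm x" using t norm_triangle_ineq3[of t x] by linarith+
    then show "x \<in> ?S" by (auto simp: dist_norm)
  qed
  have "card T * (?V * (h/2) ^ ?d) = measure lborel (\<Union>t\<in>T. ball t (h/2))"
    using T h sep by (intro measure_separated_balls[symmetric]) auto
  also have "\<dots> \<le> measure lborel ?S"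
  proof (rule measure_mono_fmeasurable[OF sub])
    have "cball (0::'a) (1 + h/2) \<in> fmeasurable lborel"
      using emeasure_lborel_cball_finite[of "0::'a" "1 + h/2"] by (intro fmeasurableI) auto
    then show "?S \<in> fmeasurable lborel" 
      using emeasure_lborel_ball_finite[of "0::'a" "1 - h/2"]
      by (intro fmeasurable.Diff) (auto intro!: fmeasurableI)
    show "(\<Union>t\<in>T. ball t (h/2)) \<in> sets lborel" by (simp add: borel_open open_UN)
  qed
  also have "\<dots> = measure lborel (cball (0::'a) (1 + h/2)) - measure lborel (ball (0::'a) (1 - h/2))"
  proof (rule measure_Diff)
    have "ball (0::'a) (1 - h/2) \<subseteq> ball 0 (1 + h/2)" using h by (intro subset_ball) simp
    then show "ball (0::'a) (1 - h/2) \<subseteq> cball 0 (1 + h/2)" using ball_subset_cball by blast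
  qed (use h emeasure_lborel_cball_finite in \<open>auto simp: less_top[symmetric]\<close>)
  also have "\<dots> = ?V * ((1 + h/2) ^ ?d - (1 - h/2) ^ ?d)"
    using h by (simp add: content_ball content_cball right_diff_distrib)
  also have "\<dots> \<le> ?V * (?d * h * 2 ^ (?d - 1))"
  proof (rule mult_left_mono)
    have "(1 + h/2) ^ ?d - (1 - h/2) ^ ?d \<le> ?d * ((1 + h/2) - (1 - h/2)) * (1 + h/2) ^ (?d - 1)"
      using h by (intro power_diff_le) auto
    also have "\<dots> \<le> ?d * h * 2 ^ (?d - 1)"
      using h by (intro mult_mono power_mono) auto
    finally show "(1 + h/2) ^ ?d - (1 - h/2) ^ ?d \<le> ?d * h * 2 ^ (?d - 1)" .
  qed (use V in auto)
  finally have "?V * (card T * (h/2) ^ ?d) \<le> ?V * (?d * h * 2 ^ (?d - 1))"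
    by (simp add: mult.commute mult.left_commute)
  then have "card T * (h/2) ^ ?d \<le> ?d * h * 2 ^ (?d - 1)" using V by (subst (asm) mult_le_cancel_left_pos)
  then have "card T * (h * h ^ k / (2 * 2 ^ k)) \<le> ?d * h * 2 ^ k" by (simp add: k power_divide)
  then have "h * (card T * h ^ k) \<le> h * (?d * (2 * 2 ^ k * 2 ^ k))"
    by (simp add: field_simps)
  then have "card T * h ^ k \<le> ?d * (2 * 2 ^ k * 2 ^ k)" using h by (subst (asm) mult_le_cancel_left_pos)
  also have "\<dots> \<le> ?d * 4 ^ Suc k"
    by (simp add: power_mult_distrib[symmetric] flip: power_mult_distrib)
  finally show ?thesis by (simp add: k)
qed

text \<open>A maximal \<open>h\<close>-separated subset of the sphere, which exists because packings
  are bounded in size, is an \<open>h\<close>-net. Its balls of radius \<open>h\<close> cover the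
  sphere with diameters at most 2h, and the packing bound makes their cost independent of
  \<open>h\<close>.\<close>

lemma hausdorff_content_sphere_le:
  assumes d: "2 \<le> DIM('a::euclidean_space)" and h: "0 < h" "h \<le> 1"
  shows "hausdorff_content (DIM('a) - 1) (2 * h) (sphere (0::'a) 1) \<le> ennreal (DIM('a) * 8 ^ DIM('a))"
proof -
  let ?k = "DIM('a) - 1"
  define P where "P T \<longleftrightarrow> finite T \<and> T \<subseteq> sphere (0::'a) 1 \<and> (\<forall>s\<in>T. \<forall>t\<in>T. s \<noteq> t \<longrightarrow> h \<le> dist s t)" for T
  have bound: "card T * h ^ ?k \<le> DIM('a) * 4 ^ DIM('a)" if "P T" for T
    using that h unfolding P_def by (intro sphere_packing) auto
  have "\<exists>T. P T \<and> (\<forall>T'. P T' \<longrightarrow> card T' \<le> card T)"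
  proof (rule ex_has_greatest_nat)
    show "P {}" by (simp add: P_def)
    show "\<forall>T. P T \<longrightarrow> card T < nat \<lceil>DIM('a) * 4 ^ DIM('a) / h ^ ?k\<rceil> + 1"
    proof (intro allI impI)
      fix T assume "P T"
      then have "card T \<le> DIM('a) * 4 ^ DIM('a) / h ^ ?k"
        using bound h by (simp add: field_simps)
      then show "card T < nat \<lceil>DIM('a) * 4 ^ DIM('a) / h ^ ?k\<rceil> + 1" by linarith
    qed
  qed
  then obtain T where T: "P T" and max: "\<And>T'. P T' \<Longrightarrow> card T' \<le> card T" by blast
  have fT: "finite T" using T by (simp add: P_def)
  obtain f where f: "bij_betw f {..<card T} T" using fT by (metis ex_bij_betw_nat_finite atLeast0LessThan)
  define U where "U i = (if i < card T then cball (f i) h else {})" for i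
  have cov: "sphere 0 1 \<subseteq> (\<Union>i. U i)"
  proof
    fix y :: 'a assume y: "y \<in> sphere 0 1"
    have "\<exists>t\<in>T. dist t y \<le> h"
    proof (rule ccontr)
      assume no: "\<not> ?thesis"
      then have "y \<notin> T" using h by force
      moreover have "P (insert y T)" using T y no by (auto simp: P_def dist_commute not_le less_imp_le)
      ultimately show False using max[of "insert y T"] fT by simp
    qed
    then obtain t where t: "t \<in> T" "dist t y \<le> h" by blast
    then obtain i where "i < card T" "f i = t" using f by (metis bij_betw_iff_bijections lessThan_iff)
    then have "y \<in> U i" using t by (simp add: U_def)
    then show "y \<in> (\<Union>i. U i)" by blast
  qed
  have "hausdorff_content ?k (2 * h) (sphere (0::'a) 1)
      \<le> (\<Sum>i. if U i = {} then 0 else ennreal (diameter (U i) ^ ?k))"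
    using cov h by (intro hausdorff_content_le) (auto simp: U_def)
  also have "\<dots> \<le> (\<Sum>i. if i < card T then ennreal ((2 * h) ^ ?k) else 0)"
    using h by (intro suminf_le) (auto simp: U_def)
  also have "\<dots> = (\<Sum>i<card T. ennreal ((2 * h) ^ ?k))"
    by (subst suminf_finite[of "{..<card T}"]) auto
  also have "\<dots> = ennreal (card T * (2 * h) ^ ?k)" using h by (simp add: ennreal_mult ennreal_of_nat_eq_real_of_nat)
  also have "\<dots> \<le> ennreal (DIM('a) * 8 ^ DIM('a))"
  proof (rule ennreal_leI)
    have "card T * (2 * h) ^ ?k = 2 ^ ?k * (card T * h ^ ?k)" by (simp add: power_mult_distrib)
    also have "\<dots> \<le> 2 ^ DIM('a) * real (DIM('a) * 4 ^ DIM('a))"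
    proof (rule mult_mono)
      show "card T * h ^ ?k \<le> real (DIM('a) * 4 ^ DIM('a))" using bound[OF T] by simp
    qed (use h in \<open>auto intro: power_increasing\<close>)
    also have "\<dots> = DIM('a) * (2 * 4) ^ DIM('a)" unfolding power_mult_distrib by simp
    finally show "card T * (2 * h) ^ ?k \<le> DIM('a) * 8 ^ DIM('a)" by simp
  qed
  finally show ?thesis .
qed

lemma hausdorff_measure_sphere_finite:
  assumes d: "2 \<le> DIM('a::euclidean_space)"
  shows "emeasure (hausdorff_measure (DIM('a) - 1)) (sphere (0::'a) 1) < \<infinity>"
proof -
  have "emeasure (hausdorff_measure (DIM('a) - 1)) (sphere (0::'a) 1) \<le> ennreal (DIM('a) * 8 ^ DIM('a))"
  proof (subst emeasure_hausdorff_measure, simp, rule SUP_least)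
    fix \<delta> :: real assume \<delta>: "\<delta> \<in> {0<..}"
    have "hausdorff_content (DIM('a) - 1) \<delta> (sphere (0::'a) 1)
        \<le> hausdorff_content (DIM('a) - 1) (2 * min 1 (\<delta>/2)) (sphere (0::'a) 1)"
      by (intro hausdorff_content_antimono) auto
    also have "\<dots> \<le> ennreal (DIM('a) * 8 ^ DIM('a))"
      using \<delta> d by (intro hausdorff_content_sphere_le) auto
    finally show "hausdorff_content (DIM('a) - 1) \<delta> (sphere (0::'a) 1) \<le> ennreal (DIM('a) * 8 ^ DIM('a))" .
  qed
  then show ?thesis by (auto intro: le_less_trans)
qed

section \<open>Lower bound on caps by comparison with the volume of cones\<close>

lemma cone_cover:
  fixes y :: "'a::euclidean_space"
  assumes y: "norm y = 1" and r: "0 < r" "r \<le> 1"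
  shows "\<exists>W\<in>sets lborel. (\<forall>t x. 0 \<le> t \<longrightarrow> t \<le> 1 \<longrightarrow> dist y x \<le> r \<longrightarrow> t *\<^sub>R x \<in> W)
    \<and> emeasure lborel W \<le> ennreal (3 * 2 ^ DIM('a) * unit_ball_vol (DIM('a)) * r ^ (DIM('a) - 1))"
proof -
  let ?V = "unit_ball_vol (real DIM('a))"
  have V: "0 < ?V" by simp
  obtain k where k: "DIM('a) = Suc k" using DIM_positive[where 'a = 'a] by (metis gr0_implies_Suc)
  define m where "m = nat \<lceil>1 / r\<rceil>"
  have m: "1 / r \<le> m" "m \<le> 1 / r + 1" using r unfolding m_def by (auto simp: of_nat_nat) 
  have m0: "0 < m" using m(1) r by (metis divide_pos_pos gr0I not_le of_nat_0 zero_less_one)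
  \<comment> \<open>The cone over a patch of radius \<open>r\<close> around \<open>y\<close> lies in
    a tube of radius 2r about the segment from 0 to \<open>y\<close>. As m is of order 1 / r,
    neighbouring centres are at most \<open>r\<close> apart, and the m + 1 balls have total volume
    of order \<open>r ^ (DIM('a) - 1)\<close>.\<close>
  define W where "W = (\<Union>j\<le>m. cball ((real j / m) *\<^sub>R y) (2 * r))"
  have "t *\<^sub>R x \<in> W" if t: "0 \<le> t" "t \<le> 1" and x: "dist y x \<le> r" for t x
  proof -
    define j where "j = nat \<lfloor>t * m\<rfloor>"
    have j: "real j \<le> t * m" "t * m < real j + 1" using t by (auto simp: j_def)
    have "t * m \<le> m" using t by (simp add: mult_left_le_one_le)
    then have jm: "j \<le> m" using j by linarith
    have "real j / m \<le> t" "t < (real j + 1) / m"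
      using j m0 by (auto simp: pos_divide_le_eq pos_less_divide_eq)
    then have "\<bar>t - real j / m\<bar> \<le> 1 / m" by (simp add: add_divide_distrib abs_le_iff)
    also have "\<dots> \<le> r" using m(1) r m0 by (simp add: field_simps)
    finally have tj: "\<bar>t - real j / m\<bar> \<le> r" .
    have "(real j / m) *\<^sub>R y - t *\<^sub>R x = t *\<^sub>R (y - x) - (t - real j / m) *\<^sub>R y"
      by (simp add: algebra_simps)
    then have "norm ((real j / m) *\<^sub>R y - t *\<^sub>R x) \<le> norm (t *\<^sub>R (y - x)) + norm ((t - real j / m) *\<^sub>R y)"
      by (metis norm_triangle_ineq4)
    also have "\<dots> \<le> 1 * r + r"
    proof (rule add_mono)
      show "norm (t *\<^sub>R (y - x)) \<le> 1 * r"
        using t x r mult_mono[of t 1 "norm (y - x)" r] by (simp add: dist_norm)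
    qed (use tj y in simp)
    finally show ?thesis using jm by (auto simp: W_def dist_norm)
  qed
  moreover have "emeasure lborel W \<le> ennreal (3 * 2 ^ DIM('a) * ?V * r ^ (DIM('a) - 1))"
  proof -
    have "emeasure lborel W \<le> (\<Sum>j\<le>m. emeasure lborel (cball ((real j / m) *\<^sub>R y) (2 * r)))"
      unfolding W_def by (intro emeasure_subadditive_finite) auto
    also have "\<dots> = ennreal ((real m + 1) * (?V * (2 * r) ^ DIM('a)))"
      using r by (simp add: emeasure_cball ennreal_mult' ennreal_of_nat_eq_real_of_nat add.commute flip: ennreal_plus ennreal_1)
    also have "\<dots> \<le> ennreal (3 * 2 ^ DIM('a) * ?V * r ^ (DIM('a) - 1))"
    proof (rule ennreal_leI)
      have "1 \<le> 1 / r" using r by simp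
      then have "real m + 1 \<le> 3 * (1 / r)" using m(2) by linarith
      then have "(real m + 1) * (?V * (2 * r) ^ DIM('a)) \<le> (3 / r) * (?V * (2 * r) ^ DIM('a))"
        using V r by (intro mult_right_mono) auto
      also have "\<dots> = 3 * 2 ^ DIM('a) * ?V * r ^ (DIM('a) - 1)"
        using r by (simp add: k power_mult_distrib)
      finally show "(real m + 1) * (?V * (2 * r) ^ DIM('a)) \<le> 3 * 2 ^ DIM('a) * ?V * r ^ (DIM('a) - 1)" .
    qed
    finally show ?thesis .
  qed
  moreover have "W \<in> sets lborel" by (auto simp: W_def)
  ultimately show ?thesis by blast
qed

lemma le_mult_of_divide_le_ennreal:
  assumes "0 < c" "x / ennreal c \<le> y"
  shows "x \<le> ennreal c * y"
proof -
  have "x = ennreal c * (x / ennreal c)"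
    using assms(1) by (simp add: ennreal_times_divide ennreal_mult_divide_eq mult.commute)
  also have "\<dots> \<le> ennreal c * y" using assms(2) by (rule mult_left_mono) simp
  finally show ?thesis .
qed

text \<open>Coning a cover of \<open>A\<close> gives a cover of \<open>B\<close>, and by
  \<open>cone_cover\<close> the cone over a piece of diameter r has volume at most a constant times
  r to the power d - 1. Volume therefore bounds the content from below.\<close>

lemma hausdorff_content_ge_cone:
  fixes A :: "'a::euclidean_space set"
  assumes d: "2 \<le> DIM('a)" and A: "A \<subseteq> sphere 0 1"
    and B: "B \<in> sets lborel" "B \<subseteq> {t *\<^sub>R x | t x. 0 \<le> t \<and> t \<le> 1 \<and> x \<in> A}"
  shows "emeasure lborel B \<le> ennreal (3 * 2 ^ DIM('a) * unit_ball_vol (DIM('a))) * hausdorff_content (DIM('a) - 1) 1 A"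
proof -
  let ?c = "3 * 2 ^ DIM('a) * unit_ball_vol (real DIM('a))" and ?k = "DIM('a) - 1"
  let ?h = "\<lambda>U :: 'a set. if U = {} then 0 else ennreal (diameter U ^ ?k)"
  have c: "0 < ?c" by simp
  have main: "emeasure lborel B \<le> ennreal ?c * (\<Sum>i. ?h (U i))"
    if U: "A \<subseteq> (\<Union>i. U i)" "\<And>i. bounded (U i)" "\<And>i. diameter (U i) \<le> 1" for U :: "nat \<Rightarrow> 'a set"
  proof (rule ennreal_le_epsilon)
    fix e :: real assume e: "0 < e"
    define q where "q i = (e / ?c) * (1/2) ^ Suc i" for i
    have q: "0 < q i" for i using e c by (simp add: q_def)
    have "\<forall>i. \<exists>W\<in>sets lborel. (\<forall>t x. 0 \<le> t \<longrightarrow> t \<le> 1 \<longrightarrow> x \<in> U i \<inter> A \<longrightarrow> t *\<^sub>R x \<in> W)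
        \<and> emeasure lborel W \<le> ennreal ?c * (?h (U i) + ennreal (q i))"
    proof
      fix i
      show "\<exists>W\<in>sets lborel. (\<forall>t x. 0 \<le> t \<longrightarrow> t \<le> 1 \<longrightarrow> x \<in> U i \<inter> A \<longrightarrow> t *\<^sub>R x \<in> W)
        \<and> emeasure lborel W \<le> ennreal ?c * (?h (U i) + ennreal (q i))"
      proof (cases "U i \<inter> A = {}")
        case True then show ?thesis by (intro bexI[of _ "{}"]) auto
      next
        case False
        then obtain y where y: "y \<in> U i" "y \<in> A" by blast
        \<comment> \<open>\<open>cone_cover\<close> asks for a positive radius. A member of diameter
          0 gets the radius \<open>min 1 (q i)\<close>; since d - 1 \<ge> 1 this costs at most the
          summable error \<open>q i\<close>.\<close>
        define r where "r = (if diameter (U i) = 0 then min 1 (q i) else diameter (U i))"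
        have r: "0 < r" "r \<le> 1" "diameter (U i) \<le> r"
          using q[of i] U(3)[of i] diameter_ge_0[OF U(2)[of i]] by (auto simp: r_def)
        have rk: "r ^ ?k \<le> diameter (U i) ^ ?k + q i"
        proof (cases "diameter (U i) = 0")
          case True
          have "r ^ ?k \<le> r ^ 1" using r d by (intro power_decreasing) auto
          moreover have "r \<le> q i" by (simp add: r_def True)
          moreover have "0 \<le> diameter (U i) ^ ?k" by (simp add: True)
          ultimately show ?thesis unfolding power_one_right by linarith
        qed (use q[of i] in \<open>simp add: r_def\<close>)
        obtain W where W: "W \<in> sets lborel" "\<And>t x. 0 \<le> t \<Longrightarrow> t \<le> 1 \<Longrightarrow> dist y x \<le> r \<Longrightarrow> t *\<^sub>R x \<in> W"
            "emeasure lborel W \<le> ennreal (?c * r ^ ?k)"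
        proof -
          have "norm y = 1" using y A by auto
          from cone_cover[OF this r(1,2)] show thesis using that by blast
        qed
        have "dist y x \<le> r" if "x \<in> U i" for x
          using diameter_bounded_bound[OF U(2) y(1) that] r by linarith
        moreover have "ennreal (?c * r ^ ?k) \<le> ennreal ?c * (?h (U i) + ennreal (q i))"
        proof -
          have "ennreal (?c * r ^ ?k) \<le> ennreal (?c * (diameter (U i) ^ ?k + q i))"
            using rk c by (intro ennreal_leI mult_left_mono) auto
          also have "\<dots> = ennreal ?c * (?h (U i) + ennreal (q i))"
            using y q[of i] c diameter_ge_0[OF U(2)[of i]] by (subst ennreal_mult) (auto simp: ennreal_plus)
          finally show ?thesis .
        qed
        ultimately show ?thesis using W by (intro bexI[of _ W]) (auto intro: order_trans)
      qed
    qed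
    from choice[OF this[unfolded Bex_def]] obtain W where W: "\<And>i. W i \<in> sets lborel"
      "\<And>i t x. 0 \<le> t \<Longrightarrow> t \<le> 1 \<Longrightarrow> x \<in> U i \<Longrightarrow> x \<in> A \<Longrightarrow> t *\<^sub>R x \<in> W i"
      "\<And>i. emeasure lborel (W i) \<le> ennreal ?c * (?h (U i) + ennreal (q i))"
      by blast
    have "B \<subseteq> (\<Union>i. W i)"
    proof
      fix b assume "b \<in> B"
      then obtain t x where tx: "b = t *\<^sub>R x" "0 \<le> t" "t \<le> 1" "x \<in> A" using B(2) by blast
      then obtain i where "x \<in> U i" using U(1) by blast
      then show "b \<in> (\<Union>i. W i)" using W(2) tx by blast
    qed
    then have "emeasure lborel B \<le> emeasure lborel (\<Union>i. W i)"
      using W(1) by (intro emeasure_mono) auto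
    also have "\<dots> \<le> (\<Sum>i. emeasure lborel (W i))" using W(1) by (intro emeasure_subadditive_countably) auto
    also have "\<dots> \<le> (\<Sum>i. ennreal ?c * (?h (U i) + ennreal (q i)))" by (intro suminf_le W) auto
    also have "\<dots> = ennreal ?c * ((\<Sum>i. ?h (U i)) + (\<Sum>i. ennreal (q i)))"
      by (subst ennreal_suminf_cmult) (auto simp: suminf_add)
    also have "(\<Sum>i. ennreal (q i)) = ennreal (e / ?c)"
    proof -
      have "q sums (e / ?c * 1)" unfolding q_def by (rule sums_mult) (rule power_half_series)
      then show ?thesis using q e c by (subst suminf_ennreal2) (auto simp: sums_iff less_imp_le)
    qed
    also have "ennreal ?c * ((\<Sum>i. ?h (U i)) + ennreal (e / ?c)) = ennreal ?c * (\<Sum>i. ?h (U i)) + ennreal e"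
    proof -
      have "?c * (e / ?c) = e" using c by (metis less_irrefl nonzero_mult_div_cancel_left times_divide_eq_right)
      then show ?thesis unfolding distrib_left using c e ennreal_mult'[of ?c "e / ?c"] by simp
    qed
    finally show "emeasure lborel B \<le> ennreal ?c * (\<Sum>i. ?h (U i)) + ennreal e" .
  qed
  have "emeasure lborel B / ennreal ?c \<le> hausdorff_content ?k 1 A"
    unfolding hausdorff_content_def
  proof (rule INF_greatest)
    fix U :: "nat \<Rightarrow> 'a set" assume "U \<in> {U. A \<subseteq> (\<Union>i. U i) \<and> (\<forall>i. bounded (U i) \<and> diameter (U i) \<le> 1)}"
    then have "emeasure lborel B \<le> ennreal ?c * (\<Sum>i. ?h (U i))" by (intro main) auto
    then show "emeasure lborel B / ennreal ?c \<le> (\<Sum>i. ?h (U i))"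
      using c by (intro divide_le_posI_ennreal) (auto simp: mult.commute)
  qed
  then show ?thesis by (rule le_mult_of_divide_le_ennreal[OF c])
qed

text \<open>The ball of radius r / 8 about 3u / 4 lies in the cone over the cap: its points have
  norm between 1 / 2 and 1, and projected to the sphere they are within r / 2 of \<open>u\<close>.
  The factor 3 / 4 keeps the ball inside the unit ball and away from 0.\<close>

lemma hausdorff_measure_cap_ge:
  fixes u :: "'a::euclidean_space"
  assumes d: "2 \<le> DIM('a)" and r: "0 < r" "r \<le> 1" and u: "norm u = 1"
  shows "emeasure lborel (ball (0::'a) (r/8))
    \<le> ennreal (3 * 2 ^ DIM('a) * unit_ball_vol (DIM('a))) * emeasure (hausdorff_measure (DIM('a) - 1)) (sphere 0 1 \<inter> ball u r)"
proof -
  have "emeasure lborel (ball (0::'a) (r/8)) = emeasure lborel (ball ((3/4) *\<^sub>R u) (r/8))"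
    using r by (simp add: emeasure_ball)
  also have "\<dots> \<le> ennreal (3 * 2 ^ DIM('a) * unit_ball_vol (DIM('a))) * hausdorff_content (DIM('a) - 1) 1 (sphere 0 1 \<inter> ball u r)"
  proof (rule hausdorff_content_ge_cone)
    show "ball ((3/4) *\<^sub>R u) (r/8) \<subseteq> {t *\<^sub>R x |t x. 0 \<le> t \<and> t \<le> 1 \<and> x \<in> sphere 0 1 \<inter> ball u r}"
    proof
      fix z assume "z \<in> ball ((3/4) *\<^sub>R u) (r/8)"
      then have z: "norm (z - (3/4) *\<^sub>R u) < r/8" by (simp add: dist_norm norm_minus_commute)
      have n: "\<bar>norm z - 3/4\<bar> < r/8" using norm_triangle_ineq3[of z "(3/4) *\<^sub>R u"] z u by simp
      then have "norm z - 3/4 < r/8" "- (norm z - 3/4) < r/8" unfolding abs_less_iff by blast+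
      then have n2: "1/2 \<le> norm z" "norm z \<le> 1" using r by linarith+
      define x where "x = (1 / norm z) *\<^sub>R z"
      have zx: "z = norm z *\<^sub>R x" "norm x = 1" using n2 by (auto simp: x_def)
      have "z - norm z *\<^sub>R u = (z - (3/4) *\<^sub>R u) - (norm z - 3/4) *\<^sub>R u" by (simp add: algebra_simps)
      then have "norm (z - norm z *\<^sub>R u) \<le> norm (z - (3/4) *\<^sub>R u) + norm ((norm z - 3/4) *\<^sub>R u)"
        by (metis norm_triangle_ineq4)
      also have "\<dots> < r/8 + r/8" using z n u by simp
      finally have "norm (z - norm z *\<^sub>R u) < r/4" by simp
      moreover have "norm (z - norm z *\<^sub>R u) = norm z * norm (x - u)"
        by (subst (1) zx(1)) (simp add: flip: scaleR_diff_right)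
      ultimately have "norm z * norm (x - u) < r/4" by simp
      moreover have "1/2 * norm (x - u) \<le> norm z * norm (x - u)" using n2 by (intro mult_right_mono) auto
      ultimately have "norm (x - u) < r" using r by linarith
      then show "z \<in> {t *\<^sub>R x |t x. 0 \<le> t \<and> t \<le> 1 \<and> x \<in> sphere 0 1 \<inter> ball u r}"
        using zx n2 by (auto simp: dist_norm norm_minus_commute intro!: exI[of _ "norm z"] exI[of _ x])
    qed
  qed (use d in auto)
  also have "\<dots> \<le> ennreal (3 * 2 ^ DIM('a) * unit_ball_vol (DIM('a))) * emeasure (hausdorff_measure (DIM('a) - 1)) (sphere 0 1 \<inter> ball u r)"
    by (subst emeasure_hausdorff_measure) (auto intro!: mult_left_mono SUP_upper)
  finally show ?thesis .
qed

lemma sets_uniform_sphere [measurable_cong]: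
  "sets (uniform_sphere :: 'a::euclidean_space measure) = sets (restrict_space borel (sphere 0 1))"
  unfolding uniform_sphere_def by (simp add: sets_restrict_space)

text \<open>The bound \<open>b0 / ?c / h\<close> is the same for all \<open>u\<close> because the
  volume of a Lebesgue ball does not depend on its centre. The total mass \<open>h\<close> of the
  sphere is finite by packing and positive by the cap bound itself.\<close>

lemma uniform_sphere_props:
  assumes d: "2 \<le> DIM('a::euclidean_space)"
  shows prob_space_uniform_sphere: "prob_space (uniform_sphere :: 'a measure)"
    and uniform_sphere_cap: "0 < r \<Longrightarrow> \<exists>c>0. \<forall>u\<in>sphere (0::'a) 1. c \<le> measure uniform_sphere (sphere 0 1 \<inter> ball u r)"
proof -
  let ?H = "hausdorff_measure (DIM('a) - 1) :: 'a measure"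
  let ?R = "restrict_space ?H (sphere 0 1)"
  let ?c = "3 * 2 ^ DIM('a) * unit_ball_vol (real DIM('a))"
  have c: "0 < ?c" by simp
  have em: "emeasure ?R B = emeasure ?H B" if "B \<subseteq> sphere 0 1" for B
    using that by (subst emeasure_restrict_space) auto
  have fin: "emeasure ?R (sphere 0 1) < \<infinity>"
    using hausdorff_measure_sphere_finite[OF d] unfolding em[OF order_refl] .
  have pos: "0 < emeasure ?H (sphere 0 1 \<inter> ball u r)" if "0 < r" "r \<le> 1" "norm u = 1" for r u
  proof -
    have "0 < emeasure lborel (ball (0::'a) (r/8))" using that by (simp add: emeasure_ball)
    then have "0 < ennreal ?c * emeasure ?H (sphere 0 1 \<inter> ball u r)"
      using hausdorff_measure_cap_ge[OF d that] by (rule less_le_trans)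
    then show ?thesis by (simp add: ennreal_zero_less_mult_iff)
  qed
  obtain b :: 'a where b: "b \<in> Basis" using nonempty_Basis by blast
  have "emeasure ?H (sphere 0 1 \<inter> ball b 1) \<le> emeasure ?R (sphere 0 1)"
    by (subst em) (auto intro!: emeasure_mono)
  then have nz: "0 < emeasure ?R (sphere 0 1)" using pos[of 1 b] b by (auto intro: less_le_trans)
  show ps: "prob_space (uniform_sphere :: 'a measure)"
    unfolding uniform_sphere_def using fin nz by (intro prob_space_uniform_measure) auto
  show "\<exists>c>0. \<forall>u\<in>sphere (0::'a) 1. c \<le> measure uniform_sphere (sphere 0 1 \<inter> ball u r)" if r: "0 < r"
  proof -
    define r' where "r' = min r 1"
    have r': "0 < r'" "r' \<le> 1" "r' \<le> r" using r by (auto simp: r'_def)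
    define b0 where "b0 = measure lborel (ball (0::'a) (r'/8))"
    have b0: "0 < b0" using r' by (simp add: b0_def content_ball)
    define h where "h = measure ?R (sphere 0 1)"
    have eh: "emeasure ?R (sphere 0 1) = ennreal h" using fin by (simp add: h_def emeasure_eq_ennreal_measure less_top)
    have h: "0 < h" using nz eh by simp
    have "b0 / ?c / h \<le> measure uniform_sphere (sphere 0 1 \<inter> ball u r)" if u: "u \<in> sphere (0::'a) 1" for u
    proof -
      let ?A = "sphere 0 1 \<inter> ball u r'"
      interpret prob_space "uniform_sphere :: 'a measure" by (rule ps)
      have sb: "?A \<in> sets ?R" "sphere 0 1 \<inter> ball u r \<in> sets (uniform_sphere :: 'a measure)"
        by (auto simp: sets_restrict_space sets_uniform_sphere)
      have "emeasure ?R ?A \<le> emeasure ?R (sphere 0 1)" by (intro emeasure_mono) (auto simp: sets_restrict_space)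
      then have fA: "emeasure ?R ?A < \<infinity>" using fin by (rule le_less_trans)
      define a where "a = measure ?R ?A"
      have ea: "emeasure ?R ?A = ennreal a" using fA by (simp add: a_def emeasure_eq_ennreal_measure less_top)
      have a0: "0 \<le> a" by (simp add: a_def)
      have "ennreal b0 \<le> ennreal ?c * ennreal a"
      proof -
        have "emeasure lborel (ball (0::'a) (r'/8)) = ennreal b0"
          using emeasure_lborel_ball_finite[of "0::'a" "r'/8"]
          by (simp add: b0_def emeasure_eq_ennreal_measure less_top)
        moreover have "emeasure ?H ?A = ennreal a" using em[of ?A] ea by simp
        moreover have "norm u = 1" using u by simp
        ultimately show ?thesis using hausdorff_measure_cap_ge[OF d r'(1,2), of u] by simp
      qed
      then have "b0 \<le> ?c * a" using a0 c by (simp add: flip: ennreal_mult)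
      then have "b0 / ?c \<le> a" using c by (simp add: divide_le_eq mult.commute)
      then have "b0 / ?c / h \<le> a / h" using h by (intro divide_right_mono) auto
      also have "a / h = measure uniform_sphere ?A"
      proof -
        have "emeasure uniform_sphere ?A = emeasure ?R (sphere 0 1 \<inter> ?A) / emeasure ?R (sphere 0 1)"
          unfolding uniform_sphere_def using sb(1) by (intro emeasure_uniform_measure) (auto simp: sets_restrict_space)
        also have "sphere 0 1 \<inter> ?A = ?A" by auto
        finally show ?thesis using a0 h unfolding measure_def ea eh by (simp add: divide_ennreal)
      qed
      also have "\<dots> \<le> measure uniform_sphere (sphere 0 1 \<inter> ball u r)"
        using sb(2) r' by (intro finite_measure_mono) auto
      finally show ?thesis .
    qed
    moreover have "0 < b0 / ?c / h" using b0 c h by simp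
    ultimately show ?thesis by blast
  qed
qed

section \<open>Existence of Poisson point processes\<close>

definition poisson_density :: "real \<Rightarrow> nat \<Rightarrow> real" where
  "poisson_density a k = exp (- a) * a ^ k / fact k"

lemma poisson_density_sums: "poisson_density a sums 1"
proof -
  have "(\<lambda>n. exp (- a) * (a ^ n /\<^sub>R fact n)) sums (exp (- a) * exp a)"
    by (intro sums_mult exp_converges)
  then show ?thesis by (simp add: poisson_density_def[abs_def] exp_minus divide_inverse mult.commute mult.left_commute)
qed

lemma poisson_density_add:
  "poisson_density (a + b) n = (\<Sum>k\<le>n. poisson_density a k * poisson_density b (n - k))"
proof -
  have "(\<Sum>k\<le>n. poisson_density a k * poisson_density b (n - k))
      = (\<Sum>k\<le>n. exp (- (a + b)) / fact n * (of_nat (n choose k) * a ^ k * b ^ (n - k)))"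
    by (intro sum.cong refl) (simp add: poisson_density_def binomial_fact exp_add exp_diff exp_minus field_simps)
  also have "\<dots> = exp (- (a + b)) / fact n * (a + b) ^ n"
    by (simp only: sum_distrib_left[symmetric] binomial_ring)
  finally show ?thesis by (simp add: poisson_density_def)
qed

text \<open>A multinomial count: \<open>l\<close> is a word of length \<open>n\<close> in which each
  letter \<open>j\<close> occurs \<open>k j\<close> times. Splitting off the last letter
  \<open>y\<close> lowers \<open>k y\<close> by one and produces a factor \<open>k y\<close>; these
  factors add up to n + 1 and raise the factorial.\<close>

lemma sum_multinomial:
  fixes q :: "'j \<Rightarrow> real"
  assumes J: "finite J"
  shows "(\<Sum>l | l \<in> {..<n} \<rightarrow>\<^sub>E J \<and> (\<forall>j\<in>J. (\<Sum>i<n. if l i = j then 1 else 0) = k j). \<Prod>i<n. q (l i))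
    = (if (\<Sum>j\<in>J. k j) = n then fact n * (\<Prod>j\<in>J. q j ^ k j / fact (k j)) else 0)"
proof (induction n arbitrary: k)
  case 0
  show ?case
  proof (cases "\<forall>j\<in>J. k j = 0")
    case True
    then have "{l. l \<in> {..<0::nat} \<rightarrow>\<^sub>E J \<and> (\<forall>j\<in>J. (\<Sum>i<0. if l i = j then 1 else 0) = k j)} = {\<lambda>_. undefined}"
      by auto
    then show ?thesis using True by (simp add: J)
  next
    case False
    then have "{l. l \<in> {..<0::nat} \<rightarrow>\<^sub>E J \<and> (\<forall>j\<in>J. (\<Sum>i<0. if l i = j then 1 else 0) = k j)} = {}"
      by auto
    moreover have "(\<Sum>j\<in>J. k j) \<noteq> 0" using False J by auto
    ultimately show ?thesis by simp
  qed
next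
  case (Suc n)
  let ?c = "\<lambda>(n::nat) l j. \<Sum>i<n. if l i = j then 1 else 0 :: nat"
  let ?L = "\<lambda>(n::nat) k. {l. l \<in> {..<n} \<rightarrow>\<^sub>E J \<and> (\<forall>j\<in>J. ?c n l j = k j)}"
  let ?k = "\<lambda>y. k(y := k y - 1)"
  let ?t = "\<lambda>k. \<Prod>j\<in>J. q j ^ k j / fact (k j)"
  have fin: "finite (?L n k)" for n k
    by (rule finite_subset[OF _ finite_PiE[of "{..<n}" "\<lambda>_. J"]]) (use J in auto)
  have L: "?L (Suc n) k = (\<lambda>(y, g). g(n := y)) ` (SIGMA y:{y\<in>J. 1 \<le> k y}. ?L n (?k y))"
  proof (intro equalityI subsetI)
    fix l assume l: "l \<in> ?L (Suc n) k"
    then have "l \<in> (\<lambda>(y, g). g(n := y)) ` (J \<times> ({..<n} \<rightarrow>\<^sub>E J))"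
      by (simp add: lessThan_Suc PiE_insert_eq)
    then obtain y g where yg: "y \<in> J" "g \<in> {..<n} \<rightarrow>\<^sub>E J" "l = g(n := y)" by auto
    have c: "?c (Suc n) l j = ?c n g j + (if y = j then 1 else 0)" for j
      by (simp add: yg)
    have "?c n g j + (if y = j then 1 else 0) = k j" if "j \<in> J" for j using l that c by auto
    then have "1 \<le> k y" "\<forall>j\<in>J. ?c n g j = ?k y j" using yg by force+
    then show "l \<in> (\<lambda>(y, g). g(n := y)) ` (SIGMA y:{y\<in>J. 1 \<le> k y}. ?L n (?k y))"
      using yg by (auto intro!: image_eqI[of _ _ "(y, g)"])
  next
    fix l assume "l \<in> (\<lambda>(y, g). g(n := y)) ` (SIGMA y:{y\<in>J. 1 \<le> k y}. ?L n (?k y))"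
    then obtain y g where yg: "y \<in> J" "1 \<le> k y" "g \<in> {..<n} \<rightarrow>\<^sub>E J" "\<forall>j\<in>J. ?c n g j = ?k y j" "l = g(n := y)"
      by auto
    have "l \<in> {..<Suc n} \<rightarrow>\<^sub>E J" using yg by (auto simp: lessThan_Suc PiE_insert_eq)
    moreover have "?c (Suc n) l j = k j" if "j \<in> J" for j using yg that by auto
    ultimately show "l \<in> ?L (Suc n) k" by simp
  qed
  have inj: "inj_on (\<lambda>(y, g). g(n := y)) (SIGMA y:{y\<in>J. 1 \<le> k y}. ?L n (?k y))"
    by (rule inj_on_subset[OF inj_combinator[of n "{..<n}" "\<lambda>_. J"]]) auto
  have "(\<Sum>l\<in>?L (Suc n) k. \<Prod>i<Suc n. q (l i))
      = (\<Sum>(y, g)\<in>(SIGMA y:{y\<in>J. 1 \<le> k y}. ?L n (?k y)). \<Prod>i<Suc n. q ((g(n := y)) i))"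
    unfolding L by (subst sum.reindex[OF inj]) (simp add: case_prod_beta comp_def)
  also have "\<dots> = (\<Sum>(y, g)\<in>(SIGMA y:{y\<in>J. 1 \<le> k y}. ?L n (?k y)). q y * (\<Prod>i<n. q (g i)))"
    by (intro sum.cong refl) (auto simp: mult.commute)
  also have "\<dots> = (\<Sum>y | y \<in> J \<and> 1 \<le> k y. \<Sum>g\<in>?L n (?k y). q y * (\<Prod>i<n. q (g i)))"
    using J fin by (subst sum.Sigma) auto
  also have "\<dots> = (\<Sum>y | y \<in> J \<and> 1 \<le> k y. q y * (if (\<Sum>j\<in>J. ?k y j) = n then fact n * ?t (?k y) else 0))"
    by (simp only: sum_distrib_left[symmetric] Suc.IH)
  also have "\<dots> = (\<Sum>y | y \<in> J \<and> 1 \<le> k y. if (\<Sum>j\<in>J. k j) = Suc n then fact n * (k y * ?t k) else 0)"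
  proof (intro sum.cong refl)
    fix y assume y: "y \<in> {y. y \<in> J \<and> 1 \<le> k y}"
    have 1: "(\<Sum>j\<in>J. k j) = Suc (\<Sum>j\<in>J. ?k y j)"
      using y J by (simp add: sum.remove[of J y])
    obtain m where m: "k y = Suc m" using y by (cases "k y") auto
    have 2: "q y * ?t (?k y) = k y * ?t k"
      using y J by (simp add: prod.remove[of J y] m field_simps del: of_nat_Suc)
    show "q y * (if (\<Sum>j\<in>J. ?k y j) = n then fact n * ?t (?k y) else 0)
      = (if (\<Sum>j\<in>J. k j) = Suc n then fact n * (k y * ?t k) else 0)"
      unfolding 1 2[symmetric] by simp
  qed
  also have "\<dots> = (\<Sum>y\<in>J. if (\<Sum>j\<in>J. k j) = Suc n then fact n * (k y * ?t k) else 0)"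
    using J by (intro sum.mono_neutral_left) auto
  also have "\<dots> = (if (\<Sum>j\<in>J. k j) = Suc n then fact (Suc n) * ?t k else 0)"
    by (auto simp flip: sum_distrib_left sum_distrib_right of_nat_sum)
  finally show ?case .
qed

text \<open>A sample is a number of points together with an infinite sequence of locations, of which
  only the first \<open>fst \<omega>\<close> are realized. This gives a fixed product space in spite
  of the random number of points.\<close>

definition cnt :: "'b set \<Rightarrow> nat \<times> (nat \<Rightarrow> 'b) \<Rightarrow> nat" where
  "cnt A \<omega> = (\<Sum>i<fst \<omega>. if snd \<omega> i \<in> A then 1 else 0)"

lemma measurable_cnt [measurable]:
  assumes [measurable]: "A \<in> sets Q"
  shows "cnt A \<in> measure_pmf p \<Otimes>\<^sub>M PiM UNIV (\<lambda>_. Q) \<rightarrow>\<^sub>M count_space UNIV"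
proof -
  have "(\<lambda>\<omega>. (\<lambda>n \<omega>. \<Sum>i<n. if snd \<omega> i \<in> A then 1 else 0 :: nat) (fst \<omega>) \<omega>)
      \<in> measure_pmf p \<Otimes>\<^sub>M PiM UNIV (\<lambda>_. Q) \<rightarrow>\<^sub>M count_space UNIV"
    by (rule measurable_compose_countable) measurable
  then show ?thesis by (simp add: cnt_def[abs_def])
qed

text \<open>For a partition the counts determine the total number \<open>s\<close> of points, so the
  event is \<open>{s}\<close> times the set of sequences whose cell labels form an admissible word.
  In the product of the Poisson and the multinomial weight \<open>fact s\<close> cancels, and the
  exponential factorizes because the cells exhaust the space.\<close>

lemma poisson_thinning_exact:
  fixes Q :: "'b measure" and A :: "'j \<Rightarrow> 'b set"
  assumes Q: "prob_space Q" and \<nu>: "0 < \<nu>" and J: "finite J"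
    and A: "\<And>j. j \<in> J \<Longrightarrow> A j \<in> sets Q" and disj: "disjoint_family_on A J" and cov: "(\<Union>j\<in>J. A j) = space Q"
  defines "\<Omega> \<equiv> measure_pmf (poisson_pmf \<nu>) \<Otimes>\<^sub>M PiM UNIV (\<lambda>_::nat. Q)"
  shows "measure \<Omega> {\<omega>\<in>space \<Omega>. \<forall>j\<in>J. cnt (A j) \<omega> = k j} = (\<Prod>j\<in>J. poisson_density (\<nu> * measure Q (A j)) (k j))"
proof -
  interpret Q: prob_space Q by (rule Q)
  interpret P: product_prob_space "\<lambda>_::nat. Q" UNIV ..
  interpret S: pair_prob_space "measure_pmf (poisson_pmf \<nu>)" "PiM UNIV (\<lambda>_::nat. Q)" ..
  define s where "s = (\<Sum>j\<in>J. k j)"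
  let ?X = "PiM UNIV (\<lambda>_::nat. Q)"
  let ?q = "\<lambda>j. measure Q (A j)"
  let ?c = "\<lambda>l j. \<Sum>i<s. if l i = j then 1 else 0 :: nat"
  let ?L = "{l. l \<in> {..<s} \<rightarrow>\<^sub>E J \<and> (\<forall>j\<in>J. ?c l j = k j)}"
  let ?B = "\<lambda>l. {x\<in>space ?X. \<forall>i\<in>{..<s}. x i \<in> A (l i)}"
  have finL: "finite ?L" by (rule finite_subset[OF _ finite_PiE[of "{..<s}" "\<lambda>_. J"]]) (use J in auto)
  have total: "(\<Sum>j\<in>J. cnt (A j) \<omega>) = fst \<omega>" if "\<omega> \<in> space \<Omega>" for \<omega>
  proof -
    have x: "snd \<omega> i \<in> space Q" for i using that by (auto simp: \<Omega>_def space_pair_measure space_PiM)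
    have one: "(\<Sum>j\<in>J. if x \<in> A j then 1 else 0 :: nat) = 1" if "x \<in> space Q" for x
    proof -
      have "x \<in> (\<Union>j\<in>J. A j)" using that by (simp add: cov)
      then obtain j0 where j0: "j0 \<in> J" "x \<in> A j0" by blast
      have "(\<Sum>j\<in>J. if x \<in> A j then 1 else 0 :: nat) = (\<Sum>j\<in>J. if j = j0 then 1 else 0)"
        using disj j0 by (intro sum.cong) (auto simp: disjoint_family_on_def)
      then show ?thesis using j0 J by simp
    qed
    have "(\<Sum>j\<in>J. cnt (A j) \<omega>) = (\<Sum>i<fst \<omega>. \<Sum>j\<in>J. if snd \<omega> i \<in> A j then 1 else 0)"
      unfolding cnt_def by (rule sum.swap)
    then show ?thesis using one[OF x] by simp
  qed
  have xl: "x i \<in> A j \<longleftrightarrow> l i = j" if "x \<in> ?B l" "l \<in> {..<s} \<rightarrow>\<^sub>E J" "j \<in> J" "i < s" for x i j l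
  proof -
    have "l i \<in> J" "x i \<in> A (l i)" using that by auto
    then show ?thesis using disj that(3) by (auto simp: disjoint_family_on_def)
  qed
  have ev: "{\<omega>\<in>space \<Omega>. \<forall>j\<in>J. cnt (A j) \<omega> = k j} = {s} \<times> (\<Union>l\<in>?L. ?B l)"
  proof (intro equalityI subsetI)
    fix \<omega> assume \<omega>: "\<omega> \<in> {\<omega>\<in>space \<Omega>. \<forall>j\<in>J. cnt (A j) \<omega> = k j}"
    then have fs: "fst \<omega> = s" using total[of \<omega>] by (simp add: s_def)
    have sp: "snd \<omega> \<in> space ?X" using \<omega> by (auto simp: \<Omega>_def space_pair_measure)
    have "\<forall>i. \<exists>j. j \<in> J \<and> snd \<omega> i \<in> A j"
    proof
      fix i
      have "snd \<omega> i \<in> (\<Union>j\<in>J. A j)" unfolding cov using sp by (auto simp: space_PiM)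
      then show "\<exists>j. j \<in> J \<and> snd \<omega> i \<in> A j" by blast
    qed
    from choice[OF this] obtain l where l: "\<And>i. l i \<in> J" "\<And>i. snd \<omega> i \<in> A (l i)" by blast
    define l' where "l' = restrict l {..<s}"
    have l': "l' \<in> {..<s} \<rightarrow>\<^sub>E J" "snd \<omega> \<in> ?B l'" using l sp by (auto simp: l'_def)
    have "?c l' j = k j" if "j \<in> J" for j
    proof -
      have "?c l' j = cnt (A j) \<omega>" unfolding cnt_def fs
        using xl[OF l'(2,1) that] by (intro sum.cong) auto
      then show ?thesis using \<omega> that by simp
    qed
    then show "\<omega> \<in> {s} \<times> (\<Union>l\<in>?L. ?B l)" using l' fs by (cases \<omega>) auto
  next
    fix \<omega> assume "\<omega> \<in> {s} \<times> (\<Union>l\<in>?L. ?B l)"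
    then obtain l where l: "l \<in> ?L" "snd \<omega> \<in> ?B l" "fst \<omega> = s" by (cases \<omega>) auto
    have "cnt (A j) \<omega> = k j" if "j \<in> J" for j
    proof -
      have "cnt (A j) \<omega> = ?c l j" unfolding cnt_def l(3)
        using xl[OF l(2) _ that] l(1) by (intro sum.cong) auto
      then show ?thesis using l that by simp
    qed
    then show "\<omega> \<in> {\<omega>\<in>space \<Omega>. \<forall>j\<in>J. cnt (A j) \<omega> = k j}"
      using l by (cases \<omega>) (auto simp: \<Omega>_def space_pair_measure)
  qed
  have Bm: "?B l \<in> sets ?X" if "l \<in> ?L" for l
  proof -
    have "A (l i) \<in> sets Q" if "i < s" for i using \<open>l \<in> ?L\<close> that A by auto
    then show ?thesis by (intro sets.sets_Collect_finite_All sets_Collect_single') auto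
  qed
  have PB: "measure ?X (?B l) = (\<Prod>i<s. ?q (l i))" if "l \<in> ?L" for l
  proof -
    have "A (l i) \<in> sets Q" if "i < s" for i using \<open>l \<in> ?L\<close> that A by auto
    then have "emeasure ?X (?B l) = (\<Prod>i<s. emeasure Q (A (l i)))"
      by (intro P.emeasure_PiM_Collect) auto
    then show ?thesis by (simp add: Q.emeasure_eq_measure P.P.emeasure_eq_measure prod_ennreal prod_nonneg)
  qed
  have Bdisj: "disjoint_family_on ?B ?L"
    unfolding disjoint_family_on_def
  proof (intro ballI impI, rule ccontr)
    fix l l' assume ll: "l \<in> ?L" "l' \<in> ?L" "l \<noteq> l'" "?B l \<inter> ?B l' \<noteq> {}"
    then obtain x where x: "x \<in> ?B l" "x \<in> ?B l'" by blast
    have "l i = l' i" if "i < s" for i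
      using xl[OF x(1) _ _ that, of "l' i"] x(2) ll that by auto
    then have "l = l'" using ll by (intro PiE_ext[of l "{..<s}" "\<lambda>_. J" l']) auto
    then show False using ll by simp
  qed
  have "measure \<Omega> ({s} \<times> (\<Union>l\<in>?L. ?B l)) = pmf (poisson_pmf \<nu>) s * measure ?X (\<Union>l\<in>?L. ?B l)"
  proof -
    have "emeasure \<Omega> ({s} \<times> (\<Union>l\<in>?L. ?B l)) = emeasure (measure_pmf (poisson_pmf \<nu>)) {s} * emeasure ?X (\<Union>l\<in>?L. ?B l)"
      unfolding \<Omega>_def using Bm finL by (intro P.P.emeasure_pair_measure_Times sets.finite_UN) auto
    then show ?thesis
      by (simp add: measure_def emeasure_pmf_single enn2real_mult)
  qed
  also have "measure ?X (\<Union>l\<in>?L. ?B l) = (\<Sum>l\<in>?L. measure ?X (?B l))"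
    using finL Bm Bdisj by (intro P.P.finite_measure_finite_Union) auto
  also have "\<dots> = (\<Sum>l\<in>?L. \<Prod>i<s. ?q (l i))" by (intro sum.cong refl PB)
  also have "\<dots> = fact s * (\<Prod>j\<in>J. ?q j ^ k j / fact (k j))"
    using sum_multinomial[OF J, where n = s and k = k and q = ?q] by (simp add: s_def)
  also have "pmf (poisson_pmf \<nu>) s * (fact s * (\<Prod>j\<in>J. ?q j ^ k j / fact (k j)))
      = exp (- \<nu>) * (\<Prod>j\<in>J. \<nu> ^ k j) * (\<Prod>j\<in>J. ?q j ^ k j / fact (k j))"
    using \<nu> by (simp add: s_def power_sum)
  also have "exp (- \<nu>) = (\<Prod>j\<in>J. exp (- (\<nu> * ?q j)))"
  proof -
    have "(\<Sum>j\<in>J. ?q j) = measure Q (\<Union>j\<in>J. A j)"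
      using J A disj by (intro Q.finite_measure_finite_Union[symmetric]) auto
    then have "(\<Sum>j\<in>J. - (\<nu> * ?q j)) = - \<nu>"
      by (simp add: cov Q.prob_space sum_negf flip: sum_distrib_left)
    then show ?thesis by (metis exp_sum J)
  qed
  finally show ?thesis unfolding ev
    by (simp add: poisson_density_def power_mult_distrib prod.distrib[symmetric] mult.assoc)
qed

text \<open>The complement of all \<open>A j\<close> joins as a further cell under the index
  \<open>None\<close>, which gives a partition; summing over its count \<open>r\<close> removes it
  again, as a Poisson density sums to one.\<close>

lemma poisson_thinning:
  fixes Q :: "'b measure" and A :: "'j \<Rightarrow> 'b set"
  assumes Q: "prob_space Q" and \<nu>: "0 < \<nu>" and J: "finite J"
    and A: "\<And>j. j \<in> J \<Longrightarrow> A j \<in> sets Q" and disj: "disjoint_family_on A J"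
  defines "\<Omega> \<equiv> measure_pmf (poisson_pmf \<nu>) \<Otimes>\<^sub>M PiM UNIV (\<lambda>_::nat. Q)"
  shows "measure \<Omega> {\<omega>\<in>space \<Omega>. \<forall>j\<in>J. cnt (A j) \<omega> = k j} = (\<Prod>j\<in>J. poisson_density (\<nu> * measure Q (A j)) (k j))"
proof -
  interpret Q: prob_space Q by (rule Q)
  interpret P: product_prob_space "\<lambda>_::nat. Q" UNIV ..
  interpret S: pair_prob_space "measure_pmf (poisson_pmf \<nu>)" "PiM UNIV (\<lambda>_::nat. Q)" ..
  define R where "R = space Q - (\<Union>j\<in>J. A j)"
  define A' where "A' j = (case j of None \<Rightarrow> R | Some j \<Rightarrow> A j)" for j
  let ?J = "insert None (Some ` J)"
  let ?E = "\<lambda>r. {\<omega>\<in>space \<Omega>. \<forall>j\<in>?J. cnt (A' j) \<omega> = case_option r k j}"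
  let ?p = "\<Prod>j\<in>J. poisson_density (\<nu> * measure Q (A j)) (k j)"
  have R: "R \<in> sets Q" unfolding R_def using A J by auto
  have A': "A' j \<in> sets Q" if "j \<in> ?J" for j using that A R by (auto simp: A'_def)
  have sub: "A j \<subseteq> space Q" if "j \<in> J" for j using A[OF that] by (rule sets.sets_into_space)
  have exact: "measure \<Omega> (?E r) = (\<Prod>j\<in>?J. poisson_density (\<nu> * measure Q (A' j)) (case_option r k j))" for r
    unfolding \<Omega>_def
  proof (rule poisson_thinning_exact[OF Q \<nu>])
    show "disjoint_family_on A' ?J"
      using disj by (auto simp: disjoint_family_on_def A'_def R_def split: option.split)
    show "(\<Union>j\<in>?J. A' j) = space Q" using sub by (auto simp: A'_def R_def)
  qed (use J A' in auto)
  have E: "measure \<Omega> (?E r) = poisson_density (\<nu> * measure Q R) r * ?p" for r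
    unfolding exact using J by (subst prod.insert) (auto simp: prod.reindex A'_def)
  have meas: "?E r \<in> sets \<Omega>" for r
  proof (rule sets.sets_Collect_finite_All)
    fix j assume "j \<in> ?J"
    then have "cnt (A' j) -` {case_option r k j} \<inter> space \<Omega> \<in> sets \<Omega>"
      unfolding \<Omega>_def by (intro measurable_sets[OF measurable_cnt[OF A']]) auto
    also have "cnt (A' j) -` {case_option r k j} \<inter> space \<Omega> = {\<omega>\<in>space \<Omega>. cnt (A' j) \<omega> = case_option r k j}"
      by auto
    finally show "{\<omega>\<in>space \<Omega>. cnt (A' j) \<omega> = case_option r k j} \<in> sets \<Omega>" .
  qed (use J in auto)
  have "(\<lambda>r. measure \<Omega> (?E r)) sums measure \<Omega> (\<Union>r. ?E r)"
    using meas unfolding \<Omega>_def by (intro S.finite_measure_UNION) (auto simp: disjoint_family_on_def)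
  moreover have "(\<lambda>r. measure \<Omega> (?E r)) sums (1 * ?p)"
    unfolding E by (intro sums_mult2 poisson_density_sums)
  ultimately have "measure \<Omega> (\<Union>r. ?E r) = ?p" using sums_unique2 by force
  moreover have "(\<Union>r. ?E r) = {\<omega>\<in>space \<Omega>. \<forall>j\<in>J. cnt (A j) \<omega> = k j}"
    by (auto simp: A'_def)
  ultimately show ?thesis by simp
qed

text \<open>The events \<open>X i = k\<close> together with the empty set are closed under
  intersection and generate, so point probabilities decide independence.\<close>

lemma (in prob_space) indep_vars_nat:
  fixes X :: "'i \<Rightarrow> 'a \<Rightarrow> nat"
  assumes rv: "\<And>i. i \<in> I \<Longrightarrow> X i \<in> M \<rightarrow>\<^sub>M count_space UNIV"
    and joint: "\<And>J k. finite J \<Longrightarrow> J \<subseteq> I \<Longrightarrow> J \<noteq> {} \<Longrightarrow>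
      prob {\<omega>\<in>space M. \<forall>j\<in>J. X j \<omega> = k j} = (\<Prod>j\<in>J. prob {\<omega>\<in>space M. X j \<omega> = k j})"
  shows "indep_vars (\<lambda>_. count_space UNIV) X I"
proof -
  define E where "E i = insert {} (range (\<lambda>k. {\<omega>\<in>space M. X i \<omega> = k}))" for i
  have ev: "{\<omega>\<in>space M. X i \<omega> = k} \<in> events" if "i \<in> I" for i k
    using measurable_sets[OF rv[OF that], of "{k}"] by (simp add: vimage_def Int_def conj_commute)
  have "indep_sets E I"
  proof (rule indep_setsI)
    fix i assume "i \<in> I" then show "E i \<subseteq> events" using ev by (auto simp: E_def)
  next
    fix A J assume J: "J \<noteq> {}" "J \<subseteq> I" "finite J" and A: "\<forall>j\<in>J. A j \<in> E j"
    show "prob (\<Inter>j\<in>J. A j) = (\<Prod>j\<in>J. prob (A j))"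
    proof (cases "\<exists>j\<in>J. A j = {}")
      case True
      then obtain j0 where j0: "j0 \<in> J" "A j0 = {}" by blast
      then have "(\<Inter>j\<in>J. A j) = {}" by blast
      moreover have "(\<Prod>j\<in>J. prob (A j)) = 0" using j0 J by (intro prod_zero bexI[of _ j0]) auto
      ultimately show ?thesis by simp
    next
      case False
      then have "\<forall>j\<in>J. \<exists>k. A j = {\<omega>\<in>space M. X j \<omega> = k}" using A unfolding E_def by blast
      from bchoice[OF this] obtain k where k: "\<And>j. j \<in> J \<Longrightarrow> A j = {\<omega>\<in>space M. X j \<omega> = k j}" by blast
      have "(\<Inter>j\<in>J. A j) = {\<omega>\<in>space M. \<forall>j\<in>J. X j \<omega> = k j}" using k J by auto
      then show ?thesis using joint[OF J(3,2,1), of k] k by simp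
    qed
  qed
  moreover have "Int_stable (E i)" for i
    by (auto simp: Int_stable_def E_def)
  ultimately have "indep_sets (\<lambda>i. sigma_sets (space M) (E i)) I" by (rule indep_sets_sigma)
  then show ?thesis unfolding indep_vars_def
  proof (intro conjI ballI rv)
    assume *: "indep_sets (\<lambda>i. sigma_sets (space M) (E i)) I"
    show "indep_sets (\<lambda>i. sigma_sets (space M) {X i -` A \<inter> space M |A. A \<in> sets (count_space UNIV)}) I"
    proof (rule indep_sets_mono_sets[OF *], rule sigma_sets_mono, safe)
      fix i and A :: "nat set"
      have "X i -` A \<inter> space M = (\<Union>k\<in>A. {\<omega>\<in>space M. X i \<omega> = k})" by auto
      moreover have "(\<Union>k\<in>A. {\<omega>\<in>space M. X i \<omega> = k}) \<in> sigma_sets (space M) (E i)"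
        by (rule sigma_sets_UNION) (auto simp: E_def)
      ultimately show "X i -` A \<inter> space M \<in> sigma_sets (space M) (E i)" by simp
    qed
  qed
qed

text \<open>Carries independence from a sample space to the law of the configuration built on it,
  where the counts agree with the original variables only almost surely.\<close>

lemma indep_vars_distr_AE:
  assumes M: "prob_space M" and f: "f \<in> M \<rightarrow>\<^sub>M N"
    and X: "\<And>i. i \<in> I \<Longrightarrow> X i \<in> N \<rightarrow>\<^sub>M L i"
    and Y: "prob_space.indep_vars M L Y I"
    and eq: "\<And>i. i \<in> I \<Longrightarrow> AE \<omega> in M. X i (f \<omega>) = Y i \<omega>"
  shows "prob_space.indep_vars (distr M N f) L X I"
proof -
  interpret M: prob_space M by (rule M)
  interpret D: prob_space "distr M N f" by (rule M.prob_space_distr[OF f])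
  have Yrv: "Y i \<in> M \<rightarrow>\<^sub>M L i" if "i \<in> I" for i using Y that by (simp add: M.indep_vars_def2)
  show ?thesis unfolding D.indep_vars_def2
  proof (intro conjI ballI D.indep_setsI)
    fix i assume i: "i \<in> I"
    then show "X i \<in> distr M N f \<rightarrow>\<^sub>M L i" using X by simp
    show "{X i -` A \<inter> space (distr M N f) |A. A \<in> sets (L i)} \<subseteq> D.events"
      using X[OF i] by (auto intro: measurable_sets)
  next
    fix A J assume J: "J \<noteq> {}" "J \<subseteq> I" "finite J"
      and A: "\<forall>j\<in>J. A j \<in> {X j -` A \<inter> space (distr M N f) |A. A \<in> sets (L j)}"
    then have "\<forall>j\<in>J. \<exists>S. S \<in> sets (L j) \<and> A j = X j -` S \<inter> space N" by auto
    from bchoice[OF this] obtain S where S: "\<And>j. j \<in> J \<Longrightarrow> S j \<in> sets (L j)" "\<And>j. j \<in> J \<Longrightarrow> A j = X j -` S j \<inter> space N"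
      by blast
    have Am: "A j \<in> sets N" if "j \<in> J" for j using S[OF that] X J that by (auto intro: measurable_sets)
    have Ym: "Y j -` S j \<inter> space M \<in> sets M" if "j \<in> J" for j
      using S[OF that] Yrv J that by (auto intro: measurable_sets)
    have eqJ: "AE \<omega> in M. \<forall>j\<in>J. X j (f \<omega>) = Y j \<omega>"
      using J eq by (intro AE_finite_allI) auto
    have one: "D.prob (A j) = M.prob (Y j -` S j \<inter> space M)" if "j \<in> J" for j
    proof -
      have "D.prob (A j) = M.prob (f -` A j \<inter> space M)" by (rule measure_distr[OF f Am[OF that]])
      also have "\<dots> = M.prob (Y j -` S j \<inter> space M)"
      proof (rule measure_eq_AE)
        show "AE x in M. x \<in> f -` A j \<inter> space M \<longleftrightarrow> x \<in> Y j -` S j \<inter> space M"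
          using eqJ AE_space
          by eventually_elim (use S(2)[OF that] that measurable_space[OF f] in auto)
      qed (use measurable_sets[OF f Am[OF that]] Ym[OF that] in auto)
      finally show ?thesis .
    qed
    have "D.prob (\<Inter>j\<in>J. A j) = M.prob (f -` (\<Inter>j\<in>J. A j) \<inter> space M)"
      using J Am by (intro measure_distr[OF f]) (auto intro!: sets.finite_INT)
    also have "\<dots> = M.prob (\<Inter>j\<in>J. Y j -` S j \<inter> space M)"
    proof (rule measure_eq_AE)
      show "AE x in M. x \<in> f -` (\<Inter>j\<in>J. A j) \<inter> space M \<longleftrightarrow> x \<in> (\<Inter>j\<in>J. Y j -` S j \<inter> space M)"
        using eqJ AE_space
      proof eventually_elim
        case (elim x)
        then show ?case using J S(2) measurable_space[OF f, of x] by auto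
      qed
      show "f -` (\<Inter>j\<in>J. A j) \<inter> space M \<in> M.events"
        using J Am by (intro measurable_sets[OF f]) (auto intro!: sets.finite_INT)
      show "(\<Inter>j\<in>J. Y j -` S j \<inter> space M) \<in> M.events"
        using J Ym by (intro sets.finite_INT) auto
    qed
    also have "\<dots> = (\<Prod>j\<in>J. M.prob (Y j -` S j \<inter> space M))"
      using J S(1) by (intro M.indep_varsD[OF Y]) auto
    also have "\<dots> = (\<Prod>j\<in>J. D.prob (A j))" using one by simp
    finally show "D.prob (\<Inter>j\<in>J. A j) = (\<Prod>j\<in>J. D.prob (A j))" .
  qed
qed

lemma cnt_eq_card: "cnt A \<omega> = card {i. i < fst \<omega> \<and> snd \<omega> i \<in> A}"
proof -
  have "{i. i < fst \<omega> \<and> snd \<omega> i \<in> A} = {i\<in>{..<fst \<omega>}. snd \<omega> i \<in> A}" by auto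
  then show ?thesis unfolding cnt_def by (simp add: sum.inter_filter[symmetric])
qed

text \<open>Fubini in the coordinate \<open>i\<close>: for fixed \<open>x j\<close> the fibre of
  \<open>f\<close> is null. For sampled locations this excludes coincidences, so a set of points
  loses no multiplicity.\<close>

lemma AE_PiM_pair_neq:
  fixes f :: "'b \<Rightarrow> 'c::{second_countable_topology, t2_space}"
  assumes Q: "prob_space Q" and f: "f \<in> borel_measurable Q" and ij: "i \<noteq> j"
    and null: "\<And>y. emeasure Q {x\<in>space Q. f x = y} = 0"
  shows "AE x in PiM (UNIV :: nat set) (\<lambda>_. Q). f (x i) \<noteq> f (x j)"
proof -
  interpret Q: prob_space Q by (rule Q)
  interpret P: product_prob_space "\<lambda>_::nat. Q" UNIV ..
  note f[measurable]
  let ?D = "{x\<in>space (PiM {i,j} (\<lambda>_. Q)). f (x i) = f (x j)}"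
  have D: "?D \<in> sets (PiM {i,j} (\<lambda>_. Q))" by measurable
  have "emeasure (PiM {i,j} (\<lambda>_. Q)) ?D = (\<integral>\<^sup>+x. indicator ?D x \<partial>PiM (insert i {j}) (\<lambda>_. Q))"
    using D by simp
  also have "\<dots> = (\<integral>\<^sup>+x. (\<integral>\<^sup>+y. indicator ?D (x(i := y)) \<partial>Q) \<partial>PiM {j} (\<lambda>_. Q))"
    using ij D by (intro P.product_nn_integral_insert) auto
  also have "\<dots> = (\<integral>\<^sup>+x. 0 \<partial>PiM {j} (\<lambda>_. Q))"
  proof (rule nn_integral_cong)
    fix x assume x: "x \<in> space (PiM {j} (\<lambda>_. Q))"
    have "(\<integral>\<^sup>+y. indicator ?D (x(i := y)) \<partial>Q) = (\<integral>\<^sup>+y. indicator {y\<in>space Q. f y = f (x j)} y \<partial>Q)"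
      using x ij by (intro nn_integral_cong) (auto simp: indicator_def space_PiM PiE_iff extensional_def)
    also have "\<dots> = emeasure Q {y\<in>space Q. f y = f (x j)}" by (rule nn_integral_indicator) measurable
    finally show "(\<integral>\<^sup>+y. indicator ?D (x(i := y)) \<partial>Q) = 0" using null by simp
  qed
  finally have z: "emeasure (PiM {i,j} (\<lambda>_. Q)) ?D = 0" by simp
  have "emeasure (PiM UNIV (\<lambda>_. Q)) {x\<in>space (PiM UNIV (\<lambda>_. Q)). f (x i) = f (x j)}
      = emeasure (distr (PiM UNIV (\<lambda>_. Q)) (PiM {i,j} (\<lambda>_. Q)) (\<lambda>x. restrict x {i,j})) ?D"
    using D by (subst emeasure_distr) (auto intro!: arg_cong2[where f = emeasure] simp: space_PiM measurable_restrict_subset)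
  also have "\<dots> = emeasure (PiM {i,j} (\<lambda>_. Q)) ?D"
    by (subst P.distr_PiM_restrict_finite) auto
  finally show ?thesis using z by (intro AE_I[where N = "{x\<in>space (PiM UNIV (\<lambda>_. Q)). f (x i) = f (x j)}"]) auto
qed

lemma sets_Collect_eq_borel:
  fixes g h :: "'w \<Rightarrow> 'c::{second_countable_topology, t2_space}"
  assumes [measurable]: "g \<in> borel_measurable M" "h \<in> borel_measurable M"
  shows "{\<omega>\<in>space M. g \<omega> = h \<omega>} \<in> sets M"
  by measurable

text \<open>Each piece \<open>B n\<close> receives a Poisson number of independent points
  distributed as \<mu> restricted to \<open>B n\<close> and normalized, independently over
  \<open>n\<close>. The map \<open>f\<close> certifies simplicity: its fibres are null and equality
  of its values is a measurable condition, so almost surely distinct indices give distinct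
  points.\<close>

theorem poisson_point_process_exists:
  fixes \<mu> :: "'b measure" and f :: "'b \<Rightarrow> 'c::{second_countable_topology, t2_space}" and B :: "nat \<Rightarrow> 'b set"
  assumes f: "f \<in> borel_measurable \<mu>" and null: "\<And>y. emeasure \<mu> {x\<in>space \<mu>. f x = y} = 0"
    and B: "\<And>n. B n \<in> sets \<mu>" "disjoint_family B" "(\<Union>n. B n) = space \<mu>"
      "\<And>n. 0 < emeasure \<mu> (B n)" "\<And>n. emeasure \<mu> (B n) < \<infinity>"
  shows "\<exists>P. poisson_point_process P \<mu> (\<lambda>\<omega>. \<omega>)"
proof -
  define Q where "Q n = uniform_measure \<mu> (B n)" for n
  define \<nu> where "\<nu> n = measure \<mu> (B n)" for n
  define C where "C n = measure_pmf (poisson_pmf (\<nu> n)) \<Otimes>\<^sub>M PiM UNIV (\<lambda>_::nat. Q n)" for n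
  define \<Omega> where "\<Omega> = PiM UNIV C"
  have sQ[simp, measurable_cong]: "sets (Q n) = sets \<mu>" for n by (simp add: Q_def)
  have spQ[simp]: "space (Q n) = space \<mu>" for n by (simp add: Q_def)
  have pQ: "prob_space (Q n)" for n unfolding Q_def
    using B(4)[of n] B(5)[of n] by (intro prob_space_uniform_measure) (auto simp: less_top)
  have eB: "emeasure \<mu> (B n) = ennreal (\<nu> n)" for n
    unfolding \<nu>_def using B(5)[of n] by (simp add: emeasure_eq_ennreal_measure less_top)
  have \<nu>: "0 < \<nu> n" for n using B(4)[of n] by (simp add: eB)
  have mQ: "\<nu> n * measure (Q n) A = measure \<mu> (B n \<inter> A)" if "A \<in> sets \<mu>" for n A
  proof -
    have "emeasure \<mu> (B n \<inter> A) \<le> emeasure \<mu> (B n)" using B by (intro emeasure_mono) auto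
    then have "emeasure \<mu> (B n \<inter> A) < \<infinity>" using B(5) by (rule le_less_trans)
    then have "emeasure \<mu> (B n \<inter> A) = ennreal (measure \<mu> (B n \<inter> A))"
      by (simp add: emeasure_eq_ennreal_measure less_top)
    then have "measure (Q n) A = measure \<mu> (B n \<inter> A) / \<nu> n"
      unfolding Q_def measure_def[of "uniform_measure \<mu> (B n)"] using that B(1) \<nu>[of n]
      by (simp add: emeasure_uniform_measure eB divide_ennreal)
    then show ?thesis using \<nu>[of n] by simp
  qed
  have pC: "prob_space (C n)" for n
  proof -
    interpret Qn: prob_space "Q n" by (rule pQ)
    interpret P: product_prob_space "\<lambda>_::nat. Q n" UNIV ..
    interpret S: pair_prob_space "measure_pmf (poisson_pmf (\<nu> n))" "PiM UNIV (\<lambda>_::nat. Q n)" ..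
    show ?thesis unfolding C_def by (rule S.prob_space_axioms)
  qed
  interpret P: product_prob_space C UNIV using pC by (intro product_prob_spaceI) auto
  interpret \<Omega>: prob_space \<Omega> unfolding \<Omega>_def by (rule P.prob_space_axioms)
  have cm: "cnt A \<in> C n \<rightarrow>\<^sub>M count_space UNIV" if "A \<in> sets \<mu>" for A n
    unfolding C_def using that by (intro measurable_cnt) simp
  define Z where "Z n A \<omega> = cnt A (\<omega> n)" for n A and \<omega> :: "nat \<Rightarrow> nat \<times> (nat \<Rightarrow> 'b)"
  have Zm: "Z n A \<in> \<Omega> \<rightarrow>\<^sub>M count_space UNIV" if "A \<in> sets \<mu>" for n A
  proof -
    have "(\<lambda>\<omega>. \<omega> n) \<in> \<Omega> \<rightarrow>\<^sub>M C n" unfolding \<Omega>_def by simp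
    from measurable_compose[OF this cm[OF that, of n]] show ?thesis by (simp add: Z_def[abs_def])
  qed
  define T where "T A \<omega> = (\<Sum>n. of_nat (Z n A \<omega>) :: ennreal)" for A \<omega>
  have Tm: "T A \<in> borel_measurable \<Omega>" if "A \<in> sets \<mu>" for A
    unfolding T_def[abs_def] using Zm[OF that] by measurable
  \<comment> \<open>Different pieces are independent coordinates of the product and thinning applies
    inside each piece; the index set \<open>L\<close> is sorted by its first component.\<close>
  have joint: "\<Omega>.prob {\<omega>\<in>space \<Omega>. \<forall>(n, j)\<in>L. Z n (A j) \<omega> = k (n, j)}
      = (\<Prod>(n, j)\<in>L. poisson_density (measure \<mu> (B n \<inter> A j)) (k (n, j)))"
    if L: "finite L" "L \<subseteq> UNIV \<times> {..<N}" and A: "\<And>j. j < N \<Longrightarrow> A j \<in> sets \<mu>" and disj: "disjoint_family_on A {..<N}"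
    for L :: "(nat \<times> nat) set" and N A k
  proof -
    let ?E = "\<lambda>n. {x\<in>space (C n). \<forall>j\<in>L `` {n}. cnt (A j) x = k (n, j)}"
    have finL: "finite (L `` {n})" "L `` {n} \<subseteq> {..<N}" for n using L by (auto intro: finite_Image)
    have Em: "?E n \<in> sets (C n)" for n
    proof (rule sets.sets_Collect_finite_All)
      fix j assume "j \<in> L `` {n}"
      then have "cnt (A j) -` {k (n, j)} \<inter> space (C n) \<in> sets (C n)"
        using finL[of n] A by (intro measurable_sets[OF cm]) auto
      also have "cnt (A j) -` {k (n, j)} \<inter> space (C n) = {x\<in>space (C n). cnt (A j) x = k (n, j)}" by auto
      finally show "{x\<in>space (C n). cnt (A j) x = k (n, j)} \<in> sets (C n)" .
    qed (rule finL)
    have EP: "measure (C n) (?E n) = (\<Prod>j\<in>L `` {n}. poisson_density (measure \<mu> (B n \<inter> A j)) (k (n, j)))" for n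
    proof -
      have "measure (C n) (?E n) = (\<Prod>j\<in>L `` {n}. poisson_density (\<nu> n * measure (Q n) (A j)) (k (n, j)))"
        unfolding C_def using finL[of n] A disj
        by (intro poisson_thinning pQ \<nu>) (auto intro: disjoint_family_on_mono)
      also have "\<dots> = (\<Prod>j\<in>L `` {n}. poisson_density (measure \<mu> (B n \<inter> A j)) (k (n, j)))"
        using finL[of n] A by (intro prod.cong refl) (auto simp: mQ)
      finally show ?thesis .
    qed
    have "{\<omega>\<in>space \<Omega>. \<forall>(n, j)\<in>L. Z n (A j) \<omega> = k (n, j)} = {\<omega>\<in>space \<Omega>. \<forall>n\<in>fst ` L. \<omega> n \<in> ?E n}"
      by (auto simp: Z_def \<Omega>_def space_PiM)
    moreover have "emeasure \<Omega> {\<omega>\<in>space \<Omega>. \<forall>n\<in>fst ` L. \<omega> n \<in> ?E n} = (\<Prod>n\<in>fst ` L. emeasure (C n) (?E n))"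
      unfolding \<Omega>_def using L Em by (intro P.emeasure_PiM_Collect) auto
    moreover have "\<dots> = ennreal (\<Prod>n\<in>fst ` L. measure (C n) (?E n))"
      using pC by (simp add: prod_ennreal finite_measure.emeasure_eq_measure prob_space.finite_measure)
    ultimately have "\<Omega>.prob {\<omega>\<in>space \<Omega>. \<forall>(n, j)\<in>L. Z n (A j) \<omega> = k (n, j)} = (\<Prod>n\<in>fst ` L. measure (C n) (?E n))"
      by (simp add: measure_def prod_nonneg)
    also have "\<dots> = (\<Prod>n\<in>fst ` L. \<Prod>j\<in>L `` {n}. poisson_density (measure \<mu> (B n \<inter> A j)) (k (n, j)))"
      by (simp only: EP)
    also have "\<dots> = (\<Prod>(n, j)\<in>(SIGMA n:fst ` L. L `` {n}). poisson_density (measure \<mu> (B n \<inter> A j)) (k (n, j)))"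
      using L finL by (intro prod.Sigma) auto
    also have "(SIGMA n:fst ` L. L `` {n}) = L" by force
    finally show ?thesis .
  qed
  have single: "\<Omega>.prob {\<omega>\<in>space \<Omega>. Z n A \<omega> = k} = poisson_density (measure \<mu> (B n \<inter> A)) k" if "A \<in> sets \<mu>" for n A k
    using joint[of "{(n, 0)}" 1 "\<lambda>_. A" "\<lambda>_. k"] that by (simp add: disjoint_family_on_def)
  have indepZ: "\<Omega>.indep_vars (\<lambda>_. count_space UNIV) (\<lambda>(n, j). Z n (A j)) (UNIV \<times> {..<N})"
    if A: "\<And>j. j < N \<Longrightarrow> A j \<in> sets \<mu>" and disj: "disjoint_family_on A {..<N}" for N :: nat and A
  proof (rule \<Omega>.indep_vars_nat)
    fix i :: "nat \<times> nat" assume "i \<in> UNIV \<times> {..<N}"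
    then show "(case i of (n, j) \<Rightarrow> Z n (A j)) \<in> \<Omega> \<rightarrow>\<^sub>M count_space UNIV" using A Zm by auto
  next
    fix L :: "(nat \<times> nat) set" and k :: "nat \<times> nat \<Rightarrow> nat" assume L: "finite L" "L \<subseteq> UNIV \<times> {..<N}"
    have "\<Omega>.prob {\<omega>\<in>space \<Omega>. \<forall>j\<in>L. (case j of (n, j) \<Rightarrow> Z n (A j)) \<omega> = k j}
      = (\<Prod>(n, j)\<in>L. poisson_density (measure \<mu> (B n \<inter> A j)) (k (n, j)))"
      using joint[OF L A disj, of k] by (simp add: case_prod_unfold)
    also have "\<dots> = (\<Prod>j\<in>L. \<Omega>.prob {\<omega>\<in>space \<Omega>. (case j of (n, j) \<Rightarrow> Z n (A j)) \<omega> = k j})"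
      using L A by (intro prod.cong refl) (auto simp: single)
    finally show "\<Omega>.prob {\<omega>\<in>space \<Omega>. \<forall>j\<in>L. (case j of (n, j) \<Rightarrow> Z n (A j)) \<omega> = k j}
      = (\<Prod>j\<in>L. \<Omega>.prob {\<omega>\<in>space \<Omega>. (case j of (n, j) \<Rightarrow> Z n (A j)) \<omega> = k j})" .
  qed
  \<comment> \<open>The independent counts are grouped by the index \<open>j\<close> of the set;
    each group runs through all pieces and is summed.\<close>
  have indepT: "\<Omega>.indep_vars (\<lambda>_. borel) (\<lambda>j. T (A j)) {..<N}"
    if A: "\<And>j. j < N \<Longrightarrow> A j \<in> sets \<mu>" and disj: "disjoint_family_on A {..<N}" for N :: nat and A
  proof -
    let ?X = "\<lambda>(n, j). Z n (A j)"
    have "\<Omega>.indep_vars (\<lambda>j. PiM (UNIV \<times> {j}) (\<lambda>_. count_space UNIV)) (\<lambda>j \<omega>. restrict (\<lambda>i. ?X i \<omega>) (UNIV \<times> {j})) {..<N}"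
      by (rule \<Omega>.indep_vars_restrict[OF indepZ[OF A disj]]) (auto simp: disjoint_family_on_def)
    then have "\<Omega>.indep_vars (\<lambda>_. borel) (\<lambda>j \<omega>. (\<lambda>g. \<Sum>n. of_nat (g (n, j)) :: ennreal) (restrict (\<lambda>i. ?X i \<omega>) (UNIV \<times> {j}))) {..<N}"
    proof (rule \<Omega>.indep_vars_compose2)
      fix j
      have "(\<lambda>g. g (n, j)) \<in> PiM (UNIV \<times> {j}) (\<lambda>_. count_space UNIV) \<rightarrow>\<^sub>M count_space (UNIV :: nat set)" for n :: nat
        by (rule measurable_component_singleton) auto
      then show "(\<lambda>g. \<Sum>n. of_nat (g (n, j)) :: ennreal) \<in> borel_measurable (PiM (UNIV \<times> {j}) (\<lambda>_. count_space (UNIV :: nat set)))"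
        by measurable
    qed
    then show ?thesis by (simp add: T_def[abs_def])
  qed
  define m where "m A n = measure \<mu> (B n \<inter> A)" for A n
  define W where "W A K \<omega> = (\<Sum>n<K. Z n A \<omega>)" for A K \<omega>
  have Wm: "W A K \<in> \<Omega> \<rightarrow>\<^sub>M count_space UNIV" if "A \<in> sets \<mu>" for A K
    unfolding W_def[abs_def] using Zm[OF that] by measurable
  \<comment> \<open>Induction over the pieces: one more piece convolves two Poisson
    densities.\<close>
  have Wdist: "\<Omega>.prob {\<omega>\<in>space \<Omega>. W A K \<omega> = k} = poisson_density (\<Sum>n<K. m A n) k" if A: "A \<in> sets \<mu>" for A K k
  proof (induction K arbitrary: k)
    case 0
    have "{\<omega>\<in>space \<Omega>. W A 0 \<omega> = k} = (if k = 0 then space \<Omega> else {})" by (auto simp: W_def)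
    then show ?case by (auto simp: \<Omega>.prob_space poisson_density_def)
  next
    case (Suc K)
    have "\<Omega>.indep_vars (\<lambda>_. count_space UNIV) (\<lambda>i. (case i of (n, j) \<Rightarrow> Z n A)) (UNIV \<times> {..<1::nat})"
      using indepZ[of 1 "\<lambda>_. A"] A by (simp add: disjoint_family_on_def)
    then have "\<Omega>.indep_var (PiM ({..<K} \<times> {0}) (\<lambda>_. count_space UNIV)) (\<lambda>\<omega>. restrict (\<lambda>i. (case i of (n, j) \<Rightarrow> Z n A) \<omega>) ({..<K} \<times> {0::nat}))
        (PiM ({K} \<times> {0}) (\<lambda>_. count_space UNIV)) (\<lambda>\<omega>. restrict (\<lambda>i. (case i of (n, j) \<Rightarrow> Z n A) \<omega>) ({K} \<times> {0::nat}))"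
      by (rule \<Omega>.indep_var_restrict) auto
    then have "\<Omega>.indep_var (count_space UNIV) ((\<lambda>g. \<Sum>n<K. g (n, 0)) \<circ> (\<lambda>\<omega>. restrict (\<lambda>i. (case i of (n, j) \<Rightarrow> Z n A) \<omega>) ({..<K} \<times> {0::nat})))
        (count_space UNIV) ((\<lambda>g. g (K, 0)) \<circ> (\<lambda>\<omega>. restrict (\<lambda>i. (case i of (n, j) \<Rightarrow> Z n A) \<omega>) ({K} \<times> {0::nat})))"
    proof (rule \<Omega>.indep_var_compose)
      show "(\<lambda>g. \<Sum>n<K. g (n, 0)) \<in> PiM ({..<K} \<times> {0}) (\<lambda>_. count_space UNIV) \<rightarrow>\<^sub>M count_space (UNIV :: nat set)"
      proof -
        have "(\<lambda>g. g (n, 0)) \<in> PiM ({..<K} \<times> {0}) (\<lambda>_. count_space UNIV) \<rightarrow>\<^sub>M count_space (UNIV :: nat set)" if "n \<in> {..<K}" for n :: nat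
          using that by (intro measurable_component_singleton) auto
        then show ?thesis by (intro measurable_sum_nat)
      qed
      show "(\<lambda>g. g (K, 0)) \<in> PiM ({K} \<times> {0}) (\<lambda>_. count_space UNIV) \<rightarrow>\<^sub>M count_space (UNIV :: nat set)"
        by (rule measurable_component_singleton) auto
    qed
    then have ind: "\<Omega>.indep_var (count_space UNIV) (W A K) (count_space UNIV) (Z K A)"
      by (simp add: comp_def W_def[abs_def])
    have "{\<omega>\<in>space \<Omega>. W A (Suc K) \<omega> = k} = (\<Union>i\<le>k. (\<lambda>\<omega>. (W A K \<omega>, Z K A \<omega>)) -` ({i} \<times> {k - i}) \<inter> space \<Omega>)"
      by (auto simp: W_def)
    then have "\<Omega>.prob {\<omega>\<in>space \<Omega>. W A (Suc K) \<omega> = k} = (\<Sum>i\<le>k. \<Omega>.prob ((\<lambda>\<omega>. (W A K \<omega>, Z K A \<omega>)) -` ({i} \<times> {k - i}) \<inter> space \<Omega>))"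
    proof (simp only:, intro \<Omega>.finite_measure_finite_Union)
      show "(\<lambda>i. (\<lambda>\<omega>. (W A K \<omega>, Z K A \<omega>)) -` ({i} \<times> {k - i}) \<inter> space \<Omega>) ` {..k} \<subseteq> \<Omega>.events"
      proof safe
        fix i
        have "(\<lambda>\<omega>. (W A K \<omega>, Z K A \<omega>)) -` ({i} \<times> {k - i}) \<inter> space \<Omega> = (W A K -` {i} \<inter> space \<Omega>) \<inter> (Z K A -` {k - i} \<inter> space \<Omega>)" by auto
        also have "\<dots> \<in> \<Omega>.events" using Wm[OF A] Zm[OF A] by (intro sets.Int measurable_sets) auto
        finally show "(\<lambda>\<omega>. (W A K \<omega>, Z K A \<omega>)) -` ({i} \<times> {k - i}) \<inter> space \<Omega> \<in> \<Omega>.events" .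
      qed
    qed (auto simp: disjoint_family_on_def)
    also have "\<dots> = (\<Sum>i\<le>k. poisson_density (\<Sum>n<K. m A n) i * poisson_density (m A K) (k - i))"
    proof (intro sum.cong refl)
      fix i
      have "\<Omega>.prob ((\<lambda>\<omega>. (W A K \<omega>, Z K A \<omega>)) -` ({i} \<times> {k - i}) \<inter> space \<Omega>) = \<Omega>.prob (W A K -` {i} \<inter> space \<Omega>) * \<Omega>.prob (Z K A -` {k - i} \<inter> space \<Omega>)"
        by (rule \<Omega>.indep_varD[OF ind]) auto
      also have "W A K -` {i} \<inter> space \<Omega> = {\<omega>\<in>space \<Omega>. W A K \<omega> = i}" by auto
      also have "Z K A -` {k - i} \<inter> space \<Omega> = {\<omega>\<in>space \<Omega>. Z K A \<omega> = k - i}" by auto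
      finally show "\<Omega>.prob ((\<lambda>\<omega>. (W A K \<omega>, Z K A \<omega>)) -` ({i} \<times> {k - i}) \<inter> space \<Omega>) = poisson_density (\<Sum>n<K. m A n) i * poisson_density (m A K) (k - i)"
        using Suc.IH single[OF A] by (simp add: m_def)
    qed
    also have "\<dots> = poisson_density (\<Sum>n<Suc K. m A n) k" by (simp add: poisson_density_add)
    finally show ?case .
  qed
  have T_le: "T A \<omega> \<le> of_nat k \<longleftrightarrow> (\<forall>K. W A K \<omega> \<le> k)" for A \<omega> k
  proof -
    have "T A \<omega> \<le> of_nat k \<longleftrightarrow> (\<forall>K. (of_nat (W A K \<omega>) :: ennreal) \<le> of_nat k)"
      by (simp add: T_def W_def suminf_eq_SUP SUP_le_iff)
    then show ?thesis by simp
  qed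
  have T_ge: "of_nat (W A K \<omega>) \<le> T A \<omega>" for A K \<omega>
    unfolding T_def suminf_eq_SUP by (rule SUP_upper2[of K]) (auto simp: W_def)
  \<comment> \<open>The events \<open>W A K \<omega> \<le> k\<close> decrease in \<open>K\<close>,
    so continuity from above gives the distribution function of the infinite sum; point
    probabilities follow as differences.\<close>
  have Tdist_le: "\<Omega>.prob {\<omega>\<in>space \<Omega>. T A \<omega> \<le> of_nat k} = (\<Sum>i\<le>k. poisson_density (measure \<mu> A) i)"
    if A: "A \<in> sets \<mu>" "emeasure \<mu> A < \<infinity>" for A k
  proof -
    have "(\<lambda>K. \<Omega>.prob {\<omega>\<in>space \<Omega>. W A K \<omega> \<le> k}) \<longlonglongrightarrow> \<Omega>.prob (\<Inter>K. {\<omega>\<in>space \<Omega>. W A K \<omega> \<le> k})"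
    proof (rule \<Omega>.finite_Lim_measure_decseq)
      show "range (\<lambda>K. {\<omega>\<in>space \<Omega>. W A K \<omega> \<le> k}) \<subseteq> \<Omega>.events"
      proof safe
        fix K
        have "W A K -` {..k} \<inter> space \<Omega> \<in> \<Omega>.events" using Wm[OF A(1)] by (intro measurable_sets) auto
        then show "{\<omega>\<in>space \<Omega>. W A K \<omega> \<le> k} \<in> \<Omega>.events" by (simp add: vimage_def Int_def conj_commute)
      qed
      show "decseq (\<lambda>K. {\<omega>\<in>space \<Omega>. W A K \<omega> \<le> k})"
        by (rule decseq_SucI) (auto simp: W_def)
    qed
    also have "(\<Inter>K. {\<omega>\<in>space \<Omega>. W A K \<omega> \<le> k}) = {\<omega>\<in>space \<Omega>. T A \<omega> \<le> of_nat k}" by (auto simp: T_le)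
    finally have 1: "(\<lambda>K. \<Omega>.prob {\<omega>\<in>space \<Omega>. W A K \<omega> \<le> k}) \<longlonglongrightarrow> \<Omega>.prob {\<omega>\<in>space \<Omega>. T A \<omega> \<le> of_nat k}" .
    have fin: "\<Omega>.prob {\<omega>\<in>space \<Omega>. W A K \<omega> \<le> k} = (\<Sum>i\<le>k. poisson_density (\<Sum>n<K. m A n) i)" for K
    proof -
      have "{\<omega>\<in>space \<Omega>. W A K \<omega> \<le> k} = (\<Union>i\<le>k. {\<omega>\<in>space \<Omega>. W A K \<omega> = i})" by auto
      then have "\<Omega>.prob {\<omega>\<in>space \<Omega>. W A K \<omega> \<le> k} = (\<Sum>i\<le>k. \<Omega>.prob {\<omega>\<in>space \<Omega>. W A K \<omega> = i})"
      proof (simp only:, intro \<Omega>.finite_measure_finite_Union)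
        show "(\<lambda>i. {\<omega>\<in>space \<Omega>. W A K \<omega> = i}) ` {..k} \<subseteq> \<Omega>.events"
        proof safe
          fix i
          have "W A K -` {i} \<inter> space \<Omega> \<in> \<Omega>.events" using Wm[OF A(1)] by (intro measurable_sets) auto
          then show "{\<omega>\<in>space \<Omega>. W A K \<omega> = i} \<in> \<Omega>.events" by (simp add: vimage_def Int_def conj_commute)
        qed
      qed (auto simp: disjoint_family_on_def)
      then show ?thesis by (simp add: Wdist[OF A(1)])
    qed
    have "m A sums measure \<mu> (\<Union>n. B n \<inter> A)"
      unfolding m_def[abs_def]
    proof (rule measure_UNION)
      have "(\<Union>n. B n \<inter> A) = A" using B(3) sets.sets_into_space[OF A(1)] by auto
      then show "emeasure \<mu> (\<Union>n. B n \<inter> A) \<noteq> \<infinity>" using A by simp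
    qed (use B A in \<open>auto simp: disjoint_family_on_def\<close>)
    moreover have "(\<Union>n. B n \<inter> A) = A" using B(3) sets.sets_into_space[OF A(1)] by auto
    ultimately have "(\<lambda>K. \<Sum>n<K. m A n) \<longlonglongrightarrow> measure \<mu> A" by (simp add: sums_def)
    then have "(\<lambda>K. \<Sum>i\<le>k. poisson_density (\<Sum>n<K. m A n) i) \<longlonglongrightarrow> (\<Sum>i\<le>k. poisson_density (measure \<mu> A) i)"
      unfolding poisson_density_def by (intro tendsto_intros) auto
    then show ?thesis using 1 unfolding fin by (rule LIMSEQ_unique[rotated])
  qed
  have Tdist: "\<Omega>.prob {\<omega>\<in>space \<Omega>. T A \<omega> = of_nat k} = poisson_density (measure \<mu> A) k"
    if A: "A \<in> sets \<mu>" "emeasure \<mu> A < \<infinity>" for A k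
  proof (cases k)
    case 0
    then show ?thesis using Tdist_le[OF A, of 0] by simp
  next
    case (Suc k')
    let ?S = "\<lambda>k. {\<omega>\<in>space \<Omega>. T A \<omega> \<le> of_nat k}"
    have Sm: "?S k \<in> \<Omega>.events" for k using Tm[OF A(1)] by measurable
    have "{\<omega>\<in>space \<Omega>. T A \<omega> = of_nat k} = ?S k - ?S k'"
    proof (intro equalityI subsetI)
      fix \<omega> assume \<omega>: "\<omega> \<in> ?S k - ?S k'"
      then obtain K where "k' < W A K \<omega>" by (auto simp: T_le not_le)
      then have "(of_nat k :: ennreal) \<le> of_nat (W A K \<omega>)" using Suc by (intro of_nat_mono) auto
      then have "of_nat k \<le> T A \<omega>" using T_ge[of A K \<omega>] by (rule order_trans)
      then show "\<omega> \<in> {\<omega>\<in>space \<Omega>. T A \<omega> = of_nat k}" using \<omega> by (simp add: antisym)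
    next
      fix \<omega> assume \<omega>: "\<omega> \<in> {\<omega>\<in>space \<Omega>. T A \<omega> = of_nat k}"
      have "\<not> (of_nat k :: ennreal) \<le> of_nat k'" using Suc by (subst of_nat_le_iff) auto
      then show "\<omega> \<in> ?S k - ?S k'" using \<omega> by auto
    qed
    moreover have "?S k' \<subseteq> ?S k"
    proof -
      have "(of_nat k' :: ennreal) \<le> of_nat k" using Suc by (intro of_nat_mono) auto
      then show ?thesis by (auto intro: order_trans)
    qed
    ultimately have "\<Omega>.prob {\<omega>\<in>space \<Omega>. T A \<omega> = of_nat k} = \<Omega>.prob (?S k) - \<Omega>.prob (?S k')"
      using Sm by (simp only: \<Omega>.finite_measure_Diff)
    then show ?thesis using Tdist_le[OF A, of k] Tdist_le[OF A, of k'] by (simp add: Suc del: of_nat_Suc)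
  qed
  \<comment> \<open>On \<open>G\<close> all locations lie in their pieces and are separated by
    \<open>f\<close>. Off this almost sure event the configuration \<eta> will be empty.\<close>
  define G where "G = {\<omega>\<in>space \<Omega>. \<forall>n. (\<forall>i. snd (\<omega> n) i \<in> B n) \<and> (\<forall>i j. i \<noteq> j \<longrightarrow> f (snd (\<omega> n) i) \<noteq> f (snd (\<omega> n) j))}"
  have xm: "(\<lambda>\<omega>. snd (\<omega> n) i) \<in> \<Omega> \<rightarrow>\<^sub>M \<mu>" for n i
  proof -
    have "(\<lambda>\<omega>. \<omega> n) \<in> \<Omega> \<rightarrow>\<^sub>M C n" unfolding \<Omega>_def by simp
    moreover have "(\<lambda>x. snd x i) \<in> C n \<rightarrow>\<^sub>M Q n" unfolding C_def by measurable
    ultimately have "(\<lambda>\<omega>. snd (\<omega> n) i) \<in> \<Omega> \<rightarrow>\<^sub>M Q n" by (rule measurable_compose)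
    then show ?thesis by (simp cong: measurable_cong_sets)
  qed
  have Gm: "G \<in> \<Omega>.events"
  proof -
    have fm: "(\<lambda>\<omega>. f (snd (\<omega> n) i)) \<in> borel_measurable \<Omega>" for n i
      by (rule measurable_compose[OF xm f])
    have 1: "{\<omega>\<in>space \<Omega>. snd (\<omega> n) i \<in> B n} \<in> \<Omega>.events" for n i
      using measurable_sets[OF xm B(1)] by (simp add: vimage_def Int_def conj_commute)
    have 2: "{\<omega>\<in>space \<Omega>. f (snd (\<omega> n) i) \<noteq> f (snd (\<omega> n) j)} \<in> \<Omega>.events" for n i j
      by (intro sets.sets_Collect_neg sets_Collect_eq_borel fm)
    show ?thesis unfolding G_def
      by (intro sets.sets_Collect_countable_All sets.sets_Collect_conj sets.sets_Collect_imp sets.sets_Collect_const 1 2)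
  qed
  have GAE: "AE \<omega> in \<Omega>. \<omega> \<in> G"
  proof -
    have "AE \<omega> in \<Omega>. (\<forall>i. snd (\<omega> n) i \<in> B n) \<and> (\<forall>i j. i \<noteq> j \<longrightarrow> f (snd (\<omega> n) i) \<noteq> f (snd (\<omega> n) j))" for n
    proof -
      interpret Qn: prob_space "Q n" by (rule pQ)
      interpret Pn: product_prob_space "\<lambda>_::nat. Q n" UNIV ..
      let ?X = "PiM UNIV (\<lambda>_::nat. Q n)"
      let ?R = "\<lambda>x. (\<forall>i. x i \<in> B n) \<and> (\<forall>i j. i \<noteq> j \<longrightarrow> f (x i) \<noteq> f (x j))"
      have nullQ: "emeasure (Q n) {x\<in>space (Q n). f x = y} = 0" for y
      proof -
        have [measurable]: "{x\<in>space \<mu>. f x = y} \<in> sets \<mu>" using f by measurable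
        have "emeasure \<mu> (B n \<inter> {x\<in>space \<mu>. f x = y}) \<le> emeasure \<mu> {x\<in>space \<mu>. f x = y}"
          by (intro emeasure_mono) auto
        then have "emeasure \<mu> (B n \<inter> {x\<in>space \<mu>. f x = y}) = 0" using null by simp
        then show ?thesis using B(1) unfolding Q_def by (simp add: emeasure_uniform_measure)
      qed
      have AEB: "AE x in Q n. x \<in> B n" unfolding Q_def
        using B by (intro AE_uniform_measureI) auto
      have fQ: "f \<in> borel_measurable (Q n)" using f by simp
      have "AE x in ?X. ?R x"
        unfolding AE_conj_iff AE_all_countable
      proof (intro conjI allI)
        fix i show "AE x in ?X. x i \<in> B n" using AEB by (intro AE_PiM_component pQ) auto
      next
        fix i j :: nat
        show "AE x in ?X. i \<noteq> j \<longrightarrow> f (x i) \<noteq> f (x j)"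
          by (cases "i = j") (auto intro: AE_PiM_pair_neq[OF pQ fQ _ nullQ])
      qed
      then obtain N where N: "N \<in> null_sets ?X" "{x\<in>space ?X. \<not> ?R x} \<subseteq> N"
        unfolding eventually_ae_filter by blast
      have "AE x in C n. ?R (snd x)"
      proof (rule AE_I')
        show "space (measure_pmf (poisson_pmf (\<nu> n))) \<times> N \<in> null_sets (C n)"
          unfolding C_def using N(1) by (intro null_setsI)
            (auto simp: Pn.P.emeasure_pair_measure_Times null_sets_def)
        show "{x\<in>space (C n). \<not> ?R (snd x)} \<subseteq> space (measure_pmf (poisson_pmf (\<nu> n))) \<times> N"
        proof
          fix x assume x: "x \<in> {x\<in>space (C n). \<not> ?R (snd x)}"
          then have "snd x \<in> {x\<in>space ?X. \<not> ?R x}" by (simp add: C_def space_pair_measure mem_Times_iff)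
          then have "snd x \<in> N" using N(2) by blast
          then show "x \<in> space (measure_pmf (poisson_pmf (\<nu> n))) \<times> N" by (simp add: mem_Times_iff)
        qed
      qed
      then show ?thesis unfolding \<Omega>_def by (intro AE_PiM_component pC) auto
    qed
    then have "AE \<omega> in \<Omega>. \<forall>n. (\<forall>i. snd (\<omega> n) i \<in> B n) \<and> (\<forall>i j. i \<noteq> j \<longrightarrow> f (snd (\<omega> n) i) \<noteq> f (snd (\<omega> n) j))"
      by (subst AE_all_countable) blast
    then show ?thesis using AE_space by eventually_elim (auto simp: G_def)
  qed
  define \<eta> where "\<eta> \<omega> = (if \<omega> \<in> G then {snd (\<omega> n) i | n i. i < fst (\<omega> n)} else {})" for \<omega>
  have num: "num_points (\<eta> \<omega>) A = T A \<omega>" if \<omega>: "\<omega> \<in> G" for \<omega> A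
  proof -
    let ?S = "\<lambda>n. {snd (\<omega> n) i | i. i < fst (\<omega> n) \<and> snd (\<omega> n) i \<in> A}"
    have "\<eta> \<omega> \<inter> A = (\<Union>n. ?S n)" using \<omega> by (auto simp: \<eta>_def)
    then have "num_points (\<eta> \<omega>) A = emeasure (count_space UNIV) (\<Union>n. ?S n)" by (simp add: num_points_def)
    also have "\<dots> = (\<Sum>n. emeasure (count_space UNIV) (?S n))"
    proof (rule suminf_emeasure[symmetric])
      have "?S n \<subseteq> B n" for n using \<omega> by (auto simp: G_def)
      then show "disjoint_family ?S" using B(2) unfolding disjoint_family_on_def by blast
    qed auto
    also have "\<dots> = T A \<omega>" unfolding T_def
    proof (rule suminf_cong)
      fix n
      have S: "?S n = snd (\<omega> n) ` {i. i < fst (\<omega> n) \<and> snd (\<omega> n) i \<in> A}" by auto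
      have inj: "inj_on (snd (\<omega> n)) {i. i < fst (\<omega> n) \<and> snd (\<omega> n) i \<in> A}"
      proof (rule inj_onI)
        fix i j assume "snd (\<omega> n) i = snd (\<omega> n) j"
        then show "i = j" using \<omega> by (auto simp: G_def) metis
      qed
      have "finite (?S n)" unfolding S by simp
      then have "emeasure (count_space UNIV) (?S n) = of_nat (card (?S n))"
        by (simp add: emeasure_count_space_finite)
      also have "card (?S n) = Z n A \<omega>" unfolding S using inj by (simp add: card_image Z_def cnt_eq_card)
      finally show "emeasure (count_space UNIV) (?S n) = of_nat (Z n A \<omega>)" .
    qed
    finally show ?thesis .
  qed
  have num0: "num_points (\<eta> \<omega>) A = 0" if "\<omega> \<notin> G" for \<omega> A using that by (simp add: \<eta>_def num_points_def)
  have \<eta>space: "\<eta> \<omega> \<subseteq> space \<mu>" for \<omega>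
    using sets.sets_into_space[OF B(1)] by (auto simp: \<eta>_def G_def)
  have nm: "(\<lambda>\<omega>. num_points (\<eta> \<omega>) A) \<in> borel_measurable \<Omega>" if "A \<in> sets \<mu>" for A
  proof -
    have "(\<lambda>\<omega>. num_points (\<eta> \<omega>) A) = (\<lambda>\<omega>. if \<omega> \<in> G then T A \<omega> else 0)" using num num0 by auto
    then show ?thesis using Tm[OF that] Gm by simp
  qed
  \<comment> \<open>Configurations carry the \<sigma>-algebra generated by the counting
    variables.\<close>
  define S where "S = {{\<omega>\<in>Pow (space \<mu>). num_points \<omega> A \<in> D} | A D. A \<in> sets \<mu> \<and> D \<in> sets borel}"
  define N where "N = sigma (Pow (space \<mu>)) S"
  have Ssub: "S \<subseteq> Pow (Pow (space \<mu>))" by (auto simp: S_def)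
  have spN: "space N = Pow (space \<mu>)" using Ssub by (simp add: N_def)
  have \<eta>m: "\<eta> \<in> \<Omega> \<rightarrow>\<^sub>M N" unfolding N_def
  proof (rule measurable_measure_of[OF Ssub])
    fix Y assume "Y \<in> S"
    then obtain A D where AD: "Y = {\<omega>\<in>Pow (space \<mu>). num_points \<omega> A \<in> D}" "A \<in> sets \<mu>" "D \<in> sets borel"
      by (auto simp: S_def)
    have "\<eta> -` Y \<inter> space \<Omega> = (\<lambda>\<omega>. num_points (\<eta> \<omega>) A) -` D \<inter> space \<Omega>" using \<eta>space by (auto simp: AD)
    then show "\<eta> -` Y \<inter> space \<Omega> \<in> sets \<Omega>" using nm[OF AD(2)] AD(3) by (simp add: measurable_sets)
  qed (use \<eta>space in auto)
  have npm: "(\<lambda>\<omega>. num_points \<omega> A) \<in> borel_measurable N" if "A \<in> sets \<mu>" for A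
  proof (rule measurableI)
    fix D :: "ennreal set" assume D: "D \<in> sets borel"
    have "(\<lambda>\<omega>. num_points \<omega> A) -` D \<inter> space N = {\<omega>\<in>Pow (space \<mu>). num_points \<omega> A \<in> D}"
      unfolding spN by auto
    also have "\<dots> \<in> sets N" unfolding N_def using that D Ssub by (auto simp: S_def intro!: sigma_sets.Basic)
    finally show "(\<lambda>\<omega>. num_points \<omega> A) -` D \<inter> space N \<in> sets N" .
  qed simp
  have "poisson_point_process (distr \<Omega> N \<eta>) \<mu> (\<lambda>\<omega>. \<omega>)"
    unfolding poisson_point_process_def
  proof (intro conjI allI impI ballI)
    show "prob_space (distr \<Omega> N \<eta>)" by (rule \<Omega>.prob_space_distr[OF \<eta>m])
    show "\<omega> \<subseteq> space \<mu>" if "\<omega> \<in> space (distr \<Omega> N \<eta>)" for \<omega> using that by (simp add: spN)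
    show "(\<lambda>\<omega>. num_points \<omega> A) \<in> borel_measurable (distr \<Omega> N \<eta>)" if "A \<in> sets \<mu>" for A
      using npm[OF that] by simp
  next
    fix A k assume A: "A \<in> sets \<mu>" "emeasure \<mu> A < \<infinity>"
    have "(\<lambda>\<omega>. num_points \<omega> A) -` {of_nat k} \<inter> space N \<in> sets N"
      using npm[OF A(1)] by (rule measurable_sets) auto
    then have m: "{\<omega>\<in>space N. num_points \<omega> A = of_nat k} \<in> sets N" by (simp add: vimage_def Int_def conj_commute)
    have "measure (distr \<Omega> N \<eta>) {\<omega>\<in>space (distr \<Omega> N \<eta>). num_points \<omega> A = of_nat k}
        = \<Omega>.prob (\<eta> -` {\<omega>\<in>space N. num_points \<omega> A = of_nat k} \<inter> space \<Omega>)"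
      using measure_distr[OF \<eta>m m] by simp
    also have "\<dots> = \<Omega>.prob {\<omega>\<in>space \<Omega>. T A \<omega> = of_nat k}"
    proof (rule measure_eq_AE)
      show "AE \<omega> in \<Omega>. \<omega> \<in> \<eta> -` {\<omega>\<in>space N. num_points \<omega> A = of_nat k} \<inter> space \<Omega> \<longleftrightarrow> \<omega> \<in> {\<omega>\<in>space \<Omega>. T A \<omega> = of_nat k}"
        using GAE by eventually_elim (auto simp: num spN \<eta>space subsetD[OF \<eta>space])
      show "{\<omega>\<in>space \<Omega>. T A \<omega> = of_nat k} \<in> \<Omega>.events" using Tm[OF A(1)] by measurable
    qed (rule measurable_sets[OF \<eta>m m])
    also have "\<dots> = exp (- measure \<mu> A) * measure \<mu> A ^ k / fact k"
      using Tdist[OF A] by (simp add: poisson_density_def)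
    finally show "measure (distr \<Omega> N \<eta>) {\<omega>\<in>space (distr \<Omega> N \<eta>). num_points \<omega> A = of_nat k}
        = exp (- measure \<mu> A) * measure \<mu> A ^ k / fact k" .
  next
    fix A :: "nat \<Rightarrow> 'b set" and n
    assume A: "(\<forall>i<n. A i \<in> sets \<mu>) \<and> disjoint_family_on A {..<n}"
    show "prob_space.indep_vars (distr \<Omega> N \<eta>) (\<lambda>_. borel) (\<lambda>i \<omega>. num_points \<omega> (A i)) {..<n}"
    proof (rule indep_vars_distr_AE[OF \<Omega>.prob_space_axioms \<eta>m])
      show "(\<lambda>\<omega>. num_points \<omega> (A i)) \<in> borel_measurable N" if "i \<in> {..<n}" for i
        using npm A that by auto
      show "\<Omega>.indep_vars (\<lambda>_. borel) (\<lambda>i. T (A i)) {..<n}" using A by (intro indepT) auto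
      show "AE \<omega> in \<Omega>. num_points (\<eta> \<omega>) (A i) = T (A i) \<omega>" for i
        using GAE by eventually_elim (rule num)
    qed
  qed
  then show ?thesis by blast
qed

section \<open>Hierarchically good blocks\<close>

definition nbr :: "nat \<times> nat \<Rightarrow> nat \<times> nat \<Rightarrow> bool" where
  "nbr v w \<longleftrightarrow> (fst v = fst w \<and> (snd w = Suc (snd v) \<or> snd v = Suc (snd w))) \<or>
    (snd v = snd w \<and> (fst w = Suc (fst v) \<or> fst v = Suc (fst w)))"

lemma nbr_sym: "nbr v w \<longleftrightarrow> nbr w v"
  by (auto simp: nbr_def)

definition subblocks :: "nat \<times> nat \<Rightarrow> (nat \<times> nat) set" where
  "subblocks v = {3 * fst v..<3 * fst v + 3} \<times> {3 * snd v..<3 * snd v + 3}"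

text \<open>\<open>K\<close> is the set of failed sites. The pairwise form negates to two distinct
  bad subblocks, which is the branching recorded in \<open>bad_families\<close>.\<close>

primrec good :: "(nat \<times> nat) set \<Rightarrow> nat \<Rightarrow> nat \<times> nat \<Rightarrow> bool" where
  "good K 0 = (\<lambda>v. v \<notin> K)"
| "good K (Suc n) = (\<lambda>v. \<forall>w\<in>subblocks v. \<forall>w'\<in>subblocks v. w \<noteq> w' \<longrightarrow> good K n w \<or> good K n w')"

text \<open>The sites reached by descending through good subblocks only: the connected set that
  belongs to a good block.\<close>

primrec good_sites :: "(nat \<times> nat) set \<Rightarrow> nat \<Rightarrow> nat \<times> nat \<Rightarrow> (nat \<times> nat) set" where
  "good_sites K 0 = (\<lambda>v. {v})"
| "good_sites K (Suc n) = (\<lambda>v. \<Union>w\<in>{w\<in>subblocks v. good K n w}. good_sites K n w)"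

definition block :: "nat \<Rightarrow> nat \<times> nat \<Rightarrow> (nat \<times> nat) set" where
  "block n v = {x. fst x div 3 ^ n = fst v \<and> snd x div 3 ^ n = snd v}"

lemma subblocks_eq: "subblocks v = {w. fst w div 3 = fst v \<and> snd w div 3 = snd v}"
proof -
  have "x div 3 = a \<longleftrightarrow> 3 * a \<le> x \<and> x < 3 * a + 3" for x a :: nat by linarith
  then show ?thesis by (auto simp: subblocks_def)
qed

lemma subblocks_cases: "w \<in> subblocks v \<Longrightarrow> \<exists>i j. w = (3 * fst v + i, 3 * snd v + j) \<and> i < 3 \<and> j < 3"
  by (intro exI[of _ "fst w - 3 * fst v"] exI[of _ "snd w - 3 * snd v"]) (auto simp: subblocks_def prod_eq_iff)

lemma block_Suc: "block (Suc n) v = (\<Union>w\<in>subblocks v. block n w)"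
proof -
  have d: "x div 3 ^ Suc n = x div 3 ^ n div 3" for x :: nat
    by (simp only: power_Suc2 div_mult2_eq)
  show ?thesis unfolding block_def subblocks_eq d by auto
qed

lemma block_disjoint: "v \<noteq> w \<Longrightarrow> block n v \<inter> block n w = {}"
  by (auto simp: block_def prod_eq_iff)

lemma finite_block: "finite (block n v)"
proof (induction n arbitrary: v)
  case 0
  have "block 0 v = {v}" by (auto simp: block_def prod_eq_iff)
  then show ?case by simp
next
  case (Suc n) then show ?case unfolding block_Suc by (auto simp: subblocks_def)
qed

lemma block_mono0: "m \<le> n \<Longrightarrow> block m (0, 0) \<subseteq> block n (0, 0)"
proof -
  assume "m \<le> n"
  then have "(3::nat) ^ m \<le> 3 ^ n" by (intro power_increasing) auto
  then have "x < 3 ^ n" if "x < 3 ^ m" for x :: nat using that by (rule less_le_trans[rotated])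
  moreover have "x div 3 ^ k = 0 \<longleftrightarrow> x < 3 ^ k" for x k :: nat by (simp add: div_eq_0_iff)
  ultimately show ?thesis unfolding block_def by auto
qed

lemma good_sites_subset: "good_sites K n v \<subseteq> block n v"
proof (induction n arbitrary: v)
  case 0 show ?case by (simp add: block_def)
next
  case (Suc n) then show ?case unfolding block_Suc by auto
qed

lemma good_sites_open: "good K n v \<Longrightarrow> good_sites K n v \<inter> K = {}"
proof (induction n arbitrary: v)
  case (Suc n) then show ?case by auto
qed auto

lemma good_sites_nonempty: "good K n v \<Longrightarrow> good_sites K n v \<noteq> {}"
proof (induction n arbitrary: v)
  case (Suc n)
  let ?w = "(3 * fst v, 3 * snd v)" and ?w' = "(3 * fst v, 3 * snd v + 1)"
  have w: "?w \<in> subblocks v" "?w' \<in> subblocks v" by (auto simp: subblocks_def)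
  then have "good K n ?w \<or> good K n ?w'" using Suc.prems by simp
  then obtain u where "u \<in> subblocks v" "good K n u" using w by blast
  then show ?case using Suc.IH[of u] unfolding good_sites.simps by blast
qed simp

text \<open>Only one cell is bad, so some row and some column consist of good cells; every good cell
  is joined to their intersection.\<close>

lemma grid3_connected:
  fixes P :: "nat \<Rightarrow> nat \<Rightarrow> bool" and S :: "nat \<Rightarrow> nat \<Rightarrow> nat \<Rightarrow> nat \<Rightarrow> bool"
  assumes one: "\<And>i j i' j'. i < 3 \<Longrightarrow> j < 3 \<Longrightarrow> i' < 3 \<Longrightarrow> j' < 3 \<Longrightarrow> (i, j) \<noteq> (i', j') \<Longrightarrow> P i j \<or> P i' j'"
    and refl: "\<And>i j. P i j \<Longrightarrow> S i j i j"
    and trans: "\<And>i j i' j' i'' j''. S i j i' j' \<Longrightarrow> S i' j' i'' j'' \<Longrightarrow> P i' j' \<Longrightarrow> S i j i'' j''"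
    and sym: "\<And>i j i' j'. S i j i' j' \<Longrightarrow> S i' j' i j"
    and row: "\<And>i j. P i j \<Longrightarrow> P i (Suc j) \<Longrightarrow> S i j i (Suc j)"
    and col: "\<And>i j. P i j \<Longrightarrow> P (Suc i) j \<Longrightarrow> S i j (Suc i) j"
    and p: "i < 3" "j < 3" "P i j" and q: "i' < 3" "j' < 3" "P i' j'"
  shows "S i j i' j'"
proof -
  have less3: "x = 0 \<or> x = Suc 0 \<or> x = Suc (Suc 0)" if "x < 3" for x :: nat using that by auto
  have fullrow: "S i j i j'" if "i < 3" "j < 3" "j' < 3" "P i 0" "P i (Suc 0)" "P i (Suc (Suc 0))" for i j j'
  proof -
    have 1: "S i 0 i (Suc 0)" "S i (Suc 0) i (Suc (Suc 0))" using that row by auto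
    have 2: "S i 0 i (Suc (Suc 0))" by (rule trans[OF 1 that(5)])
    show ?thesis using less3[OF that(2)] less3[OF that(3)] 1 2 sym[OF 1(1)] sym[OF 1(2)] sym[OF 2]
        refl[OF that(4)] refl[OF that(5)] refl[OF that(6)] by (elim disjE) simp_all
  qed
  have fullcol: "S i j i' j" if "j < 3" "i < 3" "i' < 3" "P 0 j" "P (Suc 0) j" "P (Suc (Suc 0)) j" for i i' j
  proof -
    have 1: "S 0 j (Suc 0) j" "S (Suc 0) j (Suc (Suc 0)) j" using that col by auto
    have 2: "S 0 j (Suc (Suc 0)) j" by (rule trans[OF 1 that(5)])
    show ?thesis using less3[OF that(2)] less3[OF that(3)] 1 2 sym[OF 1(1)] sym[OF 1(2)] sym[OF 2]
        refl[OF that(4)] refl[OF that(5)] refl[OF that(6)] by (elim disjE) simp_all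
  qed
  have exrow: "\<exists>i0<3. \<forall>j<3. P i0 j"
  proof (rule ccontr)
    assume no: "\<not> ?thesis"
    then have no': "\<exists>j<3. \<not> P i j" if "i < 3" for i using that by blast
    obtain j0 where "j0 < 3" "\<not> P 0 j0" using no'[of 0] by auto
    moreover obtain j1 where "j1 < 3" "\<not> P 1 j1" using no'[of 1] by auto
    ultimately show False using one[of 0 j0 1 j1] by simp
  qed
  have excol: "\<exists>j0<3. \<forall>i<3. P i j0"
  proof (rule ccontr)
    assume no: "\<not> ?thesis"
    then have no': "\<exists>i<3. \<not> P i j" if "j < 3" for j using that by blast
    obtain i0 where "i0 < 3" "\<not> P i0 0" using no'[of 0] by auto
    moreover obtain i1 where "i1 < 3" "\<not> P i1 1" using no'[of 1] by auto
    ultimately show False using one[of i0 0 i1 1] by simp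
  qed
  obtain i0 j0 where ij: "i0 < 3" "j0 < 3" "\<And>j. j < 3 \<Longrightarrow> P i0 j" "\<And>i. i < 3 \<Longrightarrow> P i j0"
    using exrow excol by blast
  have cen: "S i j i0 j0" if ij': "i < 3" "j < 3" "P i j" for i j
  proof (cases "\<forall>j<3. P i j")
    case True
    then have "S i j i j0" using ij ij' by (intro fullrow) auto
    moreover have "S i j0 i0 j0" using ij ij' by (intro fullcol) auto
    ultimately show ?thesis using trans ij ij' by blast
  next
    case False
    then obtain jb where jb: "jb < 3" "\<not> P i jb" by blast
    have "P x j" if "x < 3" for x using one[of x j i jb] that jb ij' by auto
    then have "S i j i0 j" using ij ij' by (intro fullcol) auto
    moreover have "S i0 j i0 j0" using ij ij' by (intro fullrow) auto
    ultimately show ?thesis using trans ij ij' by blast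
  qed
  show ?thesis using cen[OF p] sym[OF cen[OF q]] trans ij by blast
qed

text \<open>Connection within a block and between adjacent blocks are proved in one induction, since
  the step inside a block uses both statements one level below. \<open>R\<close> is an abstract
  equivalence on the sites outside \<open>K\<close>; it will be the connection of the cells selected
  there.\<close>

lemma good_sites_connected:
  assumes refl: "\<And>x. x \<notin> K \<Longrightarrow> R x x" and sym: "\<And>x y. R x y \<Longrightarrow> R y x"
    and trans: "\<And>x y z. R x y \<Longrightarrow> R y z \<Longrightarrow> R x z"
    and adj: "\<And>x y. x \<notin> K \<Longrightarrow> y \<notin> K \<Longrightarrow> nbr x y \<Longrightarrow> R x y"
  shows "(\<forall>v. good K n v \<longrightarrow> (\<forall>x\<in>good_sites K n v. \<forall>y\<in>good_sites K n v. R x y)) \<and>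
    (\<forall>v w. good K n v \<longrightarrow> good K n w \<longrightarrow> nbr v w \<longrightarrow> (\<forall>x\<in>good_sites K n v. \<forall>y\<in>good_sites K n w. R x y))"
proof (induction n)
  case 0
  then show ?case using refl adj by auto
next
  case (Suc n)
  define S where "S v w \<longleftrightarrow> (\<forall>x\<in>good_sites K n v. \<forall>y\<in>good_sites K n w. R x y)" for v w
  have Srefl: "S v v" if "good K n v" for v using Suc that unfolding S_def by blast
  have Sadj: "S v w" if "good K n v" "good K n w" "nbr v w" for v w using Suc that unfolding S_def by blast
  have Ssym: "S v w \<Longrightarrow> S w v" for v w using sym unfolding S_def by blast
  \<comment> \<open>Composition passes through a site of the middle block, which nonemptiness
    supplies.\<close>
  have Strans: "S u w" if "S u v" "S v w" "good K n v" for u v w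
    using good_sites_nonempty[OF that(3)] that(1,2) trans unfolding S_def by blast
  have conn: "S w w'" if v: "good K (Suc n) v" and w: "w \<in> subblocks v" "w' \<in> subblocks v" "good K n w" "good K n w'" for v w w'
  proof -
    let ?P = "\<lambda>i j. good K n (3 * fst v + i, 3 * snd v + j)"
    let ?S = "\<lambda>i j i' j'. S (3 * fst v + i, 3 * snd v + j) (3 * fst v + i', 3 * snd v + j')"
    obtain i j where ij: "w = (3 * fst v + i, 3 * snd v + j)" "i < 3" "j < 3"
      using subblocks_cases[OF w(1)] by blast
    obtain i' j' where ij': "w' = (3 * fst v + i', 3 * snd v + j')" "i' < 3" "j' < 3"
      using subblocks_cases[OF w(2)] by blast
    have "?S i j i' j'"
    proof (rule grid3_connected[where P = ?P and S = ?S])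
      fix i j i' j' :: nat assume "i < 3" "j < 3" "i' < 3" "j' < 3" "(i, j) \<noteq> (i', j')"
      then show "?P i j \<or> ?P i' j'" using v by (simp add: subblocks_def)
    next
      show "?S i j i j" if "?P i j" for i j using Srefl that by blast
      show "?S i j i'' j''" if "?S i j i' j'" "?S i' j' i'' j''" "?P i' j'" for i j i' j' i'' j''
        using Strans that by blast
      show "?S i' j' i j" if "?S i j i' j'" for i j i' j' using Ssym that by blast
      show "?S i j i (Suc j)" if "?P i j" "?P i (Suc j)" for i j
        using that by (rule Sadj) (simp add: nbr_def)
      show "?S i j (Suc i) j" if "?P i j" "?P (Suc i) j" for i j
        using that by (rule Sadj) (simp add: nbr_def)
      show "?P i j" "?P i' j'" using ij(1) ij'(1) w by auto
    qed (fact ij ij')+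
    then show ?thesis using ij ij' by simp
  qed
  have in1: "R x y" if v: "good K (Suc n) v" and xy: "x \<in> good_sites K (Suc n) v" "y \<in> good_sites K (Suc n) v" for v x y
  proof -
    obtain w w' where "w \<in> subblocks v" "good K n w" "x \<in> good_sites K n w"
      "w' \<in> subblocks v" "good K n w'" "y \<in> good_sites K n w'"
      using xy unfolding good_sites.simps by blast
    then show ?thesis using conn[OF v, of w w'] unfolding S_def by blast
  qed
  \<comment> \<open>Three facing pairs \<open>(a i, b i)\<close> of subblocks lie along the common
    side. Each of the two blocks has at most one bad subblock, so at most two of the pairs are
    spoiled.\<close>
  have bridge: "\<exists>w\<in>subblocks v. \<exists>w'\<in>subblocks v'. good K n w \<and> good K n w' \<and> nbr w w'"
    if g: "good K (Suc n) v" "good K (Suc n) v'"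
      and h: "\<And>i. i < 3 \<Longrightarrow> a i \<in> subblocks v \<and> b i \<in> subblocks v' \<and> nbr (a i) (b i)" "inj_on a {..<3}" "inj_on b {..<3}"
    for v v' and a b :: "nat \<Rightarrow> _"
  proof (rule ccontr)
    assume no: "\<not> ?thesis"
    have bad: "\<not> good K n (a i) \<or> \<not> good K n (b i)" if "i < 3" for i using no h(1)[OF that] by blast
    have na: "good K n (a i) \<or> good K n (a j)" if "i < 3" "j < 3" "i \<noteq> j" for i j
      using g(1) h(1)[OF that(1)] h(1)[OF that(2)] h(2) that by (auto simp: inj_on_def)
    have nb: "good K n (b i) \<or> good K n (b j)" if "i < 3" "j < 3" "i \<noteq> j" for i j
      using g(2) h(1)[OF that(1)] h(1)[OF that(2)] h(3) that by (auto simp: inj_on_def)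
    show False using bad[of 0] bad[of 1] bad[of 2] na[of 0 1] na[of 0 2] na[of 1 2] nb[of 0 1] nb[of 0 2] nb[of 1 2]
      by auto
  qed
  have bridge': "\<exists>w\<in>subblocks v. \<exists>w'\<in>subblocks v'. good K n w \<and> good K n w' \<and> nbr w w'"
    if g: "good K (Suc n) v" "good K (Suc n) v'" and "nbr v v'" for v v'
  proof -
    consider "fst v = fst v'" "snd v' = Suc (snd v)" | "fst v = fst v'" "snd v = Suc (snd v')"
      | "snd v = snd v'" "fst v' = Suc (fst v)" | "snd v = snd v'" "fst v = Suc (fst v')"
      using \<open>nbr v v'\<close> unfolding nbr_def by blast
    then show ?thesis
    proof cases
      case 1
      show ?thesis by (rule bridge[OF g, of "\<lambda>i. (3 * fst v + i, 3 * snd v + 2)" "\<lambda>i. (3 * fst v + i, 3 * snd v + 3)"])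
        (use 1 in \<open>auto simp: subblocks_def nbr_def inj_on_def\<close>)
    next
      case 2
      show ?thesis by (rule bridge[OF g, of "\<lambda>i. (3 * fst v + i, 3 * snd v' + 3)" "\<lambda>i. (3 * fst v + i, 3 * snd v' + 2)"])
        (use 2 in \<open>auto simp: subblocks_def nbr_def inj_on_def\<close>)
    next
      case 3
      show ?thesis by (rule bridge[OF g, of "\<lambda>i. (3 * fst v + 2, 3 * snd v + i)" "\<lambda>i. (3 * fst v + 3, 3 * snd v + i)"])
        (use 3 in \<open>auto simp: subblocks_def nbr_def inj_on_def\<close>)
    next
      case 4
      show ?thesis by (rule bridge[OF g, of "\<lambda>i. (3 * fst v' + 3, 3 * snd v + i)" "\<lambda>i. (3 * fst v' + 2, 3 * snd v + i)"])
        (use 4 in \<open>auto simp: subblocks_def nbr_def inj_on_def\<close>)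
    qed
  qed
  have in2: "R x y" if g: "good K (Suc n) v" "good K (Suc n) v'" "nbr v v'"
    and xy: "x \<in> good_sites K (Suc n) v" "y \<in> good_sites K (Suc n) v'" for v v' x y
  proof -
    obtain w w' where w: "w \<in> subblocks v" "w' \<in> subblocks v'" "good K n w" "good K n w'" "nbr w w'"
      using bridge'[OF g] by blast
    obtain z z' where z: "z \<in> good_sites K n w" "z' \<in> good_sites K n w'"
      using good_sites_nonempty w by blast
    have "z \<in> good_sites K (Suc n) v" "z' \<in> good_sites K (Suc n) v'"
      using z w unfolding good_sites.simps by blast+
    then have "R x z" "R z' y" using in1 g xy by blast+
    moreover have "R z z'" using Sadj w z unfolding S_def by blast
    ultimately show ?thesis using trans by blast
  qed
  show ?case using in1 in2 by blast
qed

text \<open>The block \<open>(0, 0)\<close> of one level is a subblock of \<open>(0, 0)\<close> of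
  the next, so the connected sets of these good blocks are nested and a site at level
  \<open>m\<close> is joined to every site of the set at level \<open>n\<close>, in particular to
  one in the last third of the large block.\<close>

lemma good_path:
  assumes refl: "\<And>x. x \<notin> K \<Longrightarrow> R x x" and sym: "\<And>x y. R x y \<Longrightarrow> R y x"
    and trans: "\<And>x y z. R x y \<Longrightarrow> R y z \<Longrightarrow> R x z"
    and adj: "\<And>x y. x \<notin> K \<Longrightarrow> y \<notin> K \<Longrightarrow> nbr x y \<Longrightarrow> R x y"
    and g: "\<And>j. m \<le> j \<Longrightarrow> j \<le> n \<Longrightarrow> good K j (0, 0)" and mn: "m < n"
  shows "\<exists>x\<in>block m (0, 0). \<exists>y\<in>block n (0, 0). n \<le> fst y \<and> x \<notin> K \<and> y \<notin> K \<and> R x y"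
proof -
  have nest: "good_sites K m (0, 0) \<subseteq> good_sites K j (0, 0)" if "m \<le> j" "j \<le> n" for j
    using that
  proof (induction j rule: dec_induct)
    case (step j)
    then have "good K j (0, 0)" using g by simp
    moreover have "(0, 0) \<in> subblocks (0, 0)" by (simp add: subblocks_def)
    ultimately show ?case using step by auto
  qed simp
  obtain k where k: "n = Suc k" using mn by (cases n) auto
  have gn: "good K n (0, 0)" and gm: "good K m (0, 0)" using g mn by auto
  obtain x where x: "x \<in> good_sites K m (0, 0)" using good_sites_nonempty[OF gm] by blast
  \<comment> \<open>Of these two subblocks with first coordinate 2 one is good. Its sites have first
    coordinate at least 2 * 3 ^ k, hence at least k + 1 = n.\<close>
  have "(2, 0) \<in> subblocks (0, 0)" "(2, 1) \<in> subblocks (0, 0)" by (auto simp: subblocks_def)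
  then obtain w where w: "w \<in> subblocks (0, 0)" "fst w = 2" "good K k w"
    using gn unfolding k good.simps by (metis fst_conv snd_conv zero_neq_one)
  obtain y where y: "y \<in> good_sites K k w" using good_sites_nonempty[OF w(3)] by blast
  have yn: "y \<in> good_sites K n (0, 0)" using y w unfolding k good_sites.simps by blast
  have "y \<in> block k w" using y good_sites_subset by blast
  then have "fst y div 3 ^ k = 2" using w by (simp add: block_def)
  then have "2 * 3 ^ k \<le> fst y" by (metis div_times_less_eq_dividend)
  moreover have "Suc k \<le> 2 * 3 ^ k" by (induction k) auto
  ultimately have "n \<le> fst y" using k by linarith
  moreover have "R x y"
  proof -
    have "\<forall>v. good K n v \<longrightarrow> (\<forall>x\<in>good_sites K n v. \<forall>y\<in>good_sites K n v. R x y)"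
      by (rule conjunct1[OF good_sites_connected[where R = R, OF refl sym trans adj]])
    moreover have "x \<in> good_sites K n (0, 0)" using nest[of n] mn x by auto
    ultimately show ?thesis using gn yn by blast
  qed
  moreover have "x \<notin> K" "y \<notin> K" using good_sites_open[OF gm] good_sites_open[OF gn] x yn by blast+
  moreover have "x \<in> block m (0, 0)" "y \<in> block n (0, 0)" using x yn good_sites_subset by blast+
  ultimately show ?thesis by blast
qed

text \<open>Witnesses of badness: a bad block has two distinct bad subblocks, each of these has two
  again, and so on. The leaves of such a binary tree are failed sites.\<close>

primrec bad_families :: "nat \<Rightarrow> nat \<times> nat \<Rightarrow> (nat \<times> nat) set set" where
  "bad_families 0 = (\<lambda>v. {{v}})"
| "bad_families (Suc n) = (\<lambda>v. \<Union>(w, w')\<in>{(w, w'). w \<in> subblocks v \<and> w' \<in> subblocks v \<and> w \<noteq> w'}.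
     (\<lambda>(F, F'). F \<union> F') ` (bad_families n w \<times> bad_families n w'))"

lemma not_good_bad_families: "\<not> good K n v \<Longrightarrow> \<exists>F\<in>bad_families n v. F \<subseteq> K"
proof (induction n arbitrary: v)
  case (Suc n)
  then obtain w w' where w: "w \<in> subblocks v" "w' \<in> subblocks v" "w \<noteq> w'" "\<not> good K n w" "\<not> good K n w'" by auto
  then obtain F F' where "F \<in> bad_families n w" "F' \<in> bad_families n w'" "F \<subseteq> K" "F' \<subseteq> K" using Suc.IH by meson
  moreover have "F \<union> F' \<in> bad_families (Suc n) v"
    unfolding bad_families.simps using w calculation by blast
  ultimately show ?case by blast
qed simp

text \<open>The two branches lie in disjoint blocks, so the number of leaves doubles. The number of
  families obeys the recursion N' \<le> 81 * N * N with N = 1 at level 0, where 81 bounds the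
  ordered pairs of subblocks; the exponent 2 ^ n - 1 solves it.\<close>

lemma bad_families_props:
  "finite (bad_families n v) \<and> card (bad_families n v) \<le> 81 ^ (2 ^ n - 1) \<and>
    (\<forall>F\<in>bad_families n v. F \<subseteq> block n v \<and> card F = 2 ^ n)"
proof (induction n arbitrary: v)
  case 0 show ?case by (auto simp: block_def)
next
  case (Suc n)
  let ?I = "{(w, w'). w \<in> subblocks v \<and> w' \<in> subblocks v \<and> w \<noteq> w'}"
  have I: "?I \<subseteq> subblocks v \<times> subblocks v" by auto
  have fs: "finite (subblocks v)" "card (subblocks v) = 9" by (auto simp: subblocks_def)
  then have fI: "finite ?I" using I finite_subset by blast
  have cI: "card ?I \<le> 81" using card_mono[OF _ I] fs by (simp add: card_cartesian_product)
  have step: "finite ((\<lambda>(F, F'). F \<union> F') ` (bad_families n w \<times> bad_families n w')) \<and>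
     card ((\<lambda>(F, F'). F \<union> F') ` (bad_families n w \<times> bad_families n w')) \<le> 81 ^ (2 ^ n - 1) * 81 ^ (2 ^ n - 1)" for w w'
  proof
    show "finite ((\<lambda>(F, F'). F \<union> F') ` (bad_families n w \<times> bad_families n w'))" using Suc by simp
    have "card ((\<lambda>(F, F'). F \<union> F') ` (bad_families n w \<times> bad_families n w')) \<le> card (bad_families n w \<times> bad_families n w')"
      using Suc by (intro card_image_le) auto
    also have "\<dots> \<le> 81 ^ (2 ^ n - 1) * 81 ^ (2 ^ n - 1)"
      using Suc unfolding card_cartesian_product by (intro mult_mono) auto
    finally show "card ((\<lambda>(F, F'). F \<union> F') ` (bad_families n w \<times> bad_families n w')) \<le> 81 ^ (2 ^ n - 1) * 81 ^ (2 ^ n - 1)" .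
  qed
  have "card (bad_families (Suc n) v) \<le> (\<Sum>(w, w')\<in>?I. card ((\<lambda>(F, F'). F \<union> F') ` (bad_families n w \<times> bad_families n w')))"
    using card_UN_le[OF fI, of "\<lambda>(w, w'). (\<lambda>(F, F'). F \<union> F') ` (bad_families n w \<times> bad_families n w')"]
    by (simp add: case_prod_unfold)
  also have "\<dots> \<le> (\<Sum>(w, w')\<in>?I. 81 ^ (2 ^ n - 1) * 81 ^ (2 ^ n - 1))"
    using step by (intro sum_mono) (auto split: prod.split)
  also have "\<dots> = card ?I * (81 ^ (2 ^ n - 1) * 81 ^ (2 ^ n - 1))" by (simp add: case_prod_unfold)
  also have "\<dots> \<le> 81 * (81 ^ (2 ^ n - 1) * 81 ^ (2 ^ n - 1))" using cI by (rule mult_right_mono) simp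
  also have "\<dots> = 81 ^ (2 ^ Suc n - 1)"
  proof -
    obtain k :: nat where "2 ^ n = Suc k" by (metis gr0_implies_Suc zero_less_numeral zero_less_power)
    then show ?thesis by (simp add: power_add mult_2)
  qed
  finally have "card (bad_families (Suc n) v) \<le> 81 ^ (2 ^ Suc n - 1)" .
  moreover have "finite (bad_families (Suc n) v)" using fI step by auto
  moreover have "F \<subseteq> block (Suc n) v \<and> card F = 2 ^ Suc n" if F: "F \<in> bad_families (Suc n) v" for F
  proof -
    obtain w w' A A' where A: "w \<in> subblocks v" "w' \<in> subblocks v" "w \<noteq> w'" "A \<in> bad_families n w" "A' \<in> bad_families n w'" "F = A \<union> A'"
      using F by auto
    have B: "A \<subseteq> block n w" "A' \<subseteq> block n w'" "card A = 2 ^ n" "card A' = 2 ^ n" using Suc A by auto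
    have "A \<inter> A' = {}" using B block_disjoint[OF A(3)] by blast
    moreover have "finite A" "finite A'" using B finite_block finite_subset by metis+
    ultimately have "card F = 2 ^ Suc n" using A(6) B by (simp add: card_Un_disjoint)
    then show ?thesis using A B unfolding block_Suc by blast
  qed
  ultimately show ?case by blast
qed

section \<open>Exploration of independent blocks\<close>

text \<open>The coordinate \<open>w\<close> is revealed before the others. Given its value they keep
  their product law, and the conditional bound depends only on whether this value lies in
  \<open>S\<close>.\<close>

lemma prob_Pi_pmf_insert_le:
  fixes p :: "'v \<Rightarrow> 'x pmf"
  assumes U: "finite U" "w \<notin> U"
    and le: "\<And>y. y \<in> set_pmf (p w) \<Longrightarrow> measure_pmf.prob (Pi_pmf U d p) {X. P (X(w := y))} \<le> (if y \<in> S then b else c)"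
    and b: "0 \<le> b" and c: "0 \<le> c"
  shows "measure_pmf.prob (Pi_pmf (insert w U) d p) {X. P X} \<le> measure_pmf.prob (p w) S * b + measure_pmf.prob (p w) (- S) * c"
proof -
  have "emeasure (measure_pmf (Pi_pmf (insert w U) d p)) {X. P X}
      = (\<integral>\<^sup>+y. emeasure (measure_pmf (map_pmf (\<lambda>X. X(w := y)) (Pi_pmf U d p))) {X. P X} \<partial>measure_pmf (p w))"
    by (simp add: Pi_pmf_insert'[OF U] map_pmf_def)
  also have "\<dots> \<le> (\<integral>\<^sup>+y. ennreal b * indicator S y + ennreal c * indicator (- S) y \<partial>measure_pmf (p w))"
  proof (rule nn_integral_mono_AE, rule AE_pmfI)
    fix y assume y: "y \<in> set_pmf (p w)"
    have "emeasure (measure_pmf (map_pmf (\<lambda>X. X(w := y)) (Pi_pmf U d p))) {X. P X}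
        = ennreal (measure_pmf.prob (Pi_pmf U d p) {X. P (X(w := y))})"
      by (simp add: measure_pmf.emeasure_eq_measure vimage_def)
    also have "\<dots> \<le> ennreal (if y \<in> S then b else c)" by (rule ennreal_leI[OF le[OF y]])
    also have "\<dots> = ennreal b * indicator S y + ennreal c * indicator (- S) y" by (simp add: indicator_def)
    finally show "emeasure (measure_pmf (map_pmf (\<lambda>X. X(w := y)) (Pi_pmf U d p))) {X. P X}
        \<le> ennreal b * indicator S y + ennreal c * indicator (- S) y" .
  qed
  also have "\<dots> = ennreal b * emeasure (measure_pmf (p w)) S + ennreal c * emeasure (measure_pmf (p w)) (- S)"
    by (simp add: nn_integral_add nn_integral_cmult)
  also have "\<dots> = ennreal (measure_pmf.prob (p w) S * b + measure_pmf.prob (p w) (- S) * c)"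
  proof -
    let ?s = "measure_pmf.prob (p w) S" and ?t = "measure_pmf.prob (p w) (- S)"
    have "ennreal (?s * b + ?t * c) = ennreal (?s * b) + ennreal (?t * c)"
      using b c by (intro ennreal_plus) auto
    also have "ennreal (?s * b) = ennreal b * ennreal ?s" using b by (simp add: ennreal_mult' mult.commute)
    also have "ennreal (?t * c) = ennreal c * ennreal ?t" using c by (simp add: ennreal_mult' mult.commute)
    finally show ?thesis unfolding measure_pmf.emeasure_eq_measure ..
  qed
  finally have "ennreal (measure_pmf.prob (Pi_pmf (insert w U) d p) {X. P X})
      \<le> ennreal (measure_pmf.prob (p w) S * b + measure_pmf.prob (p w) (- S) * c)"
    unfolding measure_pmf.emeasure_eq_measure .
  moreover have "0 \<le> measure_pmf.prob (p w) S * b + measure_pmf.prob (p w) (- S) * c" using b c by simp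
  ultimately show ?thesis using ennreal_le_iff by blast
qed

text \<open>A partial map \<open>f\<close> records the cell selected in each block reached so far, \<open>U\<close> is the set of
  unexplored blocks. As long as some reached block has an unexplored neighbour, such a neighbour is
  explored next, so that the reached blocks with unexplored neighbours all belong to the current
  cluster. The set \<open>K X\<close> of failed blocks then separates different clusters.\<close>

definition linked :: "('v \<Rightarrow> 'v \<Rightarrow> bool) \<Rightarrow> ('c \<Rightarrow> 'c \<Rightarrow> bool) \<Rightarrow> ('v \<rightharpoonup> 'c) \<Rightarrow> bool" where
  "linked nb R f \<longleftrightarrow> (\<forall>v w Q Q'. f v = Some Q \<longrightarrow> f w = Some Q' \<longrightarrow> nb v w \<longrightarrow> R Q Q')"

definition active_linked :: "('v \<Rightarrow> 'v \<Rightarrow> bool) \<Rightarrow> ('c \<Rightarrow> 'c \<Rightarrow> bool) \<Rightarrow> 'v set \<Rightarrow> ('v \<rightharpoonup> 'c) \<Rightarrow> bool" where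
  "active_linked nb R U f \<longleftrightarrow> (\<forall>v w Q Q' x y. f v = Some Q \<longrightarrow> f w = Some Q' \<longrightarrow>
     x \<in> U \<longrightarrow> nb v x \<longrightarrow> y \<in> U \<longrightarrow> nb w y \<longrightarrow> R Q Q')"

definition explores where
  "explores nb a p U f K \<longleftrightarrow> (\<forall>X Occ R.
     (\<forall>v\<in>U. X v \<in> set_pmf (p v) \<and> X v \<subseteq> Occ) \<longrightarrow> ran f \<subseteq> Occ \<longrightarrow> equivp R \<longrightarrow>
     (\<forall>Q\<in>Occ. \<forall>Q'\<in>Occ. a Q Q' \<longrightarrow> R Q Q') \<longrightarrow> linked nb R f \<longrightarrow> active_linked nb R U f \<longrightarrow>
     (\<exists>g. dom g = dom f \<union> (U - K X) \<and> f \<subseteq>\<^sub>m g \<and> (\<forall>v Q. v \<in> U \<longrightarrow> g v = Some Q \<longrightarrow> Q \<in> X v) \<and> linked nb R g))"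

text \<open>Induction on the number of unexplored blocks. The next block \<open>w\<close> and the
  target set \<open>D\<close> depend on \<open>f\<close> and \<open>U\<close> alone, so they are
  fixed before \<open>X w\<close> is revealed; how the rest is explored may depend on the value
  seen. Thus every failure costs a factor \<epsilon> conditionally on the past, although the
  failures themselves are not independent.\<close>

lemma exploration:
  fixes p :: "'v \<Rightarrow> 'c set pmf" and nb :: "'v \<Rightarrow> 'v \<Rightarrow> bool" and a :: "'c \<Rightarrow> 'c \<Rightarrow> bool"
  assumes nb: "\<And>v w. nb v w \<Longrightarrow> nb w v" and irr: "\<And>v. \<not> nb v v"
    and B: "\<And>v X. X \<in> set_pmf (p v) \<Longrightarrow> X \<subseteq> B v"
    and H: "\<And>v w Q. nb v w \<Longrightarrow> Q \<in> B v \<Longrightarrow> measure_pmf.prob (p w) {X. X \<inter> {Q'. a Q Q'} = {}} \<le> \<epsilon>"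
    and H0: "\<And>w. measure_pmf.prob (p w) {X. X = {}} \<le> \<epsilon>"
    and \<epsilon>: "0 \<le> \<epsilon>"
  shows "finite U \<Longrightarrow> dom f \<inter> U = {} \<Longrightarrow> (\<forall>v Q. f v = Some Q \<longrightarrow> Q \<in> B v) \<Longrightarrow>
    \<exists>K. (\<forall>X. K X \<subseteq> U) \<and> explores nb a p U f K \<and>
      (\<forall>F. F \<subseteq> U \<longrightarrow> measure_pmf.prob (Pi_pmf U {} p) {X. F \<subseteq> K X} \<le> \<epsilon> ^ card F)"
proof (induction "card U" arbitrary: U f)
  case 0
  then have U: "U = {}" by simp
  have "explores nb a p {} f (\<lambda>_. {})" unfolding explores_def
    by (intro allI impI exI[of _ f]) auto
  then show ?case unfolding U by (intro exI[of _ "\<lambda>_. {}"]) auto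
next
  case (Suc n)
  \<comment> \<open>Either \<open>w\<close> adjoins a reached block, and \<open>D\<close> consists
    of the cells to which its selected cell is linked by \<open>a\<close>, or no reached block
    adjoins \<open>U\<close>, and a new cluster is started at any \<open>w\<close> with
    \<open>D = UNIV\<close>, where failure means that \<open>X w\<close> is empty.\<close>
  have "\<exists>w\<in>U. \<exists>D. measure_pmf.prob (p w) {X. X \<inter> D = {}} \<le> \<epsilon> \<and>
      ((\<exists>v Q. f v = Some Q \<and> nb v w \<and> D = {Q'. a Q Q'}) \<or> (\<forall>v\<in>dom f. \<forall>w\<in>U. \<not> nb v w))"
  proof (cases "\<exists>v\<in>dom f. \<exists>w\<in>U. nb v w")
    case True
    then obtain v Q w where v: "f v = Some Q" "w \<in> U" "nb v w" by auto
    then show ?thesis using H[OF v(3), of Q] Suc.prems(3) by blast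
  next
    case False
    obtain w where "w \<in> U" using Suc by fastforce
    then show ?thesis using False H0[of w] by (intro bexI[of _ w] exI[of _ UNIV]) auto
  qed
  then obtain w D where w: "w \<in> U" and D: "measure_pmf.prob (p w) {X. X \<inter> D = {}} \<le> \<epsilon>"
    and cs: "(\<exists>v Q. f v = Some Q \<and> nb v w \<and> D = {Q'. a Q Q'}) \<or> (\<forall>v\<in>dom f. \<forall>w\<in>U. \<not> nb v w)" by blast
  define U' where "U' = U - {w}"
  have U': "finite U'" "w \<notin> U'" "U = insert w U'" "n = card U'" using Suc w by (auto simp: U'_def)
  define q where "q Y = (SOME Q. Q \<in> Y \<inter> D)" for Y
  have q: "q Y \<in> Y \<inter> D" if "Y \<inter> D \<noteq> {}" for Y unfolding q_def using that by (metis all_not_in_conv someI_ex)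
  define f' where "f' Y = (if Y \<inter> D = {} then f else f(w \<mapsto> q Y))" for Y
  have fw: "f w = None" using Suc.prems(2) w by auto
  have "\<forall>Y. \<exists>K. Y \<in> set_pmf (p w) \<longrightarrow> (\<forall>X. K X \<subseteq> U') \<and> explores nb a p U' (f' Y) K \<and>
      (\<forall>F. F \<subseteq> U' \<longrightarrow> measure_pmf.prob (Pi_pmf U' {} p) {X. F \<subseteq> K X} \<le> \<epsilon> ^ card F)"
  proof
    fix Y
    show "\<exists>K. Y \<in> set_pmf (p w) \<longrightarrow> (\<forall>X. K X \<subseteq> U') \<and> explores nb a p U' (f' Y) K \<and>
      (\<forall>F. F \<subseteq> U' \<longrightarrow> measure_pmf.prob (Pi_pmf U' {} p) {X. F \<subseteq> K X} \<le> \<epsilon> ^ card F)"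
    proof (cases "Y \<in> set_pmf (p w)")
      case True
      have 1: "dom (f' Y) \<inter> U' = {}" using Suc.prems(2) U' by (auto simp: f'_def)
      have 2: "\<forall>v Q. f' Y v = Some Q \<longrightarrow> Q \<in> B v"
        using Suc.prems(3) B[OF True] q[of Y] by (auto simp: f'_def)
      show ?thesis using Suc.hyps(1)[OF U'(4) U'(1) 1 2] by blast
    qed blast
  qed
  from choice[OF this] obtain KK where KK:
    "\<And>Y X. Y \<in> set_pmf (p w) \<Longrightarrow> KK Y X \<subseteq> U'" "\<And>Y. Y \<in> set_pmf (p w) \<Longrightarrow> explores nb a p U' (f' Y) (KK Y)"
    "\<And>Y F. Y \<in> set_pmf (p w) \<Longrightarrow> F \<subseteq> U' \<Longrightarrow> measure_pmf.prob (Pi_pmf U' {} p) {X. F \<subseteq> KK Y X} \<le> \<epsilon> ^ card F"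
    by blast
  \<comment> \<open>The coordinate \<open>w\<close> is reset to \<open>{}\<close> because the
    failure map for \<open>U'\<close> is evaluated on samples of \<open>Pi_pmf U' {} p\<close>,
    which have this default value there.\<close>
  define K where "K X = (if X w \<in> set_pmf (p w) then (if X w \<inter> D = {} then {w} else {}) \<union> KK (X w) (X(w := {})) else {})" for X
  have "\<forall>X. K X \<subseteq> U" using KK(1) U'(3) by (auto simp: K_def)
  moreover have "measure_pmf.prob (Pi_pmf U {} p) {X. F \<subseteq> K X} \<le> \<epsilon> ^ card F" if F: "F \<subseteq> U" for F
  proof -
    define b where "b = \<epsilon> ^ card (F - {w})"
    have b: "0 \<le> b" using \<epsilon> by (simp add: b_def)
    have fF: "finite F" using F Suc.prems(1) finite_subset by blast
    \<comment> \<open>If \<open>w\<close> is in \<open>F\<close>, success at \<open>w\<close> rules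
      out \<open>F \<subseteq> K X\<close>, since later failures lie in \<open>U'\<close>: the
      second weight is 0 and the first yields the factor \<epsilon>. Otherwise both cases carry the
      same weight \<open>b\<close>.\<close>
    have "measure_pmf.prob (Pi_pmf (insert w U') {} p) {X. F \<subseteq> K X}
      \<le> measure_pmf.prob (p w) {X. X \<inter> D = {}} * b + measure_pmf.prob (p w) (- {X. X \<inter> D = {}}) * (if w \<in> F then 0 else b)"
    proof (rule prob_Pi_pmf_insert_le[OF U'(1,2)])
      fix y assume y: "y \<in> set_pmf (p w)"
      have "measure_pmf.prob (Pi_pmf U' {} p) {X. F \<subseteq> K (X(w := y))}
        = measure_pmf.prob (Pi_pmf U' {} p) {X. F \<subseteq> (if y \<inter> D = {} then {w} else {}) \<union> KK y X}"
      proof (rule measure_pmf.finite_measure_eq_AE)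
        show "AE x in measure_pmf (Pi_pmf U' {} p). (x \<in> {X. F \<subseteq> K (X(w := y))}) =
            (x \<in> {X. F \<subseteq> (if y \<inter> D = {} then {w} else {}) \<union> KK y X})"
        proof (rule AE_pmfI)
          fix x assume "x \<in> set_pmf (Pi_pmf U' {} p)"
          then have "x w = {}" using set_Pi_pmf_subset[OF U'(1)] U'(2) by fast
          then have "(x(w := y))(w := {}) = x" by (simp add: fun_upd_idem)
          then show "(x \<in> {X. F \<subseteq> K (X(w := y))}) = (x \<in> {X. F \<subseteq> (if y \<inter> D = {} then {w} else {}) \<union> KK y X})"
            using y by (simp add: K_def)
        qed
      qed auto
      also have "\<dots> \<le> (if y \<in> {X. X \<inter> D = {}} then b else if w \<in> F then 0 else b)"
      proof (cases "y \<inter> D \<noteq> {} \<and> w \<in> F")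
        case True
        then have "{X. F \<subseteq> (if y \<inter> D = {} then {w} else {}) \<union> KK y X} = {}" using KK(1)[OF y] U'(2) by auto
        then show ?thesis using True by simp
      next
        case False
        have "measure_pmf.prob (Pi_pmf U' {} p) {X. F \<subseteq> (if y \<inter> D = {} then {w} else {}) \<union> KK y X}
            \<le> measure_pmf.prob (Pi_pmf U' {} p) {X. F - {w} \<subseteq> KK y X}"
          by (rule measure_pmf.finite_measure_mono) auto
        also have "\<dots> \<le> b" unfolding b_def using F U'(3) by (intro KK(3)[OF y]) auto
        also have "b = (if y \<in> {X. X \<inter> D = {}} then b else if w \<in> F then 0 else b)" using False by auto
        finally show ?thesis .
      qed
      finally show "measure_pmf.prob (Pi_pmf U' {} p) {X. F \<subseteq> K (X(w := y))}
        \<le> (if y \<in> {X. X \<inter> D = {}} then b else if w \<in> F then 0 else b)" .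
    qed (use b in auto)
    also have "\<dots> \<le> \<epsilon> ^ card F"
    proof (cases "w \<in> F")
      case True
      then have "card F = Suc (card (F - {w}))" using card_Suc_Diff1[OF fF True] by simp
      then have "\<epsilon> ^ card F = \<epsilon> * b" unfolding b_def by (metis power_Suc)
      then show ?thesis using True mult_right_mono[OF D b] by simp
    next
      case False
      have "measure_pmf.prob (p w) {X. X \<inter> D = {}} + measure_pmf.prob (p w) (- {X. X \<inter> D = {}}) = 1"
        using measure_pmf.prob_compl[of "{X. X \<inter> D = {}}" "p w"] by (simp add: Compl_eq_Diff_UNIV)
      moreover have "b = \<epsilon> ^ card F" using False by (simp add: b_def)
      ultimately show ?thesis using False by (simp flip: distrib_right)
    qed
    finally show ?thesis using U'(3) by simp
  qed
  moreover have "explores nb a p U f K" unfolding explores_def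
  proof (intro allI impI)
    fix X Occ R
    assume X: "\<forall>v\<in>U. X v \<in> set_pmf (p v) \<and> X v \<subseteq> Occ" and ran: "ran f \<subseteq> Occ" and R: "equivp R"
      and aR: "\<forall>Q\<in>Occ. \<forall>Q'\<in>Occ. a Q Q' \<longrightarrow> R Q Q'" and lf: "linked nb R f" and al: "active_linked nb R U f"
    define Y where "Y = X w"
    have Y: "Y \<in> set_pmf (p w)" "Y \<subseteq> Occ" using X w by (auto simp: Y_def)
    have Rr: "R Q Q" and Rs: "R Q Q' \<Longrightarrow> R Q' Q" and Rt: "R Q Q' \<Longrightarrow> R Q' Q'' \<Longrightarrow> R Q Q''" for Q Q' Q''
      using equivp_reflp[OF R] equivp_symp[OF R] equivp_transp[OF R] by blast+
    have X': "\<forall>v\<in>U'. (X(w := {})) v \<in> set_pmf (p v) \<and> (X(w := {})) v \<subseteq> Occ" using X U' by auto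
    have ran': "ran (f' Y) \<subseteq> Occ" using ran q[of Y] Y fw by (auto simp: f'_def ran_map_upd)
    \<comment> \<open>There is a reached block \<open>v0\<close> adjoining \<open>w\<close> whose
      cell \<open>Q0\<close> is linked to \<open>q Y\<close> by the choice of \<open>D\<close>. Both
      \<open>v\<close> and \<open>v0\<close> adjoin the unexplored \<open>w\<close>, so
      \<open>active_linked\<close> relates \<open>Q\<close> to \<open>Q0\<close>.\<close>
    have new: "R Q (q Y)" if h: "f v = Some Q" "nb v w" "Y \<inter> D \<noteq> {}" for v Q
    proof -
      obtain v0 Q0 where v0: "f v0 = Some Q0" "nb v0 w" "D = {Q'. a Q0 Q'}" using cs h w by blast
      have "Q0 \<in> Occ" using ran v0 by (auto intro: ranI)
      then have "R Q0 (q Y)" using aR q[OF h(3)] Y v0 by auto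
      moreover have "R Q Q0" using al h v0 w unfolding active_linked_def by blast
      ultimately show ?thesis using Rt by blast
    qed
    have new2: "R Q (q Y)" if h: "f v = Some Q" "nb v x" "x \<in> U" "Y \<inter> D \<noteq> {}" for v Q x
    proof -
      obtain v0 Q0 where v0: "f v0 = Some Q0" "nb v0 w" using cs h by blast
      have "R Q Q0" using al h v0 w unfolding active_linked_def by blast
      then show ?thesis using new[OF v0 h(4)] Rt by blast
    qed
    have lf': "linked nb R (f' Y)"
      using lf new Rs nb irr unfolding linked_def f'_def by (auto split: if_splits)
    have al': "active_linked nb R U' (f' Y)"
      unfolding active_linked_def
    proof (intro allI impI)
      fix v v' Q Q' x y
      assume h: "f' Y v = Some Q" "f' Y v' = Some Q'" "x \<in> U'" "nb v x" "y \<in> U'" "nb v' y"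
      have xy: "x \<in> U" "y \<in> U" using h U' by auto
      show "R Q Q'"
      proof (cases "Y \<inter> D = {}")
        case True
        then show ?thesis using al h xy unfolding active_linked_def f'_def by auto
      next
        case False
        have "R Q (q Y)" using h(1,4) False new2[of v Q x] xy Rr by (auto simp: f'_def split: if_splits)
        moreover have "R Q' (q Y)" using h(2,6) False new2[of v' Q' y] xy Rr by (auto simp: f'_def split: if_splits)
        ultimately show ?thesis using Rs Rt by blast
      qed
    qed
    obtain g where g: "dom g = dom (f' Y) \<union> (U' - KK Y (X(w := {})))" "f' Y \<subseteq>\<^sub>m g"
        "\<And>v Q. v \<in> U' \<Longrightarrow> g v = Some Q \<Longrightarrow> Q \<in> (X(w := {})) v" "linked nb R g"
      using KK(2)[OF Y(1), unfolded explores_def, rule_format, of "X(w := {})" Occ R] X' ran' R aR lf' al' by blast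
    have KX: "K X = (if Y \<inter> D = {} then {w} else {}) \<union> KK Y (X(w := {}))"
      using Y by (simp add: K_def Y_def)
    have "dom g = dom f \<union> (U - K X)"
      unfolding g(1) KX using U'(2,3) KK(1)[OF Y(1), of "X(w := {})"] by (auto simp: f'_def)
    moreover have "f \<subseteq>\<^sub>m f' Y" using fw by (auto simp: f'_def map_le_def)
    then have "f \<subseteq>\<^sub>m g" using g(2) map_le_trans by blast
    moreover have "Q \<in> X v" if v: "v \<in> U" "g v = Some Q" for v Q
    proof (cases "v = w")
      case True
      have "w \<notin> U' - KK Y (X(w := {}))" using U'(2) by blast
      moreover have "w \<in> dom g" using v True by auto
      ultimately have "w \<in> dom (f' Y)" using g(1) by blast
      then have "Y \<inter> D \<noteq> {}" "f' Y w = Some (q Y)" using fw by (auto simp: f'_def split: if_splits)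
      moreover have "g w = f' Y w" using g(2) \<open>w \<in> dom (f' Y)\<close> by (auto simp: map_le_def)
      ultimately show ?thesis using q[of Y] v True by (auto simp: Y_def)
    next
      case False
      then show ?thesis using g(3)[of v Q] v U'(3) by auto
    qed
    ultimately show "\<exists>g. dom g = dom f \<union> (U - K X) \<and> f \<subseteq>\<^sub>m g \<and> (\<forall>v Q. v \<in> U \<longrightarrow> g v = Some Q \<longrightarrow> Q \<in> X v) \<and> linked nb R g"
      using g(4) by blast
  qed
  ultimately show ?case by blast
qed

text \<open>Union bound over the families: at most 81 to the power 2 ^ n of them, each of
  probability at most \<epsilon> to the power 2 ^ n. With 324 = 4 * 81 the base of the product is at
  most 1 / 4.\<close>

lemma prob_not_good_le:
  fixes P :: "'x pmf" and K :: "'x \<Rightarrow> (nat \<times> nat) set"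
  assumes F: "\<And>F. F \<subseteq> block n v \<Longrightarrow> measure_pmf.prob P {X. F \<subseteq> K X} \<le> \<epsilon> ^ card F"
    and \<epsilon>: "0 \<le> \<epsilon>" "324 * \<epsilon> \<le> 1"
  shows "measure_pmf.prob P {X. \<not> good (K X) n v} \<le> (1/2) ^ Suc n"
proof -
  note bf = bad_families_props[of n v]
  have "measure_pmf.prob P {X. \<not> good (K X) n v} \<le> measure_pmf.prob P (\<Union>F\<in>bad_families n v. {X. F \<subseteq> K X})"
  proof (rule measure_pmf.finite_measure_mono)
    show "{X. \<not> good (K X) n v} \<subseteq> (\<Union>F\<in>bad_families n v. {X. F \<subseteq> K X})"
      using not_good_bad_families[of _ n v] by blast
  qed simp
  also have "\<dots> \<le> (\<Sum>F\<in>bad_families n v. measure_pmf.prob P {X. F \<subseteq> K X})"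
    using conjunct1[OF bf] by (intro measure_pmf.finite_measure_subadditive_finite) auto
  also have "\<dots> \<le> (\<Sum>F\<in>bad_families n v. \<epsilon> ^ (2 ^ n))"
  proof (rule sum_mono)
    fix G assume "G \<in> bad_families n v"
    then have "G \<subseteq> block n v" "card G = 2 ^ n" using bf by blast+
    then show "measure_pmf.prob P {X. G \<subseteq> K X} \<le> \<epsilon> ^ 2 ^ n" using F[of G] by simp
  qed
  also have "\<dots> = card (bad_families n v) * \<epsilon> ^ (2 ^ n)" by simp
  also have "\<dots> \<le> 81 ^ (2 ^ n) * \<epsilon> ^ (2 ^ n)"
  proof (rule mult_right_mono)
    have "card (bad_families n v) \<le> 81 ^ (2 ^ n - 1)" using bf by blast
    also have "\<dots> \<le> (81::nat) ^ (2 ^ n)" by (intro power_increasing) auto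
    finally have "real (card (bad_families n v)) \<le> real (81 ^ (2 ^ n))" by (rule of_nat_mono)
    then show "real (card (bad_families n v)) \<le> 81 ^ (2 ^ n)" by simp
  qed (use \<epsilon> in simp)
  also have "\<dots> = (81 * \<epsilon>) ^ (2 ^ n)" by (simp add: power_mult_distrib)
  also have "\<dots> \<le> (1/4) ^ (2 ^ n)" using \<epsilon> by (intro power_mono) auto
  also have "\<dots> = (1/2) ^ (2 * 2 ^ n)" by (simp add: power_mult power2_eq_square)
  also have "\<dots> \<le> (1/2) ^ Suc n"
  proof (rule power_decreasing)
    have "Suc n \<le> 2 ^ Suc n" using less_exp[of "Suc n"] by simp
    then show "Suc n \<le> 2 * 2 ^ n" by simp
  qed auto
  finally show ?thesis .
qed

section \<open>From finite windows to an infinite cluster\<close>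

lemma sum_half_powers_le: "(\<Sum>j=m..n. (1/2::real) ^ Suc j) \<le> (1/2) ^ m"
proof (cases "m \<le> n")
  case True
  have "(\<Sum>j=m..n. (1/2::real) ^ Suc j) = (1/2) ^ m - (1/2) ^ Suc n"
    using True
  proof (induction n rule: dec_induct)
    case (step n)
    then show ?case by (subst sum.nat_ivl_Suc') auto
  qed simp
  then show ?thesis by simp
qed auto

text \<open>Connection inside \<open>S\<close> along \<open>a\<close> in either direction. The
  closure is reflexive also outside \<open>S\<close>, so membership of the end points is stated
  separately in its uses.\<close>

definition joined :: "('c \<Rightarrow> 'c \<Rightarrow> bool) \<Rightarrow> 'c set \<Rightarrow> 'c \<Rightarrow> 'c \<Rightarrow> bool" where
  "joined a S = equivclp (\<lambda>Q Q'. Q \<in> S \<and> Q' \<in> S \<and> a Q Q')"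

lemma joined_mono: "S \<subseteq> T \<Longrightarrow> joined a S Q Q' \<Longrightarrow> joined a T Q Q'"
proof -
  assume "S \<subseteq> T" "joined a S Q Q'"
  from this(2) show ?thesis unfolding joined_def
  proof (induction rule: equivclp_induct)
    case (step y z)
    then show ?case using \<open>S \<subseteq> T\<close> by (auto intro: equivclp_into_equivclp)
  qed simp
qed

definition far_joined :: "(nat \<times> nat \<Rightarrow> 'c set) \<Rightarrow> ('c \<Rightarrow> 'c \<Rightarrow> bool) \<Rightarrow> nat \<Rightarrow> nat \<Rightarrow> (nat \<times> nat \<Rightarrow> 'c set) \<Rightarrow> bool" where
  "far_joined B a m n X \<longleftrightarrow> (\<exists>x\<in>block m (0, 0). \<exists>y\<in>block n (0, 0). n \<le> fst y \<and>
     (\<exists>Q\<in>X x. \<exists>Q'\<in>X y. joined a (\<Union>v\<in>block n (0, 0). X v) Q Q'))"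

declare split_paired_All [simp del] split_paired_Ex [simp del]

text \<open>The block at the origin is bad at level \<open>j\<close> with probability at most (1/2)
  ^ (j + 1). These bounds sum to (1/2) ^ m over the levels from \<open>m\<close> to
  \<open>n\<close>, uniformly in \<open>n\<close>; when all these levels are good,
  \<open>good_path\<close> applies.\<close>

lemma prob_far_joined_ge:
  fixes p :: "nat \<times> nat \<Rightarrow> 'c set pmf" and a :: "'c \<Rightarrow> 'c \<Rightarrow> bool"
  assumes B: "\<And>v X. X \<in> set_pmf (p v) \<Longrightarrow> X \<subseteq> B v"
    and H: "\<And>v w Q. nbr v w \<Longrightarrow> Q \<in> B v \<Longrightarrow> measure_pmf.prob (p w) {X. X \<inter> {Q'. a Q Q'} = {}} \<le> \<epsilon>"
    and H0: "\<And>w. measure_pmf.prob (p w) {X. X = {}} \<le> \<epsilon>"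
    and \<epsilon>: "0 \<le> \<epsilon>" "324 * \<epsilon> \<le> 1" and mn: "m < n"
  shows "1 - (1/2) ^ m \<le> measure_pmf.prob (Pi_pmf (block n (0, 0)) {} p) {X. far_joined B a m n X}"
proof -
  let ?\<Lambda> = "block n (0, 0)"
  let ?P = "Pi_pmf ?\<Lambda> {} p"
  have "\<exists>K. (\<forall>X. K X \<subseteq> ?\<Lambda>) \<and> explores nbr a p ?\<Lambda> Map.empty K \<and>
      (\<forall>F. F \<subseteq> ?\<Lambda> \<longrightarrow> measure_pmf.prob (Pi_pmf ?\<Lambda> {} p) {X. F \<subseteq> K X} \<le> \<epsilon> ^ card F)"
  proof (rule exploration[where B = B])
    show "nbr v w \<Longrightarrow> nbr w v" for v w by (simp add: nbr_sym)
    show "\<not> nbr v v" for v by (simp add: nbr_def)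
  qed (use B H H0 \<epsilon> finite_block in auto)
  then obtain K where K: "\<And>X. K X \<subseteq> ?\<Lambda>" "explores nbr a p ?\<Lambda> Map.empty K"
    "\<And>F. F \<subseteq> ?\<Lambda> \<Longrightarrow> measure_pmf.prob ?P {X. F \<subseteq> K X} \<le> \<epsilon> ^ card F" by blast
  \<comment> \<open>Sites outside the window count as failed, so every site outside
    \<open>K' X\<close> carries a selected cell. Inside the window nothing changes, and the families
    at stake lie there.\<close>
  define K' where "K' X = K X \<union> - ?\<Lambda>" for X
  have bad: "measure_pmf.prob ?P {X. \<not> good (K' X) j (0, 0)} \<le> (1/2) ^ Suc j" if j: "j \<le> n" for j
  proof (rule prob_not_good_le[OF _ \<epsilon>])
    fix F assume "F \<subseteq> block j (0, 0)"
    then have F: "F \<subseteq> ?\<Lambda>" using block_mono0[OF j] by blast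
    then have "{X. F \<subseteq> K' X} = {X. F \<subseteq> K X}" by (auto simp: K'_def)
    then show "measure_pmf.prob ?P {X. F \<subseteq> K' X} \<le> \<epsilon> ^ card F" using K(3)[OF F] by simp
  qed
  have path: "far_joined B a m n X" if X: "X \<in> set_pmf ?P" and g: "\<And>j. j \<in> {m..n} \<Longrightarrow> good (K' X) j (0, 0)" for X
  proof -
    define Occ where "Occ = (\<Union>v\<in>?\<Lambda>. X v)"
    define R where "R = joined a Occ"
    have Xp: "X v \<in> set_pmf (p v)" if "v \<in> ?\<Lambda>" for v
    proof -
      have "X \<in> PiE_dflt ?\<Lambda> {} (set_pmf \<circ> p)" by (rule subsetD[OF set_Pi_pmf_subset'[OF finite_block] X])
      then show ?thesis using that by (cases v) (simp add: PiE_dflt_def)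
    qed
    have eR: "equivp R" unfolding R_def joined_def by (rule equivp_evquivclp)
    have aR: "\<forall>Q\<in>Occ. \<forall>Q'\<in>Occ. a Q Q' \<longrightarrow> R Q Q'" unfolding R_def joined_def by (auto intro: r_into_equivclp)
    obtain g where g1: "dom g = ?\<Lambda> - K X" and g2: "\<And>v Q. v \<in> ?\<Lambda> \<Longrightarrow> g v = Some Q \<Longrightarrow> Q \<in> X v" and g3: "linked nbr R g"
    proof -
      have 1: "X v \<in> set_pmf (p v) \<and> X v \<subseteq> Occ" if "v \<in> ?\<Lambda>" for v using Xp[OF that] that by (auto simp: Occ_def)
      have 2: "linked nbr R Map.empty" "active_linked nbr R ?\<Lambda> Map.empty"
        by (simp_all add: linked_def active_linked_def)
      have "\<exists>g. dom g = dom Map.empty \<union> (?\<Lambda> - K X) \<and> Map.empty \<subseteq>\<^sub>m g \<and>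
          (\<forall>v Q. v \<in> ?\<Lambda> \<longrightarrow> g v = Some Q \<longrightarrow> Q \<in> X v) \<and> linked nbr R g"
        using K(2)[unfolded explores_def, THEN spec[of _ X], THEN spec[of _ Occ], THEN spec[of _ R]] 1 2 eR aR by simp
      then show thesis using that by auto
    qed
    \<comment> \<open>Sites are related through their selected cells. Reflexivity requires such a
      cell, which is why \<open>good_path\<close> asks for it outside the failed set only.\<close>
    define R' where "R' x y \<longleftrightarrow> (\<exists>Q Q'. g x = Some Q \<and> g y = Some Q' \<and> R Q Q')" for x y
    have gK: "\<exists>Q. g x = Some Q" if "x \<notin> K' X" for x
    proof -
      have "x \<in> dom g" using that g1 by (auto simp: K'_def)
      then show ?thesis by auto
    qed
    have "\<exists>x\<in>block m (0, 0). \<exists>y\<in>block n (0, 0). n \<le> fst y \<and> x \<notin> K' X \<and> y \<notin> K' X \<and> R' x y"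
    proof (rule good_path[of "K' X" R' m n])
      show "R' x x" if "x \<notin> K' X" for x using gK[OF that] equivp_reflp[OF eR] by (auto simp: R'_def)
      show "R' y x" if "R' x y" for x y using that equivp_symp[OF eR] by (auto simp: R'_def)
      show "R' x z" if "R' x y" "R' y z" for x y z using that equivp_transp[OF eR] by (auto simp: R'_def)
      show "R' x y" if "x \<notin> K' X" "y \<notin> K' X" "nbr x y" for x y
        using gK[OF that(1)] gK[OF that(2)] g3 that(3) unfolding linked_def R'_def by blast
    qed (use g mn in auto)
    then obtain x y where xy: "x \<in> block m (0, 0)" "y \<in> block n (0, 0)" "n \<le> fst y" "R' x y" by blast
    obtain Q Q' where Q: "g x = Some Q" "g y = Some Q'" "R Q Q'" using xy(4) unfolding R'_def by blast
    have "x \<in> ?\<Lambda>" using xy(1) block_mono0[of m n] mn by auto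
    then have "Q \<in> X x" "Q' \<in> X y" using Q g2 xy(2) by auto
    then show ?thesis using xy Q(3) unfolding far_joined_def R_def Occ_def by blast
  qed
  have "measure_pmf.prob ?P {X. \<not> far_joined B a m n X} \<le> measure_pmf.prob ?P (\<Union>j\<in>{m..n}. {X. \<not> good (K' X) j (0, 0)})"
  proof (intro measure_pmf.finite_measure_mono_AE AE_pmfI impI)
    fix y assume y: "y \<in> set_pmf ?P" "y \<in> {X. \<not> far_joined B a m n X}"
    then show "y \<in> (\<Union>j\<in>{m..n}. {X. \<not> good (K' X) j (0, 0)})" using path[OF y(1)] by blast
  qed auto
  also have "\<dots> \<le> (\<Sum>j=m..n. measure_pmf.prob ?P {X. \<not> good (K' X) j (0, 0)})"
    by (intro measure_pmf.finite_measure_subadditive_finite) auto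
  also have "\<dots> \<le> (\<Sum>j=m..n. (1/2) ^ Suc j)" by (intro sum_mono bad) auto
  also have "\<dots> \<le> (1/2) ^ m" by (rule sum_half_powers_le)
  finally have "measure_pmf.prob ?P {X. \<not> far_joined B a m n X} \<le> (1/2) ^ m" .
  moreover have "measure_pmf.prob ?P {X. \<not> far_joined B a m n X} = 1 - measure_pmf.prob ?P {X. far_joined B a m n X}"
    using measure_pmf.prob_compl[of "{X. far_joined B a m n X}" ?P] by (simp add: Compl_eq_Diff_UNIV[symmetric] Collect_neg_eq)
  ultimately show ?thesis by simp
qed

text \<open>\<open>occ\<close> is the random set of occupied cells. For \<open>m\<close> fixed the events that block \<open>m (0, 0)\<close> is
  joined to distance \<open>n\<close> have probability close to one uniformly in \<open>n\<close>, so their limit superior does.\<close>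

lemma (in prob_space) AE_infinite_cluster:
  fixes occ :: "'a \<Rightarrow> 'c set" and B :: "nat \<times> nat \<Rightarrow> 'c set"
  assumes fB: "\<And>v. finite (B v)"
    and meas: "\<And>Q. {\<omega>\<in>space M. Q \<in> occ \<omega>} \<in> events"
    and indep: "\<And>V Y. finite V \<Longrightarrow> prob {\<omega>\<in>space M. \<forall>v\<in>V. occ \<omega> \<inter> B v = Y v} = (\<Prod>v\<in>V. prob {\<omega>\<in>space M. occ \<omega> \<inter> B v = Y v})"
    and H: "\<And>v w Q. nbr v w \<Longrightarrow> Q \<in> B v \<Longrightarrow> prob {\<omega>\<in>space M. occ \<omega> \<inter> B w \<inter> {Q'. a Q Q'} = {}} \<le> \<epsilon>"
    and H0: "\<And>w. prob {\<omega>\<in>space M. occ \<omega> \<inter> B w = {}} \<le> \<epsilon>"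
    and \<epsilon>: "0 \<le> \<epsilon>" "324 * \<epsilon> \<le> 1"
  shows "AE \<omega> in M. \<exists>Q\<in>occ \<omega>. \<forall>k. \<exists>v Q'. k \<le> fst v \<and> Q' \<in> occ \<omega> \<inter> B v \<and> joined a (occ \<omega>) Q Q'"
proof -
  have evS: "{\<omega>\<in>space M. occ \<omega> \<inter> C = Y} \<in> events" if "finite C" for C Y
  proof (cases "Y \<subseteq> C")
    case True
    have "{\<omega>\<in>space M. \<forall>Q\<in>C. (Q \<in> occ \<omega>) = (Q \<in> Y)} \<in> events"
    proof (rule sets.sets_Collect_finite_All[OF _ that])
      fix Q show "{\<omega>\<in>space M. (Q \<in> occ \<omega>) = (Q \<in> Y)} \<in> events"
        using meas[of Q] sets.sets_Collect_neg[OF meas[of Q]] by (cases "Q \<in> Y") auto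
    qed
    moreover have "{\<omega>\<in>space M. \<forall>Q\<in>C. (Q \<in> occ \<omega>) = (Q \<in> Y)} = {\<omega>\<in>space M. occ \<omega> \<inter> C = Y}"
      using True by blast
    ultimately show ?thesis by simp
  next
    case False
    then have e: "{\<omega>\<in>space M. occ \<omega> \<inter> C = Y} = {}" by blast
    show ?thesis unfolding e by simp
  qed
  define f where "f v Y = prob {\<omega>\<in>space M. occ \<omega> \<inter> B v = Y}" for v Y
  \<comment> \<open>The trace of \<open>occ\<close> on a finite block takes finitely many values, so
    its law is a \<open>pmf\<close> and the exploration of finite products applies to it.\<close>
  define p where "p v = embed_pmf (f v)" for v
  have sumf: "(\<Sum>Y\<in>\<Y>. f v Y) = prob {\<omega>\<in>space M. occ \<omega> \<inter> B v \<in> \<Y>}" if "finite \<Y>" for v \<Y>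
  proof -
    have "{\<omega>\<in>space M. occ \<omega> \<inter> B v \<in> \<Y>} = (\<Union>Y\<in>\<Y>. {\<omega>\<in>space M. occ \<omega> \<inter> B v = Y})" by auto
    then show ?thesis unfolding f_def using that evS[OF fB[of v]]
      by (simp only:) (intro finite_measure_finite_Union[symmetric], auto simp: disjoint_family_on_def)
  qed
  have f0: "f v Y = 0" if "\<not> Y \<subseteq> B v" for v Y
  proof -
    have e: "{\<omega>\<in>space M. occ \<omega> \<inter> B v = Y} = {}" using that by blast
    show ?thesis unfolding f_def e by simp
  qed
  have pmf_p: "pmf (p v) Y = f v Y" for v Y
    unfolding p_def
  proof (rule pmf_embed_pmf)
    have "(\<integral>\<^sup>+Y. ennreal (f v Y) \<partial>count_space UNIV) = (\<integral>\<^sup>+Y. ennreal (f v Y) \<partial>count_space (Pow (B v)))"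
      using f0 by (intro nn_integral_count_space_eq) auto
    also have "\<dots> = ennreal (\<Sum>Y\<in>Pow (B v). f v Y)"
      using fB by (simp add: nn_integral_count_space_finite f_def)
    also have "(\<Sum>Y\<in>Pow (B v). f v Y) = 1" using fB by (subst sumf) (auto simp: prob_space)
    finally show "(\<integral>\<^sup>+Y. ennreal (f v Y) \<partial>count_space UNIV) = 1" by simp
  qed (simp add: f_def)
  have set_p: "X \<subseteq> B v" if "X \<in> set_pmf (p v)" for X v
  proof (rule ccontr)
    assume "\<not> X \<subseteq> B v"
    then have "f v X = 0" by (rule f0)
    then show False using that by (simp add: set_pmf_eq pmf_p)
  qed
  have prob_p: "measure_pmf.prob (p v) \<Y> = prob {\<omega>\<in>space M. occ \<omega> \<inter> B v \<in> \<Y>}" for v \<Y>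
  proof -
    have "measure_pmf.prob (p v) \<Y> = measure_pmf.prob (p v) (\<Y> \<inter> Pow (B v))"
      using set_p by (intro measure_pmf.finite_measure_eq_AE AE_pmfI) auto
    also have "\<dots> = (\<Sum>Y\<in>\<Y> \<inter> Pow (B v). f v Y)"
      using fB by (subst measure_measure_pmf_finite) (auto simp: pmf_p)
    also have "\<dots> = prob {\<omega>\<in>space M. occ \<omega> \<inter> B v \<in> \<Y>}"
      using fB by (subst sumf) (auto intro!: arg_cong[where f = prob])
    finally show ?thesis .
  qed
  define X where "X n \<omega> v = (if v \<in> block n (0, 0) then occ \<omega> \<inter> B v else {})" for n \<omega> v
  \<comment> \<open>By \<open>indep\<close> the traces in a finite window have the product law;
    every set of values gives an event because only finitely many values occur.\<close>
  have law: "{\<omega>\<in>space M. X n \<omega> \<in> \<Y>} \<in> events \<and>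
      prob {\<omega>\<in>space M. X n \<omega> \<in> \<Y>} = measure_pmf.prob (Pi_pmf (block n (0, 0)) {} p) \<Y>" for n \<Y>
  proof -
    let ?\<Lambda> = "block n (0, 0)"
    let ?\<Phi> = "PiE_dflt ?\<Lambda> {} (\<lambda>v. Pow (B v))"
    have fin: "finite ?\<Phi>" using finite_block fB by (intro finite_PiE_dflt) auto
    have XP: "X n \<omega> \<in> ?\<Phi>" for \<omega> by (auto simp: PiE_dflt_def X_def)
    have eq: "{\<omega>\<in>space M. X n \<omega> = Y} = {\<omega>\<in>space M. \<forall>v\<in>?\<Lambda>. occ \<omega> \<inter> B v = Y v}" if "Y \<in> ?\<Phi>" for Y
      using that unfolding X_def PiE_dflt_def fun_eq_iff by (intro Collect_cong) auto
    have ev: "{\<omega>\<in>space M. X n \<omega> = Y} \<in> events" if "Y \<in> ?\<Phi>" for Y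
      unfolding eq[OF that] by (intro sets.sets_Collect_finite_All evS fB finite_block)
    have pr: "prob {\<omega>\<in>space M. X n \<omega> = Y} = pmf (Pi_pmf ?\<Lambda> {} p) Y" if "Y \<in> ?\<Phi>" for Y
    proof -
      have "prob {\<omega>\<in>space M. X n \<omega> = Y} = (\<Prod>v\<in>?\<Lambda>. f v (Y v))"
        unfolding eq[OF that] f_def by (rule indep[OF finite_block])
      also have "\<dots> = pmf (Pi_pmf ?\<Lambda> {} p) Y"
        using that by (subst pmf_Pi') (auto simp: finite_block pmf_p PiE_dflt_def)
      finally show ?thesis .
    qed
    have un: "{\<omega>\<in>space M. X n \<omega> \<in> \<Y>} = (\<Union>Y\<in>\<Y> \<inter> ?\<Phi>. {\<omega>\<in>space M. X n \<omega> = Y})" using XP by auto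
    have "measure_pmf.prob (Pi_pmf ?\<Lambda> {} p) \<Y> = measure_pmf.prob (Pi_pmf ?\<Lambda> {} p) (\<Y> \<inter> ?\<Phi>)"
    proof (intro measure_pmf.finite_measure_eq_AE AE_pmfI)
      fix x assume "x \<in> set_pmf (Pi_pmf ?\<Lambda> {} p)"
      then have "x \<in> PiE_dflt ?\<Lambda> {} (set_pmf \<circ> p)" by (rule subsetD[OF set_Pi_pmf_subset'[OF finite_block]])
      then have "x \<in> ?\<Phi>" using set_p by (auto simp: PiE_dflt_def)
      then show "(x \<in> \<Y>) = (x \<in> \<Y> \<inter> ?\<Phi>)" by simp
    qed auto
    also have "\<dots> = (\<Sum>Y\<in>\<Y> \<inter> ?\<Phi>. pmf (Pi_pmf ?\<Lambda> {} p) Y)"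
      using fin by (subst measure_measure_pmf_finite) auto
    also have "\<dots> = (\<Sum>Y\<in>\<Y> \<inter> ?\<Phi>. prob {\<omega>\<in>space M. X n \<omega> = Y})" using pr by (intro sum.cong) auto
    also have "\<dots> = prob (\<Union>Y\<in>\<Y> \<inter> ?\<Phi>. {\<omega>\<in>space M. X n \<omega> = Y})"
      using fin ev by (intro finite_measure_finite_Union[symmetric]) (auto simp: disjoint_family_on_def)
    finally have "prob {\<omega>\<in>space M. X n \<omega> \<in> \<Y>} = measure_pmf.prob (Pi_pmf ?\<Lambda> {} p) \<Y>" unfolding un by simp
    moreover have "{\<omega>\<in>space M. X n \<omega> \<in> \<Y>} \<in> events" unfolding un using fin ev by (intro sets.finite_UN) auto
    ultimately show ?thesis by blast
  qed
  define E where "E m n = {\<omega>\<in>space M. far_joined B a m n (X n \<omega>)}" for m n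
  have Eev: "E m n \<in> events" for m n unfolding E_def using law[of n "{X. far_joined B a m n X}"] by simp
  have EP: "1 - (1/2) ^ m \<le> prob (E m n)" if "m < n" for m n
  proof -
    have "1 - (1/2) ^ m \<le> measure_pmf.prob (Pi_pmf (block n (0, 0)) {} p) {X. far_joined B a m n X}"
    proof (rule prob_far_joined_ge[OF set_p _ _ \<epsilon> that])
      show "measure_pmf.prob (p w) {X. X \<inter> {Q'. a Q Q'} = {}} \<le> \<epsilon>" if "nbr v w" "Q \<in> B v" for v w Q
        unfolding prob_p using H[OF that] by simp
      show "measure_pmf.prob (p w) {X. X = {}} \<le> \<epsilon>" for w
        unfolding prob_p using H0[of w] by simp
    qed
    then show ?thesis unfolding E_def using law[of n "{X. far_joined B a m n X}"] by simp
  qed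
  define L where "L m = (\<Inter>k. \<Union>n\<in>{k..}. E m n)" for m
  have Lev: "L m \<in> events" for m unfolding L_def using Eev by (intro sets.countable_INT' sets.countable_UN') auto
  have LP: "1 - (1/2) ^ m \<le> prob (L m)" for m
  proof -
    have "(\<lambda>k. prob (\<Union>n\<in>{k..}. E m n)) \<longlonglongrightarrow> prob (\<Inter>k. \<Union>n\<in>{k..}. E m n)"
    proof (rule finite_Lim_measure_decseq)
      show "range (\<lambda>k. \<Union>n\<in>{k..}. E m n) \<subseteq> events" using Eev by auto
      show "decseq (\<lambda>k. \<Union>n\<in>{k..}. E m n)" by (intro decseq_SucI UN_mono) auto
    qed
    moreover have "\<forall>k\<ge>Suc m. 1 - (1/2) ^ m \<le> prob (\<Union>n\<in>{k..}. E m n)"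
    proof (intro allI impI)
      fix k assume k: "Suc m \<le> k"
      then have "1 - (1/2) ^ m \<le> prob (E m k)" by (intro EP) simp
      also have "\<dots> \<le> prob (\<Union>n\<in>{k..}. E m n)" using Eev by (intro finite_measure_mono) auto
      finally show "1 - (1/2) ^ m \<le> prob (\<Union>n\<in>{k..}. E m n)" .
    qed
    ultimately show ?thesis unfolding L_def by (intro LIMSEQ_le_const) auto
  qed
  have "prob (\<Union>m. L m) = 1"
  proof (rule antisym)
    have "1 - (1/2) ^ m \<le> prob (\<Union>m. L m)" for m
    proof -
      have "prob (L m) \<le> prob (\<Union>m. L m)" using Lev by (intro finite_measure_mono) auto
      then show ?thesis using LP[of m] by linarith
    qed
    moreover have "(\<lambda>m. 1 - (1/2::real) ^ m) \<longlonglongrightarrow> 1 - 0" by (intro tendsto_intros) auto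
    ultimately show "1 \<le> prob (\<Union>m. L m)" using LIMSEQ_le_const2[of "\<lambda>m. 1 - (1/2::real) ^ m" 1] by auto
  qed simp
  then have "AE \<omega> in M. \<omega> \<in> (\<Union>m. L m)" using Lev by (subst (asm) prob_eq_1) auto
  then show ?thesis
  proof eventually_elim
    case (elim \<omega>)
    then obtain m0 where m0: "\<omega> \<in> L m0" by blast
    have m: "\<exists>n\<ge>k. \<omega> \<in> E m0 n" for k
    proof -
      have "\<omega> \<in> (\<Union>n\<in>{k..}. E m0 n)" using m0 unfolding L_def by blast
      then show ?thesis by auto
    qed
    define C where "C = (\<Union>x\<in>block m0 (0, 0). B x)"
    have finC: "finite C" using finite_block fB by (auto simp: C_def)
    have "\<forall>k. \<exists>Q\<in>C. Q \<in> occ \<omega> \<and> (\<exists>v Q'. k \<le> fst v \<and> Q' \<in> occ \<omega> \<inter> B v \<and> joined a (occ \<omega>) Q Q')"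
    proof
      fix k
      obtain n where n: "k \<le> n" "\<omega> \<in> E m0 n" using m by blast
      then obtain x y Q Q' where xy: "x \<in> block m0 (0, 0)" "n \<le> fst y" "Q \<in> X n \<omega> x" "Q' \<in> X n \<omega> y"
          "joined a (\<Union>v\<in>block n (0, 0). X n \<omega> v) Q Q'"
        unfolding E_def far_joined_def by blast
      have "Q \<in> occ \<omega> \<inter> B x" "Q' \<in> occ \<omega> \<inter> B y" using xy by (auto simp: X_def split: if_splits)
      moreover have "joined a (occ \<omega>) Q Q'"
        by (rule joined_mono[OF _ xy(5)]) (auto simp: X_def)
      moreover have "Q \<in> C" using calculation xy(1) by (auto simp: C_def)
      ultimately show "\<exists>Q\<in>C. Q \<in> occ \<omega> \<and> (\<exists>v Q'. k \<le> fst v \<and> Q' \<in> occ \<omega> \<inter> B v \<and> joined a (occ \<omega>) Q Q')"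
        using n xy(2) order_trans by blast
    qed
    then obtain q where q: "\<And>k. q k \<in> C" "\<And>k. q k \<in> occ \<omega>"
      "\<And>k. \<exists>v Q'. k \<le> fst v \<and> Q' \<in> occ \<omega> \<inter> B v \<and> joined a (occ \<omega>) (q k) Q'" by metis
    \<comment> \<open>Pigeonhole: the starting cells stay in the finite set \<open>C\<close> while
      the distance grows, so one of them serves infinitely many, hence all, values of
      \<open>k\<close>.\<close>
    have "\<exists>Q\<in>C. infinite {k. q k = Q}"
    proof (rule ccontr)
      assume "\<not> ?thesis"
      then have "finite (\<Union>Q\<in>C. {k. q k = Q})" using finC by auto
      moreover have "(\<Union>Q\<in>C. {k. q k = Q}) = UNIV" using q(1) by auto
      ultimately show False by simp
    qed
    then obtain Q where Q: "infinite {k. q k = Q}" by blast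
    have "\<exists>v Q'. k \<le> fst v \<and> Q' \<in> occ \<omega> \<inter> B v \<and> joined a (occ \<omega>) Q Q'" for k
    proof -
      obtain k' where "k < k'" "q k' = Q" using Q by (auto simp: infinite_nat_iff_unbounded)
      then show ?thesis using q(3)[of k'] by (metis less_imp_le order_trans)
    qed
    moreover have "Q \<in> occ \<omega>" using Q q(2) by (metis (mono_tags, lifting) finite.emptyI empty_Collect_eq)
    ultimately show ?case by blast
  qed
qed

declare split_paired_All [simp] split_paired_Ex [simp]

section \<open>Cells\<close>

text \<open>Balls of radius \<open>h\<close> around the centres \<open>d i\<close>, made disjoint by
  giving priority to the smaller index.\<close>

definition cell :: "(nat \<Rightarrow> 'a::metric_space) \<Rightarrow> real \<Rightarrow> 'a set \<Rightarrow> nat \<Rightarrow> 'a set" where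
  "cell d h S i = {z \<in> S. dist z (d i) < h \<and> (\<forall>j<i. h \<le> dist z (d j))}"

lemma disjoint_cell: "disjoint_family (cell d h S)"
proof -
  have "cell d h S i \<inter> cell d h S j = {}" if "i < j" for i j using that by (auto simp: cell_def)
  then show ?thesis unfolding disjoint_family_on_def by (metis Int_commute linorder_neq_iff)
qed

lemma cell_cover:
  assumes "z \<in> S" "dist z (d i) < h"
  shows "\<exists>j\<le>i. z \<in> cell d h S j"
proof -
  define l where "l = (LEAST j. dist z (d j) < h)"
  have "dist z (d l) < h" "l \<le> i" using assms(2) unfolding l_def by (auto intro: LeastI Least_le)
  moreover have "h \<le> dist z (d j)" if "j < l" for j using not_less_Least[of j] that unfolding l_def by (meson not_le)
  ultimately show ?thesis using assms(1) by (auto simp: cell_def)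
qed

lemma cell_diameter: "z \<in> cell d h S i \<Longrightarrow> z' \<in> cell d h S i \<Longrightarrow> dist z z' < 2 * h"
  using dist_triangle2[of z z' "d i"] by (auto simp: cell_def)

lemma cell_eq_Int_open: "cell d h S i = S \<inter> (ball (d i) h - (\<Union>j<i. ball (d j) h))"
  by (auto simp: cell_def dist_commute not_less)

lemma cell_in_sets:
  assumes "S \<in> sets M" "\<And>G. open G \<Longrightarrow> G \<inter> space M \<in> sets M"
  shows "cell d h S i \<in> sets M"
proof -
  have "cell d h S i = S \<inter> ((ball (d i) h \<inter> space M) - (\<Union>j<i. ball (d j) h \<inter> space M))"
    using sets.sets_into_space[OF assms(1)] unfolding cell_eq_Int_open by blast
  also have "\<dots> \<in> sets M" by (intro sets.Int sets.Diff sets.finite_UN assms) auto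
  finally show ?thesis .
qed

section \<open>Consequences of the defining properties of a Poisson process\<close>

locale ppp =
  fixes P :: "'b set measure" and \<mu> :: "'b measure"
  assumes ppp: "poisson_point_process P \<mu> (\<lambda>\<omega>. \<omega>)"
begin

sublocale prob_space P using ppp by (simp add: poisson_point_process_def)

lemma points_subset: "\<omega> \<in> space P \<Longrightarrow> \<omega> \<subseteq> space \<mu>"
  using ppp by (simp add: poisson_point_process_def)

lemma num_points_eq_0: "num_points \<omega> A = 0 \<longleftrightarrow> \<omega> \<inter> A = {}"
  by (simp add: num_points_def emeasure_count_space_eq_0)

lemma num_points_measurable [measurable]: "A \<in> sets \<mu> \<Longrightarrow> (\<lambda>\<omega>. num_points \<omega> A) \<in> borel_measurable P"
  using ppp by (simp add: poisson_point_process_def)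

lemma empty_event: "A \<in> sets \<mu> \<Longrightarrow> {\<omega>\<in>space P. \<omega> \<inter> A = {}} \<in> events"
proof -
  assume "A \<in> sets \<mu>"
  then have "(\<lambda>\<omega>. num_points \<omega> A) -` {0} \<inter> space P \<in> events" by (intro measurable_sets[OF num_points_measurable]) auto
  moreover have "(\<lambda>\<omega>. num_points \<omega> A) -` {0} \<inter> space P = {\<omega>\<in>space P. \<omega> \<inter> A = {}}"
    by (auto simp: num_points_eq_0)
  ultimately show ?thesis by simp
qed

lemma prob_empty:
  assumes "A \<in> sets \<mu>" "emeasure \<mu> A < \<infinity>"
  shows "prob {\<omega>\<in>space P. \<omega> \<inter> A = {}} = exp (- measure \<mu> A)"
proof -
  have "prob {\<omega>\<in>space P. num_points \<omega> A = of_nat 0} = exp (- measure \<mu> A) * measure \<mu> A ^ 0 / fact 0"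
    using ppp assms unfolding poisson_point_process_def by blast
  then show ?thesis by (simp add: num_points_eq_0)
qed

lemma prob_nonempty_le:
  assumes "A \<in> sets \<mu>" "emeasure \<mu> A < \<infinity>"
  shows "prob {\<omega>\<in>space P. \<omega> \<inter> A \<noteq> {}} \<le> measure \<mu> A"
proof -
  have "prob {\<omega>\<in>space P. \<omega> \<inter> A \<noteq> {}} = 1 - exp (- measure \<mu> A)"
    using prob_neg[OF empty_event[OF assms(1)]] prob_empty[OF assms] by simp
  then show ?thesis using exp_ge_add_one_self[of "- measure \<mu> A"] by linarith
qed

text \<open>Counts over disjoint sets are independent by definition, for families indexed by an
  initial segment of the naturals; hence the enumeration \<open>f\<close>. The pattern
  \<open>e\<close> selects, for each set, the count 0 or its complement.\<close>

lemma indep_empty: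
  assumes I: "finite I" and A: "\<And>i. i \<in> I \<Longrightarrow> A i \<in> sets \<mu>" and disj: "disjoint_family_on A I"
  shows "prob {\<omega>\<in>space P. \<forall>i\<in>I. (\<omega> \<inter> A i = {}) = e i} = (\<Prod>i\<in>I. prob {\<omega>\<in>space P. (\<omega> \<inter> A i = {}) = e i})"
proof (cases "I = {}")
  case True then show ?thesis by (simp add: prob_space)
next
  case False
  define n where "n = card I"
  obtain f where f: "bij_betw f {..<n} I" unfolding n_def using I by (metis ex_bij_betw_nat_finite atLeast0LessThan)
  have n: "{..<n} \<noteq> {}" using f False by (auto simp: bij_betw_def)
  have fI: "f k \<in> I" if "k < n" for k using f that by (auto simp: bij_betw_def)
  have "disjoint_family_on (\<lambda>k. A (f k)) {..<n}"
    using disj f unfolding disjoint_family_on_def bij_betw_def inj_on_def by blast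
  then have ind: "indep_vars (\<lambda>_. borel) (\<lambda>k \<omega>. num_points \<omega> (A (f k))) {..<n}"
    using A fI by (intro ppp[unfolded poisson_point_process_def, THEN conjunct2, THEN conjunct2, THEN conjunct2,
      THEN conjunct2, THEN spec[of _ "\<lambda>k. A (f k)"], THEN spec[of _ n], THEN mp]) auto
  let ?S = "\<lambda>k. if e (f k) then {0} else - {0::ennreal}"
  have v: "(\<lambda>\<omega>. num_points \<omega> (A (f k))) -` ?S k \<inter> space P = {\<omega>\<in>space P. (\<omega> \<inter> A (f k) = {}) = e (f k)}" for k
    by (auto simp: num_points_eq_0)
  have "{\<omega>\<in>space P. \<forall>i\<in>I. (\<omega> \<inter> A i = {}) = e i} = (\<Inter>k\<in>{..<n}. (\<lambda>\<omega>. num_points \<omega> (A (f k))) -` ?S k \<inter> space P)"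
    unfolding v using f n by (auto simp: bij_betw_def)
  also have "prob \<dots> = (\<Prod>k\<in>{..<n}. prob ((\<lambda>\<omega>. num_points \<omega> (A (f k))) -` ?S k \<inter> space P))"
    by (rule indep_varsD[OF ind n]) auto
  also have "\<dots> = (\<Prod>k\<in>{..<n}. prob {\<omega>\<in>space P. (\<omega> \<inter> A (f k) = {}) = e (f k)})" unfolding v ..
  also have "\<dots> = (\<Prod>i\<in>I. prob {\<omega>\<in>space P. (\<omega> \<inter> A i = {}) = e i})" by (rule prod.reindex_bij_betw[OF f])
  finally show ?thesis .
qed

end

section \<open>Subcritical site percolation\<close>

text \<open>Walks with \<open>n\<close> steps from \<open>i\<close> as lists of n + 1 vertices,
  repetitions allowed. The bound \<open>N\<close> on the vertices after the start keeps the set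
  finite.\<close>

primrec paths :: "(nat \<Rightarrow> nat \<Rightarrow> bool) \<Rightarrow> nat \<Rightarrow> nat \<Rightarrow> nat \<Rightarrow> nat list set" where
  "paths r N 0 = (\<lambda>i. {[i]})"
| "paths r N (Suc n) = (\<lambda>i. \<Union>j\<in>{j. j < N \<and> r i j}. (#) i ` paths r N n j)"

lemma paths_hd: "l \<in> paths r N n i \<Longrightarrow> l \<noteq> [] \<and> hd l = i"
  by (cases n) auto

lemma finite_paths: "finite (paths r N n i)"
  by (induction n arbitrary: i) auto

lemma paths_mono: "N \<le> N' \<Longrightarrow> paths r N n i \<subseteq> paths r N' n i"
proof (induction n arbitrary: i)
  case (Suc n)
  then show ?case unfolding paths.simps by (intro UN_mono image_mono Suc.IH) auto
qed simp

text \<open>Every step multiplies the total weight by at most \<kappa>, the bound on the summed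
  weight of all neighbours of a vertex.\<close>

lemma paths_weight:
  assumes m: "\<And>i. 0 \<le> m i" and \<kappa>: "\<And>i. (\<Sum>j | j < N \<and> r i j. m j) \<le> \<kappa>" "0 \<le> \<kappa>"
  shows "(\<Sum>l\<in>paths r N n i. prod_list (map m l)) \<le> m i * (\<kappa> :: real) ^ n"
proof (induction n arbitrary: i)
  case (Suc n)
  have "(\<Sum>l\<in>paths r N (Suc n) i. prod_list (map m l)) \<le> (\<Sum>j | j < N \<and> r i j. \<Sum>l\<in>(#) i ` paths r N n j. prod_list (map m l))"
    unfolding paths.simps
  proof (rule order.eq_iff[THEN iffD1, THEN conjunct1], rule sum.UNION_disjoint)
    show "\<forall>j\<in>{j. j < N \<and> r i j}. finite ((#) i ` paths r N n j)" using finite_paths by blast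
    show "\<forall>j\<in>{j. j < N \<and> r i j}. \<forall>j'\<in>{j. j < N \<and> r i j}. j \<noteq> j' \<longrightarrow> (#) i ` paths r N n j \<inter> (#) i ` paths r N n j' = {}"
      by (auto dest!: paths_hd)
  qed simp
  also have "\<dots> = (\<Sum>j | j < N \<and> r i j. m i * (\<Sum>l\<in>paths r N n j. prod_list (map m l)))"
    by (intro sum.cong refl) (simp add: sum.reindex sum_distrib_left)
  also have "\<dots> \<le> (\<Sum>j | j < N \<and> r i j. m i * (m j * \<kappa> ^ n))"
    by (intro sum_mono mult_left_mono Suc m)
  also have "\<dots> = m i * \<kappa> ^ n * (\<Sum>j | j < N \<and> r i j. m j)"
    by (simp add: sum_distrib_left mult.commute mult.left_commute)
  also have "\<dots> \<le> m i * \<kappa> ^ n * \<kappa>" using m \<kappa> by (intro mult_left_mono) auto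
  finally show ?case by (simp add: mult.commute mult.left_commute)
qed simp

lemma mem_pathsI:
  "l \<noteq> [] \<Longrightarrow> length l = Suc n \<Longrightarrow> set l \<subseteq> {..<N} \<Longrightarrow> successively r l \<Longrightarrow> l \<in> paths r N n (hd l)"
proof (induction n arbitrary: l)
  case 0 then show ?case by (cases l) auto
next
  case (Suc n)
  then obtain i j l' where l: "l = i # j # l'" by (metis Suc_length_conv)
  then have "j # l' \<in> paths r N n (hd (j # l'))" using Suc.prems by (intro Suc.IH) auto
  then show ?case using Suc.prems l by auto
qed

text \<open>Distinctness of the vertices turns the probability that a path is occupied into a
  product; the sum over self-avoiding paths is then enlarged to all walks. The bound
  \<open>m i * \<kappa> ^ n\<close> is uniform in the truncation \<open>N\<close>, so it survives
  the increasing limit and forces the intersection over \<open>n\<close> to be null.\<close>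

lemma (in prob_space) AE_no_long_path:
  fixes occ :: "'a \<Rightarrow> nat set"
  assumes ev: "\<And>i. {\<omega>\<in>space M. i \<in> occ \<omega>} \<in> events"
    and indep: "\<And>I. finite I \<Longrightarrow> prob {\<omega>\<in>space M. \<forall>i\<in>I. i \<in> occ \<omega>} = (\<Prod>i\<in>I. prob {\<omega>\<in>space M. i \<in> occ \<omega>})"
    and m: "\<And>i. prob {\<omega>\<in>space M. i \<in> occ \<omega>} \<le> m i"
    and \<kappa>: "\<And>i N. (\<Sum>j | j < N \<and> r i j. m j) \<le> \<kappa>" "0 \<le> \<kappa>" "\<kappa> < 1"
  shows "AE \<omega> in M. \<forall>i. \<exists>n. \<not> (\<exists>l. length l = Suc n \<and> hd l = i \<and> distinct l \<and> successively r l \<and> set l \<subseteq> occ \<omega>)"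
proof -
  have m0: "0 \<le> m i" for i using m[of i] measure_nonneg order_trans by blast
  define E where "E n i N = {\<omega>\<in>space M. \<exists>l\<in>{l\<in>paths r N n i. distinct l}. \<forall>x\<in>set l. x \<in> occ \<omega>}" for n i N
  have evl: "{\<omega>\<in>space M. \<forall>x\<in>set l. x \<in> occ \<omega>} \<in> events" for l
    by (intro sets.sets_Collect_finite_All ev) simp
  have EU: "E n i N = (\<Union>l\<in>{l\<in>paths r N n i. distinct l}. {\<omega>\<in>space M. \<forall>x\<in>set l. x \<in> occ \<omega>})" for n i N
    by (auto simp: E_def)
  have finp: "finite {l\<in>paths r N n i. distinct l}" for N n i using finite_paths by simp
  have Eev: "E n i N \<in> events" for n i N unfolding EU using evl finp by (intro sets.finite_UN) auto
  have Ele: "prob (E n i N) \<le> m i * \<kappa> ^ n" for n i N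
  proof -
    have "prob (E n i N) \<le> (\<Sum>l\<in>{l\<in>paths r N n i. distinct l}. prob {\<omega>\<in>space M. \<forall>x\<in>set l. x \<in> occ \<omega>})"
      unfolding EU using evl finp by (intro finite_measure_subadditive_finite) auto
    also have "\<dots> \<le> (\<Sum>l\<in>{l\<in>paths r N n i. distinct l}. prod_list (map m l))"
    proof (rule sum_mono)
      fix l assume l: "l \<in> {l\<in>paths r N n i. distinct l}"
      have "prob {\<omega>\<in>space M. \<forall>x\<in>set l. x \<in> occ \<omega>} = (\<Prod>x\<in>set l. prob {\<omega>\<in>space M. x \<in> occ \<omega>})"
        by (rule indep) simp
      also have "\<dots> \<le> (\<Prod>x\<in>set l. m x)" by (intro prod_mono) (auto simp: m)
      also have "\<dots> = prod_list (map m l)" using l by (intro prod.distinct_set_conv_list) auto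
      finally show "prob {\<omega>\<in>space M. \<forall>x\<in>set l. x \<in> occ \<omega>} \<le> prod_list (map m l)" .
    qed
    also have "\<dots> \<le> (\<Sum>l\<in>paths r N n i. prod_list (map m l))"
      using finite_paths m0 by (intro sum_mono2) (auto intro!: prod_list_nonneg)
    also have "\<dots> \<le> m i * \<kappa> ^ n" by (rule paths_weight[OF m0 \<kappa>(1,2)])
    finally show ?thesis .
  qed
  define F where "F n i = (\<Union>N. E n i N)" for n i
  have Fev: "F n i \<in> events" for n i unfolding F_def using Eev by auto
  have Fle: "prob (F n i) \<le> m i * \<kappa> ^ n" for n i
  proof -
    have "(\<lambda>N. prob (E n i N)) \<longlonglongrightarrow> prob (F n i)" unfolding F_def
    proof (rule finite_Lim_measure_incseq)
      show "incseq (E n i)"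
      proof (rule incseq_SucI)
        fix N show "E n i N \<subseteq> E n i (Suc N)" unfolding E_def using paths_mono[of N "Suc N" r n i] by auto
      qed
    qed (use Eev in auto)
    then show ?thesis using Ele by (intro LIMSEQ_le_const2) auto
  qed
  have "AE \<omega> in M. \<omega> \<notin> (\<Inter>n. F n i)" for i
  proof -
    have I: "(\<Inter>n. F n i) \<in> events" using Fev by auto
    have "prob (\<Inter>n. F n i) \<le> m i * \<kappa> ^ n" for n
    proof -
      have "prob (\<Inter>n. F n i) \<le> prob (F n i)" using Fev by (intro finite_measure_mono) auto
      then show ?thesis using Fle[of n i] by linarith
    qed
    moreover have "(\<lambda>n. m i * \<kappa> ^ n) \<longlonglongrightarrow> m i * 0"
      using \<kappa> by (intro tendsto_intros LIMSEQ_realpow_zero) auto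
    ultimately have "prob (\<Inter>n. F n i) \<le> 0" using LIMSEQ_le_const[of "\<lambda>n. m i * \<kappa> ^ n" 0] by auto
    then have "prob (\<Inter>n. F n i) = 0" using measure_nonneg antisym by blast
    then show ?thesis using I by (intro AE_I'[of "\<Inter>n. F n i"]) (auto simp: null_sets_def emeasure_eq_measure)
  qed
  then have "AE \<omega> in M. \<forall>i. \<omega> \<notin> (\<Inter>n. F n i)" by (subst AE_all_countable) blast
  then show ?thesis using AE_space
  proof eventually_elim
    case (elim \<omega>)
    show ?case
    proof
      fix i
      obtain n where n: "\<omega> \<notin> F n i" using elim by blast
      have "\<not> (\<exists>l. length l = Suc n \<and> hd l = i \<and> distinct l \<and> successively r l \<and> set l \<subseteq> occ \<omega>)"
      proof
        assume "\<exists>l. length l = Suc n \<and> hd l = i \<and> distinct l \<and> successively r l \<and> set l \<subseteq> occ \<omega>"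
        then obtain l where l: "length l = Suc n" "hd l = i" "distinct l" "successively r l" "set l \<subseteq> occ \<omega>" by blast
        define N where "N = Suc (Max (set l))"
        have "set l \<subseteq> {..<N}" using l(1) by (auto simp: N_def less_Suc_eq_le)
        then have "l \<in> paths r N n (hd l)" using l by (intro mem_pathsI) auto
        then have "\<omega> \<in> E n i N" using l elim by (auto simp: E_def)
        then show False using n by (auto simp: F_def)
      qed
      then show "\<exists>n. \<not> (\<exists>l. length l = Suc n \<and> hd l = i \<and> distinct l \<and> successively r l \<and> set l \<subseteq> occ \<omega>)" ..
    qed
  qed
qed

text \<open>Loop erasure: when the new vertex already lies on the path, the path is cut back to its
  earlier visit.\<close>

lemma rtranclp_distinct_path:
  assumes "r\<^sup>*\<^sup>* x y"
  shows "\<exists>l. l \<noteq> [] \<and> hd l = x \<and> last l = y \<and> distinct l \<and> successively r l"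
  using assms
proof (induction rule: rtranclp_induct)
  case base
  show ?case by (intro exI[of _ "[x]"]) simp
next
  case (step y z)
  then obtain l where l: "l \<noteq> []" "hd l = x" "last l = y" "distinct l" "successively r l" by blast
  show ?case
  proof (cases "z \<in> set l")
    case True
    then obtain l1 l2 where s: "l = l1 @ z # l2" by (meson split_list)
    have "hd (l1 @ [z]) = x" using l s by (cases l1) auto
    moreover have "successively r (l1 @ [z])" using l(5) s by (auto simp: successively_append_iff)
    ultimately show ?thesis using l s by (intro exI[of _ "l1 @ [z]"]) auto
  next
    case False
    then show ?thesis using l step(2) by (intro exI[of _ "l @ [z]"]) (auto simp: successively_append_iff)
  qed
qed

text \<open>The bound per step is chained through arbitrary points of the intermediate sets, which
  must therefore be nonempty. Two vertices at least are required because the step bound concerns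
  related sets, not two points of one set.\<close>

lemma successively_dist_le:
  assumes "successively r l" "\<And>x y a b. r x y \<Longrightarrow> a \<in> A x \<Longrightarrow> b \<in> A y \<Longrightarrow> dist a b \<le> (c::real)"
    and "\<And>x. x \<in> set l \<Longrightarrow> A x \<noteq> {}" "0 \<le> c" "2 \<le> length l" "a \<in> A (hd l)" "b \<in> A (last l)"
  shows "dist a b \<le> c * length l"
  using assms(1,3,5,6,7)
proof (induction l arbitrary: a)
  case (Cons x l)
  then obtain y l' where l: "l = y # l'" by (cases l) auto
  obtain d where d: "d \<in> A y" using Cons.prems(2)[of y] l by auto
  have ad: "dist a d \<le> c" using Cons.prems l d by (intro assms(2)[of x y]) auto
  show ?case
  proof (cases "l' = []")
    case True
    then have "dist a b \<le> c" using Cons.prems l by (intro assms(2)[of x y]) auto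
    also have "c \<le> c * length (x # l)" using assms(4) by (simp add: algebra_simps)
    finally show ?thesis .
  next
    case False
    have "dist d b \<le> c * length l"
      using Cons.prems l False d by (intro Cons.IH) (auto simp: Suc_le_eq)
    then show ?thesis using ad dist_triangle[of a b d] by (simp add: algebra_simps)
  qed
qed simp

section \<open>Sticks\<close>

text \<open>The axis is compact, so the infimum in the distance to it is attained.\<close>

lemma stick_iff_interval: "y \<in> stick L x p \<longleftrightarrow> (\<exists>t. - L / 2 \<le> t \<and> t \<le> L / 2 \<and> dist y (x + t *\<^sub>R p) \<le> 1)" if "0 \<le> L"
proof -
  have ax: "stick_axis L x p = (\<lambda>t. x + t *\<^sub>R p) ` {- L / 2..L / 2}" by (auto simp: stick_axis_def)
  have ne: "stick_axis L x p \<noteq> {}" using that by (auto simp: ax)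
  have cl: "closed (stick_axis L x p)" unfolding ax
    by (intro compact_imp_closed compact_continuous_image continuous_intros) auto
  show ?thesis
  proof
    assume "y \<in> stick L x p"
    then have "infdist y (stick_axis L x p) \<le> 1" by (simp add: stick_def)
    moreover obtain a where "a \<in> stick_axis L x p" "infdist y (stick_axis L x p) = dist y a"
      using infdist_attains_inf[OF cl ne] by blast
    ultimately show "\<exists>t. - L / 2 \<le> t \<and> t \<le> L / 2 \<and> dist y (x + t *\<^sub>R p) \<le> 1" by (auto simp: stick_axis_def)
  next
    assume "\<exists>t. - L / 2 \<le> t \<and> t \<le> L / 2 \<and> dist y (x + t *\<^sub>R p) \<le> 1"
    then obtain t where t: "- L / 2 \<le> t" "t \<le> L / 2" "dist y (x + t *\<^sub>R p) \<le> 1" by blast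
    have "infdist y (stick_axis L x p) \<le> dist y (x + t *\<^sub>R p)"
      using t by (intro infdist_le) (auto simp: stick_axis_def)
    then show "y \<in> stick L x p" using t by (simp add: stick_def)
  qed
qed

lemma stick_iff: "0 \<le> L \<Longrightarrow> y \<in> stick L x p \<longleftrightarrow> (\<exists>t. \<bar>t\<bar> \<le> L / 2 \<and> dist y (x + t *\<^sub>R p) \<le> 1)"
proof -
  assume L: "0 \<le> L"
  have "- L / 2 \<le> t \<and> t \<le> L / 2 \<longleftrightarrow> \<bar>t\<bar> \<le> L / 2" for t by (simp add: abs_le_iff) linarith
  then show ?thesis unfolding stick_iff_interval[OF L] by (simp add: conj_assoc[symmetric])
qed

lemma stick_dist_center:
  assumes "0 \<le> L" "norm p = 1" "y \<in> stick L x p"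
  shows "dist y x \<le> L / 2 + 1"
proof -
  obtain t where t: "\<bar>t\<bar> \<le> L / 2" "dist y (x + t *\<^sub>R p) \<le> 1" using assms by (auto simp: stick_iff)
  have "dist (x + t *\<^sub>R p) x \<le> L / 2" using t assms by (simp add: dist_norm)
  then show ?thesis using t dist_triangle[of y x "x + t *\<^sub>R p"] by linarith
qed

text \<open>A change of direction is magnified by the half-length L / 2. This is why cells have
  diameter of order 1 / L.\<close>

lemma axis_point_dist:
  fixes z z' :: "'a::euclidean_space \<times> 'a"
  assumes "\<bar>t\<bar> \<le> L / 2"
  shows "dist (fst z + t *\<^sub>R snd z) (fst z' + t *\<^sub>R snd z') \<le> (1 + L / 2) * dist z z'"
proof -
  have "(fst z + t *\<^sub>R snd z) - (fst z' + t *\<^sub>R snd z') = (fst z - fst z') + t *\<^sub>R (snd z - snd z')"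
    by (simp add: algebra_simps)
  then have "dist (fst z + t *\<^sub>R snd z) (fst z' + t *\<^sub>R snd z') \<le> norm (fst z - fst z') + norm (t *\<^sub>R (snd z - snd z'))"
    unfolding dist_norm by (metis norm_triangle_ineq)
  also have "\<dots> = dist (fst z) (fst z') + \<bar>t\<bar> * dist (snd z) (snd z')" by (simp add: dist_norm)
  also have "\<dots> \<le> dist z z' + (L / 2) * dist z z'"
    using assms by (intro add_mono mult_mono dist_fst_le dist_snd_le) auto
  finally show ?thesis by (simp add: algebra_simps)
qed

lemma space_stick_intensity: "space (stick_intensity \<Theta> u) = UNIV \<times> space \<Theta>"
  using sets_eq_imp_space_eq[of "stick_intensity \<Theta> u" "lborel \<Otimes>\<^sub>M \<Theta>"]
  by (simp add: stick_intensity_def space_pair_measure)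

text \<open>An arbitrary orientation distribution; absence of percolation at low intensity is proved
  in this generality.\<close>

locale direction =
  fixes \<Theta> :: "'a::euclidean_space measure"
  assumes sets_\<Theta>: "sets \<Theta> = sets (restrict_space borel (sphere 0 1))" and prob_\<Theta>: "prob_space \<Theta>"
begin

sublocale \<Theta>: prob_space \<Theta> by (rule prob_\<Theta>)
sublocale pair_sigma_finite "lborel :: 'a measure" \<Theta> ..

lemma space_\<Theta>: "space \<Theta> = sphere 0 1"
  using sets_eq_imp_space_eq[OF sets_\<Theta>] by (simp add: space_restrict_space)

lemma space_intensity: "space (stick_intensity \<Theta> u) = UNIV \<times> sphere 0 1"
  by (simp add: space_stick_intensity space_\<Theta>)

lemma open_in_intensity:
  assumes "open G"
  shows "G \<inter> space (stick_intensity \<Theta> u) \<in> sets (stick_intensity \<Theta> u)"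
proof -
  have "(\<lambda>x. x) \<in> \<Theta> \<rightarrow>\<^sub>M borel"
    unfolding measurable_cong_sets[OF sets_\<Theta> refl] by (intro measurable_restrict_space1) simp
  then have "(\<lambda>z. (fst z, snd z)) \<in> lborel \<Otimes>\<^sub>M \<Theta> \<rightarrow>\<^sub>M borel \<Otimes>\<^sub>M borel"
    by (intro measurable_Pair measurable_compose[OF measurable_snd]) auto
  then have "(\<lambda>z. z) \<in> lborel \<Otimes>\<^sub>M \<Theta> \<rightarrow>\<^sub>M borel" by (simp add: borel_prod)
  then have "(\<lambda>z. z) -` G \<inter> space (lborel \<Otimes>\<^sub>M \<Theta>) \<in> sets (lborel \<Otimes>\<^sub>M \<Theta>)"
    using assms by (intro measurable_sets) auto
  then show ?thesis by (simp add: stick_intensity_def space_stick_intensity[unfolded stick_intensity_def] space_pair_measure Int_commute)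
qed

lemma cell_in_intensity:
  "cell d h (space (stick_intensity \<Theta> u)) i \<in> sets (stick_intensity \<Theta> u)"
  by (intro cell_in_sets open_in_intensity) auto

lemma emeasure_intensity:
  assumes "A \<in> sets (stick_intensity \<Theta> u)"
  shows "emeasure (stick_intensity \<Theta> u) A = ennreal u * (\<integral>\<^sup>+p. emeasure lborel ((\<lambda>x. (x, p)) -` A) \<partial>\<Theta>)"
  using assms by (simp add: stick_intensity_def emeasure_pair_measure_alt2)

lemma emeasure_intensity_le:
  assumes "A \<in> sets (stick_intensity \<Theta> u)" "\<And>p. p \<in> sphere 0 1 \<Longrightarrow> emeasure lborel ((\<lambda>x. (x, p)) -` A) \<le> c"
  shows "emeasure (stick_intensity \<Theta> u) A \<le> ennreal u * c"
proof -
  have "(\<integral>\<^sup>+p. emeasure lborel ((\<lambda>x. (x, p)) -` A) \<partial>\<Theta>) \<le> (\<integral>\<^sup>+p. c \<partial>\<Theta>)"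
    using assms(2) by (intro nn_integral_mono) (auto simp: space_\<Theta>)
  also have "\<dots> = c" by (simp add: \<Theta>.emeasure_space_1)
  finally show ?thesis unfolding emeasure_intensity[OF assms(1)] by (intro mult_left_mono) auto
qed

section \<open>No percolation at low intensity\<close>

text \<open>Existential and with a gap: sticks from two cells that are not close keep distance at
  least 1. Such a gap survives infinite unions and splits the covered set into separated
  parts.\<close>

definition close :: "real \<Rightarrow> ('a \<times> 'a) set \<Rightarrow> ('a \<times> 'a) set \<Rightarrow> bool" where
  "close L C D \<longleftrightarrow> (\<exists>z\<in>C. \<exists>z'\<in>D. \<exists>y\<in>stick L (fst z) (snd z). \<exists>y'\<in>stick L (fst z') (snd z'). dist y y' < 1)"

text \<open>The constant is 6 = 3/2 + 1 + 1 + 1 + 3/2: moving inside the first cell, the radius of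
  its stick, the gap, the radius of the other stick, moving inside the second cell. The first and
  last terms bound (1 + L / 2) / L for L \<ge> 1.\<close>

lemma close_axes:
  assumes L: "1 \<le> L" and C: "\<And>z z'. z \<in> C \<Longrightarrow> z' \<in> C \<Longrightarrow> dist z z' < 1 / L"
    and D: "\<And>z z'. z \<in> D \<Longrightarrow> z' \<in> D \<Longrightarrow> dist z z' < 1 / L"
    and cl: "close L C D" and z: "z \<in> C" "z' \<in> D"
  shows "\<exists>t s. \<bar>t\<bar> \<le> L / 2 \<and> \<bar>s\<bar> \<le> L / 2 \<and> dist (fst z + t *\<^sub>R snd z) (fst z' + s *\<^sub>R snd z') \<le> 6"
proof -
  obtain w w' y y' where w: "w \<in> C" "w' \<in> D" "y \<in> stick L (fst w) (snd w)" "y' \<in> stick L (fst w') (snd w')" "dist y y' < 1"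
    using cl unfolding close_def by blast
  obtain t where t: "\<bar>t\<bar> \<le> L / 2" "dist y (fst w + t *\<^sub>R snd w) \<le> 1" using w(3) L by (auto simp: stick_iff)
  obtain s where s: "\<bar>s\<bar> \<le> L / 2" "dist y' (fst w' + s *\<^sub>R snd w') \<le> 1" using w(4) L by (auto simp: stick_iff)
  have k: "(1 + L / 2) * e \<le> 3 / 2" if "e < 1 / L" for e
  proof -
    have "(1 + L / 2) * e \<le> (1 + L / 2) * (1 / L)" using that L by (intro mult_left_mono) auto
    also have "\<dots> = 1 / L + 1 / 2" using L by (simp add: field_simps)
    also have "1 / L \<le> 1" using L by simp
    finally show ?thesis by simp
  qed
  have 1: "dist (fst z + t *\<^sub>R snd z) (fst w + t *\<^sub>R snd w) \<le> 3 / 2"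
    using axis_point_dist[OF t(1), of z w] k[OF C[OF z(1) w(1)]] by linarith
  have 2: "dist (fst w' + s *\<^sub>R snd w') (fst z' + s *\<^sub>R snd z') \<le> 3 / 2"
    using axis_point_dist[OF s(1), of w' z'] k[OF D[OF w(2) z(2)]] by linarith
  have "dist (fst z + t *\<^sub>R snd z) (fst z' + s *\<^sub>R snd z') \<le> 6"
    using 1 2 t(2) s(2) w(5)
      dist_triangle[of "fst z + t *\<^sub>R snd z" "fst z' + s *\<^sub>R snd z'" "fst w + t *\<^sub>R snd w"]
      dist_triangle[of "fst w + t *\<^sub>R snd w" "fst z' + s *\<^sub>R snd z'" y]
      dist_triangle[of y "fst z' + s *\<^sub>R snd z'" y']
      dist_triangle[of y' "fst z' + s *\<^sub>R snd z'" "fst w' + s *\<^sub>R snd w'"]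
    by (simp add: dist_commute)
  then show ?thesis using t(1) s(1) by blast
qed

text \<open>Four times the volume of a ball of radius 8: the parameter grid in
  \<open>volume_near_segments\<close> has at most (2L) * (2L) points, each contributing one such
  ball.\<close>

definition crossing_const :: real where
  "crossing_const = 4 * (unit_ball_vol (DIM('a)) * 8 ^ DIM('a))"

text \<open>Up to distance 6 the centre \<open>x\<close> equals
  \<open>x0 + t *\<^sub>R p0 - s *\<^sub>R p\<close>. Replacing \<open>t\<close> and
  \<open>s\<close> by parameters from a grid of spacing 1 adds at most 1 each, which gives balls of
  radius 8.\<close>

lemma volume_near_segments:
  fixes x0 p0 p :: 'a
  assumes L: "1 \<le> L" and p: "norm p0 = 1" "norm p = 1"
    and A: "\<And>x. x \<in> A \<Longrightarrow> \<exists>t s. \<bar>t\<bar> \<le> L / 2 \<and> \<bar>s\<bar> \<le> L / 2 \<and> dist (x0 + t *\<^sub>R p0) (x + s *\<^sub>R p) \<le> 6"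
  shows "emeasure lborel A \<le> ennreal (crossing_const * L\<^sup>2)"
proof -
  define N where "N = nat \<lfloor>L\<rfloor>"
  define c where "c a b = x0 + (real a - L / 2) *\<^sub>R p0 - (real b - L / 2) *\<^sub>R p" for a b :: nat
  have approx: "\<exists>a\<le>N. \<bar>t - (real a - L / 2)\<bar> \<le> 1" if "\<bar>t\<bar> \<le> L / 2" for t
  proof -
    have t: "0 \<le> t + L / 2" "t + L / 2 \<le> L" using that by (auto simp: abs_le_iff)
    define a where "a = nat \<lfloor>t + L / 2\<rfloor>"
    have "a \<le> N" unfolding a_def N_def using t by (intro nat_mono floor_mono)
    moreover have "real a \<le> t + L / 2" "t + L / 2 < real a + 1" using t by (auto simp: a_def)
    ultimately show ?thesis by (intro exI[of _ a]) auto
  qed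
  have "A \<subseteq> (\<Union>(a, b)\<in>{..N} \<times> {..N}. cball (c a b) 8)"
  proof
    fix x assume "x \<in> A"
    then obtain t s where ts: "\<bar>t\<bar> \<le> L / 2" "\<bar>s\<bar> \<le> L / 2" "dist (x0 + t *\<^sub>R p0) (x + s *\<^sub>R p) \<le> 6" using A by blast
    obtain a b where ab: "a \<le> N" "\<bar>t - (real a - L / 2)\<bar> \<le> 1" "b \<le> N" "\<bar>s - (real b - L / 2)\<bar> \<le> 1"
      using approx ts by blast
    have "c a b - x = (x0 + t *\<^sub>R p0 - (x + s *\<^sub>R p)) - (t - (real a - L / 2)) *\<^sub>R p0 + (s - (real b - L / 2)) *\<^sub>R p"
      by (simp add: c_def algebra_simps)
    then have "norm (c a b - x) \<le> norm (x0 + t *\<^sub>R p0 - (x + s *\<^sub>R p)) + norm ((t - (real a - L / 2)) *\<^sub>R p0) + norm ((s - (real b - L / 2)) *\<^sub>R p)"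
      using norm_triangle_ineq4 norm_triangle_ineq order_trans add_right_mono by (metis (no_types, lifting))
    also have "\<dots> \<le> 6 + 1 + 1" using ts ab p by (intro add_mono) (auto simp: dist_norm)
    finally have "x \<in> cball (c a b) 8" by (simp add: dist_norm)
    then show "x \<in> (\<Union>(a, b)\<in>{..N} \<times> {..N}. cball (c a b) 8)" using ab by blast
  qed
  then have "emeasure lborel A \<le> emeasure lborel (\<Union>(a, b)\<in>{..N} \<times> {..N}. cball (c a b) 8)"
    by (intro emeasure_mono) auto
  also have "\<dots> \<le> (\<Sum>(a, b)\<in>{..N} \<times> {..N}. emeasure lborel (cball (c a b) 8))"
    unfolding case_prod_unfold by (intro emeasure_subadditive_finite) auto
  also have "\<dots> = of_nat (card ({..N} \<times> {..N})) * ennreal (unit_ball_vol (DIM('a)) * 8 ^ DIM('a))"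
    by (simp add: case_prod_unfold emeasure_cball)
  also have "\<dots> = ennreal (real (card ({..N} \<times> {..N})) * (unit_ball_vol (DIM('a)) * 8 ^ DIM('a)))"
    by (simp add: ennreal_mult ennreal_of_nat_eq_real_of_nat)
  also have "\<dots> \<le> ennreal (crossing_const * L\<^sup>2)"
  proof (rule ennreal_leI)
    have "real N \<le> L" using L by (simp add: N_def)
    then have "real (card ({..N} \<times> {..N})) \<le> (2 * L) * (2 * L)"
      using L unfolding card_cartesian_product card_atMost of_nat_mult by (intro mult_mono) auto
    then have "real (card ({..N} \<times> {..N})) * (unit_ball_vol (DIM('a)) * 8 ^ DIM('a)) \<le> (2 * L) * (2 * L) * (unit_ball_vol (DIM('a)) * 8 ^ DIM('a))"
      by (rule mult_right_mono) simp
    then show "real (card ({..N} \<times> {..N})) * (unit_ball_vol (DIM('a)) * 8 ^ DIM('a)) \<le> crossing_const * L\<^sup>2"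
      by (simp add: crossing_const_def power2_eq_square algebra_simps)
  qed
  finally show ?thesis .
qed

text \<open>A component stays within the sticks of the occupied cells reachable from one of its
  cells, because all other sticks keep distance 1. Reachable cells are joined to the first by
  self-avoiding paths of bounded length, so the component is bounded.\<close>

lemma AE_not_percolates:
  assumes P: "poisson_point_process P (stick_intensity \<Theta> u) (\<lambda>\<omega>. \<omega>)"
    and u: "0 < u" and L: "1 \<le> L" and small: "u * (crossing_const * L\<^sup>2) < 1"
  shows "AE \<omega> in P. \<not> percolates (covered_set L \<omega>)"
proof -
  let ?\<mu> = "stick_intensity \<Theta> u"
  define \<kappa> where "\<kappa> = u * (crossing_const * L\<^sup>2)"
  interpret ppp P ?\<mu> by (rule ppp.intro[OF P])
  obtain D :: "('a \<times> 'a) set" where D: "countable D" "\<And>X. open X \<Longrightarrow> X \<noteq> {} \<Longrightarrow> \<exists>d\<in>D. d \<in> X"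
    using countable_dense_exists by blast
  define d where "d = from_nat_into D"
  have Dne: "D \<noteq> {}" using D(2)[of UNIV] by auto
  \<comment> \<open>Around a countable dense set of centres this radius gives cells of diameter
    below 1 / L, as \<open>close_axes\<close> requires.\<close>
  define h where "h = 1 / (2 * L)"
  have h: "0 < h" "2 * h = 1 / L" using L by (auto simp: h_def)
  define C where "C = cell d h (space ?\<mu>)"
  have Cs: "C i \<in> sets ?\<mu>" for i unfolding C_def by (rule cell_in_intensity)
  have Cd: "disjoint_family_on C I" for I
    using disjoint_cell[of d h "space ?\<mu>"] unfolding C_def disjoint_family_on_def by blast
  have Cdiam: "dist z z' < 1 / L" if "z \<in> C i" "z' \<in> C i" for z z' i
    using cell_diameter that h unfolding C_def by metis
  have Ccov: "\<exists>i. z \<in> C i" if "z \<in> space ?\<mu>" for z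
  proof -
    obtain e where "e \<in> D" "e \<in> ball z h" using D(2)[of "ball z h"] h by auto
    then obtain n where "d n = e" unfolding d_def using D(1) Dne by (metis from_nat_into_surj)
    then show ?thesis using cell_cover[OF that, of d n h] \<open>e \<in> ball z h\<close> by (auto simp: C_def)
  qed
  have Csp: "z \<in> C i \<Longrightarrow> norm (snd z) = 1" for z i
    by (auto simp: C_def cell_def space_intensity)
  define r where "r i j \<longleftrightarrow> close L (C i) (C j)" for i j
  \<comment> \<open>One stick \<open>z0\<close> stands for its whole cell. For each direction the
    centres of sticks in close cells fill volume at most \<open>crossing_const * L\<^sup>2\<close>,
    and averaging over directions preserves the bound.\<close>
  have mass: "emeasure ?\<mu> (\<Union>j\<in>{j. r i j}. C j) \<le> ennreal \<kappa>" for i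
  proof (cases "C i = {}")
    case True
    then have "{j. r i j} = {}" by (auto simp: r_def close_def)
    then show ?thesis by simp
  next
    case False
    then obtain z0 where z0: "z0 \<in> C i" by blast
    have "emeasure ?\<mu> (\<Union>j\<in>{j. r i j}. C j) \<le> ennreal u * ennreal (crossing_const * L\<^sup>2)"
    proof (rule emeasure_intensity_le)
      show "(\<Union>j\<in>{j. r i j}. C j) \<in> sets ?\<mu>" using Cs by (intro sets.countable_UN') auto
      fix p :: 'a assume p: "p \<in> sphere 0 1"
      show "emeasure lborel ((\<lambda>x. (x, p)) -` (\<Union>j\<in>{j. r i j}. C j)) \<le> ennreal (crossing_const * L\<^sup>2)"
      proof (rule volume_near_segments[OF L Csp[OF z0]])
        fix x assume "x \<in> (\<lambda>x. (x, p)) -` (\<Union>j\<in>{j. r i j}. C j)"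
        then obtain j where j: "r i j" "(x, p) \<in> C j" by auto
        show "\<exists>t s. \<bar>t\<bar> \<le> L / 2 \<and> \<bar>s\<bar> \<le> L / 2 \<and> dist (fst z0 + t *\<^sub>R snd z0) (x + s *\<^sub>R p) \<le> 6"
          using close_axes[OF L Cdiam Cdiam j(1)[unfolded r_def] z0 j(2)] by simp
      qed (use p in simp)
    qed
    then show ?thesis using u by (simp add: \<kappa>_def ennreal_mult')
  qed
  have \<kappa>0: "0 \<le> \<kappa>" using u by (simp add: \<kappa>_def crossing_const_def)
  \<comment> \<open>A nonempty cell is its own neighbour, so the bound on neighbours also bounds its
    own mass.\<close>
  have self: "r i i" if ne: "C i \<noteq> {}" for i
  proof -
    obtain z where z: "z \<in> C i" using ne by blast
    have "fst z \<in> stick L (fst z) (snd z)" using L by (subst stick_iff) (auto intro!: exI[of _ 0])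
    then show ?thesis unfolding r_def close_def using z by (metis dist_self zero_less_one)
  qed
  have Cfin: "emeasure ?\<mu> (C i) < \<infinity>" for i
  proof (cases "C i = {}")
    case False
    have "emeasure ?\<mu> (C i) \<le> emeasure ?\<mu> (\<Union>j\<in>{j. r i j}. C j)"
      using self[OF False] Cs by (intro emeasure_mono sets.countable_UN') auto
    also have "\<dots> \<le> ennreal \<kappa>" by (rule mass)
    finally show ?thesis by (rule le_less_trans) simp
  qed simp
  define occ where "occ \<omega> = {i. \<omega> \<inter> C i \<noteq> {}}" for \<omega>
  have "AE \<omega> in P. \<forall>i. \<exists>n. \<not> (\<exists>l. length l = Suc n \<and> hd l = i \<and> distinct l \<and> successively r l \<and> set l \<subseteq> occ \<omega>)"
  proof (rule AE_no_long_path[where m = "\<lambda>i. measure ?\<mu> (C i)" and \<kappa> = \<kappa>])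
    show "{\<omega>\<in>space P. i \<in> occ \<omega>} \<in> events" for i
      unfolding occ_def using sets.sets_Collect_neg[OF empty_event[OF Cs[of i]]] by simp
    show "prob {\<omega>\<in>space P. \<forall>i\<in>I. i \<in> occ \<omega>} = (\<Prod>i\<in>I. prob {\<omega>\<in>space P. i \<in> occ \<omega>})" if "finite I" for I
      using indep_empty[OF that, of C "\<lambda>_. False"] Cs Cd by (simp add: occ_def)
    show "prob {\<omega>\<in>space P. i \<in> occ \<omega>} \<le> measure ?\<mu> (C i)" for i
      using prob_nonempty_le[OF Cs Cfin] by (simp add: occ_def)
    show "(\<Sum>j | j < N \<and> r i j. measure ?\<mu> (C j)) \<le> \<kappa>" for i N
    proof -
      have "(\<Sum>j | j < N \<and> r i j. measure ?\<mu> (C j)) = measure ?\<mu> (\<Union>j\<in>{j. j < N \<and> r i j}. C j)"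
        using Cs Cd Cfin by (intro measure_finite_Union[symmetric]) (auto simp: less_top)
      moreover have "emeasure ?\<mu> (\<Union>j\<in>{j. j < N \<and> r i j}. C j) \<le> ennreal \<kappa>"
        using Cs by (intro order_trans[OF emeasure_mono mass[of i]] sets.countable_UN') auto
      ultimately show ?thesis using \<kappa>0 by (simp add: measure_def enn2real_leI)
    qed
  qed (use \<kappa>0 small in \<open>auto simp: \<kappa>_def\<close>)
  then show ?thesis using AE_space
  proof eventually_elim
    case (elim \<omega>)
    have \<omega>: "\<omega> \<subseteq> space ?\<mu>" using elim by (intro points_subset)
    let ?st = "\<lambda>z. stick L (fst z) (snd z)"
    define SS where "SS i = (\<Union>z\<in>C i. ?st z)" for i
    \<comment> \<open>Four passages between a point of a stick and its centre cost L / 2 + 1 each;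
      two moves inside cells and the gap between close sticks cost at most 1 each.\<close>
    define c where "c = 2 * L + 7"
    have c0: "0 \<le> c" using L by (simp add: c_def)
    have SSd: "dist a b \<le> c" if ij: "r i j" and ab: "a \<in> SS i" "b \<in> SS j" for i j a b
    proof -
      obtain z z' where z: "z \<in> C i" "a \<in> ?st z" "z' \<in> C j" "b \<in> ?st z'" using ab by (auto simp: SS_def)
      obtain w w' y y' where w: "w \<in> C i" "w' \<in> C j" "y \<in> ?st w" "y' \<in> ?st w'" "dist y y' < 1"
        using ij unfolding r_def close_def by blast
      have L1: "1 / L \<le> 1" using L by simp
      have "dist (fst z) (fst w) \<le> 1" using Cdiam[OF z(1) w(1)] dist_fst_le[of z w] L1 by linarith
      moreover have "dist (fst w') (fst z') \<le> 1" using Cdiam[OF w(2) z(3)] dist_fst_le[of w' z'] L1 by linarith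
      moreover have "dist a (fst z) \<le> L / 2 + 1" "dist y (fst w) \<le> L / 2 + 1" "dist y' (fst w') \<le> L / 2 + 1" "dist b (fst z') \<le> L / 2 + 1"
        using stick_dist_center[OF _ Csp[OF z(1)] z(2)] stick_dist_center[OF _ Csp[OF w(1)] w(3)]
          stick_dist_center[OF _ Csp[OF w(2)] w(4)] stick_dist_center[OF _ Csp[OF z(3)] z(4)] L by simp_all
      ultimately show ?thesis using w(5)
          dist_triangle[of a b "fst z"] dist_triangle[of "fst z" b "fst w"] dist_triangle[of "fst w" b y]
          dist_triangle[of y b y'] dist_triangle[of y' b "fst w'"] dist_triangle[of "fst w'" b "fst z'"]
        unfolding c_def by (simp add: dist_commute)
    qed
    show ?case
    proof
      assume "percolates (covered_set L \<omega>)"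
      then obtain K where K: "K \<in> components (covered_set L \<omega>)" "\<not> bounded K" by (auto simp: percolates_def)
      have Ksub: "K \<subseteq> covered_set L \<omega>" and Kc: "connected K" and Kne: "K \<noteq> {}"
        using K(1) in_components_subset in_components_connected in_components_nonempty by blast+
      have cov: "\<exists>z\<in>\<omega>. y \<in> ?st z" if "y \<in> covered_set L \<omega>" for y using that by (force simp: covered_set_def)
      obtain y z0 where y: "y \<in> K" "z0 \<in> \<omega>" "y \<in> ?st z0" using Kne Ksub cov by blast
      obtain i where i: "z0 \<in> C i" using Ccov[OF subsetD[OF \<omega> y(2)]] by blast
      have iocc: "i \<in> occ \<omega>" using i y(2) by (auto simp: occ_def)
      define r' where "r' j k \<longleftrightarrow> j \<in> occ \<omega> \<and> k \<in> occ \<omega> \<and> r j k" for j k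
      define A where "A = (\<Union>z\<in>{z\<in>\<omega>. \<exists>j. r'\<^sup>*\<^sup>* i j \<and> z \<in> C j}. ?st z)"
      define B where "B = (\<Union>z\<in>{z\<in>\<omega>. \<not> (\<exists>j. r'\<^sup>*\<^sup>* i j \<and> z \<in> C j)}. ?st z)"
      have AB: "covered_set L \<omega> \<subseteq> A \<union> B"
      proof
        fix x assume "x \<in> covered_set L \<omega>"
        then obtain z where z: "z \<in> \<omega>" "x \<in> ?st z" using cov by blast
        show "x \<in> A \<union> B"
        proof (cases "\<exists>j. r'\<^sup>*\<^sup>* i j \<and> z \<in> C j")
          case True
          then have "x \<in> A" unfolding A_def using z by (intro UN_I[of z]) auto
          then show ?thesis ..
        next
          case False
          then have "x \<in> B" unfolding B_def using z by (intro UN_I[of z]) auto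
          then show ?thesis ..
        qed
      qed
      have reach_occ: "j \<in> occ \<omega>" if "r'\<^sup>*\<^sup>* i j" for j
        using that iocc by (induction rule: rtranclp_induct) (auto simp: r'_def)
      have sepAB: "1 \<le> dist a b" if ab: "a \<in> A" "b \<in> B" for a b
      proof (rule ccontr)
        assume "\<not> 1 \<le> dist a b"
        obtain z j where z: "z \<in> \<omega>" "r'\<^sup>*\<^sup>* i j" "z \<in> C j" "a \<in> ?st z" using ab by (auto simp: A_def)
        obtain z' where z': "z' \<in> \<omega>" "\<not> (\<exists>j. r'\<^sup>*\<^sup>* i j \<and> z' \<in> C j)" "b \<in> ?st z'" using ab by (auto simp: B_def)
        obtain k where k: "z' \<in> C k" using Ccov[OF subsetD[OF \<omega> z'(1)]] by blast
        have "r j k" unfolding r_def close_def using z z' k \<open>\<not> 1 \<le> dist a b\<close> not_le by blast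
        moreover have "k \<in> occ \<omega>" using k z'(1) by (auto simp: occ_def)
        ultimately have "r' j k" using reach_occ[OF z(2)] by (simp add: r'_def)
        then have "r'\<^sup>*\<^sup>* i k" using z(2) by simp
        then show False using z'(2) k by blast
      qed
      have KA: "K \<subseteq> A"
      proof -
        \<comment> \<open>Enlarged by balls of radius 1 / 2, the sets \<open>A\<close> and
          \<open>B\<close> become disjoint and open. The connected \<open>K\<close> contains
          \<open>y\<close> from \<open>A\<close> and hence misses \<open>B\<close>.\<close>
        let ?G1 = "\<Union>a\<in>A. ball a (1/2)" and ?G2 = "\<Union>b\<in>B. ball b (1/2)"
        have "?G1 \<inter> ?G2 = {}"
        proof (rule ccontr)
          assume "?G1 \<inter> ?G2 \<noteq> {}"
          then obtain x a b where "a \<in> A" "b \<in> B" "dist a x < 1/2" "dist b x < 1/2" by auto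
          then show False using sepAB[of a b] dist_triangle2[of a b x] by linarith
        qed
        moreover have "K \<subseteq> ?G1 \<union> ?G2"
        proof
          fix x assume "x \<in> K"
          then have "x \<in> A \<or> x \<in> B" using Ksub AB by blast
          moreover have "x \<in> ball x (1/2)" by simp
          ultimately show "x \<in> ?G1 \<union> ?G2" by blast
        qed
        moreover have "y \<in> A" unfolding A_def using y i by (intro UN_I[of z0]) auto
        then have "y \<in> ?G1" by (intro UN_I[of y]) simp_all
        moreover have "open ?G1" "open ?G2" by auto
        ultimately have "?G2 \<inter> K = {}"
          using connectedD[OF Kc, of ?G1 ?G2] y(1) by blast
        moreover have "B \<subseteq> ?G2" by auto
        ultimately have "B \<inter> K = {}" by blast
        then show ?thesis using Ksub AB by blast
      qed
      obtain n where n: "\<not> (\<exists>l. length l = Suc n \<and> hd l = i \<and> distinct l \<and> successively r l \<and> set l \<subseteq> occ \<omega>)"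
        using elim by blast
      have "dist y a \<le> c * (n + 1)" if a: "a \<in> A" for a
      proof -
        obtain z j where z: "z \<in> \<omega>" "r'\<^sup>*\<^sup>* i j" "z \<in> C j" "a \<in> ?st z" using a by (auto simp: A_def)
        obtain l where l: "l \<noteq> []" "hd l = i" "last l = j" "distinct l" "successively r' l"
          using rtranclp_distinct_path[OF z(2)] by blast
        have locc: "set l \<subseteq> occ \<omega>"
        proof (cases "length l \<le> 1")
          case True
          then have "l = [i]" using l by (cases l) auto
          then show ?thesis using iocc by simp
        next
          case False
          show ?thesis using l(5) False
          proof (induction l rule: induct_list012)
            case (3 x y zs)
            then show ?case by (cases zs) (auto simp: r'_def)
          qed auto
        qed
        have lr: "successively r l" using l(5) by (rule successively_mono) (auto simp: r'_def)
        \<comment> \<open>A longer path would have an initial segment of exactly n + 1 cells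
          starting at \<open>i\<close>.\<close>
        have len: "length l \<le> n"
        proof (rule ccontr)
          assume "\<not> length l \<le> n"
          then have "length (take (Suc n) l) = Suc n" by simp
          moreover have "hd (take (Suc n) l) = i" using l by simp
          moreover have "distinct (take (Suc n) l)" using l(4) by simp
          moreover have "successively r (take (Suc n) l)"
            using lr by (metis append_take_drop_id successively_append_iff)
          moreover have "set (take (Suc n) l) \<subseteq> occ \<omega>" using locc set_take_subset by fast
          ultimately show False using n by blast
        qed
        have ya: "y \<in> SS (hd l)" "a \<in> SS (last l)" using l z i y by (auto simp: SS_def)
        show ?thesis
        proof (cases "2 \<le> length l")
          case True
          have "dist y a \<le> c * length l"
          proof (rule successively_dist_le[OF lr SSd _ c0 True ya])
            fix x assume "x \<in> set l"
            then have "x \<in> occ \<omega>" using locc by blast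
            then obtain w where w: "w \<in> C x" unfolding occ_def by blast
            have "fst w \<in> ?st w" using L by (subst stick_iff) (auto intro!: exI[of _ 0])
            then show "SS x \<noteq> {}" using w by (auto simp: SS_def)
          qed
          also have "\<dots> \<le> c * (n + 1)" using len c0 by (intro mult_left_mono) auto
          finally show ?thesis .
        next
          case False
          \<comment> \<open>A path of one cell: both points belong to sticks of the same cell, which
            is close to itself.\<close>
          then have "hd l = last l" using l(1) by (cases l rule: remdups_adj.cases) auto
          then have "dist y a \<le> c" using ya SSd[of i i y a] self[of i] i l by auto
          also have "c \<le> c * (n + 1)" using c0 by (simp add: algebra_simps)
          finally show ?thesis .
        qed
      qed
      then have "A \<subseteq> cball y (c * (n + 1))" by auto
      then have "bounded K" using KA bounded_cball bounded_subset by (meson order_trans)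
      then show False using K(2) by blast
    qed
  qed
qed

end

section \<open>Percolation at high intensity\<close>

lemma connected_stick: "0 \<le> L \<Longrightarrow> connected (stick L x p)" for x :: "'a::euclidean_space"
proof -
  assume L: "0 \<le> L"
  have "stick L x p = (\<lambda>(t, b). x + t *\<^sub>R p + b) ` ({- L / 2..L / 2} \<times> cball 0 1)"
  proof (intro equalityI subsetI)
    fix y assume "y \<in> stick L x p"
    then obtain t where "- L / 2 \<le> t" "t \<le> L / 2" "dist y (x + t *\<^sub>R p) \<le> 1"
      using L by (auto simp: stick_iff_interval)
    then show "y \<in> (\<lambda>(t, b). x + t *\<^sub>R p + b) ` ({- L / 2..L / 2} \<times> cball 0 1)"
      by (intro image_eqI[of _ _ "(t, y - (x + t *\<^sub>R p))"]) (auto simp: dist_norm norm_minus_commute)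
  next
    fix y assume "y \<in> (\<lambda>(t, b). x + t *\<^sub>R p + b) ` ({- L / 2..L / 2} \<times> cball 0 1)"
    then show "y \<in> stick L x p"
      unfolding stick_iff_interval[OF L] by (force simp: dist_norm norm_minus_commute)
  qed
  moreover have "connected (({- L / 2..L / 2} :: real set) \<times> cball (0::'a) 1)"
    by (intro connected_Times convex_connected convex_cball) auto
  then have "connected ((\<lambda>(t, b). x + t *\<^sub>R p + b) ` ({- L / 2..L / 2} \<times> cball 0 1))"
    by (intro connected_continuous_image) (auto simp: case_prod_unfold intro!: continuous_intros)
  ultimately show ?thesis by simp
qed

section \<open>Transversal directions and the volume of hitting centres\<close>

lemma bessel_two:
  fixes p v w :: "'a::real_inner"
  assumes "norm p = 1" "norm v = 1" "norm w = 1" "v \<bullet> w = 0"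
  shows "(p \<bullet> v)\<^sup>2 + (p \<bullet> w)\<^sup>2 \<le> 1"
proof -
  have n: "p \<bullet> p = 1" "v \<bullet> v = 1" "w \<bullet> w = 1" using assms by (simp_all add: norm_eq_1)
  have "0 \<le> (p - (p \<bullet> v) *\<^sub>R v - (p \<bullet> w) *\<^sub>R w) \<bullet> (p - (p \<bullet> v) *\<^sub>R v - (p \<bullet> w) *\<^sub>R w)" by simp
  also have "\<dots> = 1 - (p \<bullet> v)\<^sup>2 - (p \<bullet> w)\<^sup>2"
    using n assms(4) by (simp add: inner_diff_left inner_diff_right inner_commute[of v p] inner_commute[of w p]
        inner_commute[of w v] power2_eq_square algebra_simps)
  finally show ?thesis by simp
qed

text \<open>Rotating \<open>v\<close> by a small angle (with sine \<open>20/101\<close>) in either sense inside a plane containing it,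
  at least one of the two results is transversal to \<open>p\<close>.\<close>

lemma transversal_direction:
  fixes p v :: "'a::euclidean_space"
  assumes d: "2 \<le> DIM('a)" and p: "norm p = 1" and v: "norm v = 1"
  shows "\<exists>v'. norm v' = 1 \<and> norm (v' - v) \<le> 1 / 5 \<and> \<bar>p \<bullet> v'\<bar> \<le> 99 / 100"
proof -
  obtain w0 where w0: "w0 \<noteq> 0" "orthogonal v w0" using orthogonal_to_vector_exists[OF d, of v] by blast
  define w where "w = w0 /\<^sub>R norm w0"
  have w: "norm w = 1" "v \<bullet> w = 0" using w0 by (auto simp: w_def orthogonal_def)
  have n: "v \<bullet> v = 1" "w \<bullet> w = 1" using v w by (simp_all add: norm_eq_1)
  \<comment> \<open>The Pythagorean triple 20, 99, 101 makes \<open>f s\<close> a unit vector with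
    rational coefficients for s = 1 and s = -1. Its squared distance to \<open>v\<close> is 4 / 101,
    just below 1 / 25.\<close>
  define f where "f s = (99/101) *\<^sub>R v + (s * (20/101)) *\<^sub>R w" for s :: real
  have f1: "norm (f s) = 1" if "s * s = 1" for s
  proof -
    have "f s \<bullet> f s = (99/101)\<^sup>2 + (20/101)\<^sup>2 * (s * s)"
      using n w(2) by (simp add: f_def inner_add_left inner_add_right inner_commute[of w v] power2_eq_square)
    then show ?thesis using that by (simp add: norm_eq_1 power2_eq_square)
  qed
  have f2: "norm (f s - v) \<le> 1 / 5" if "s * s = 1" for s
  proof -
    have "f s - v = (s * (20/101)) *\<^sub>R w - (2/101) *\<^sub>R v" by (simp add: f_def algebra_simps flip: scaleR_add_left)
    then have "(f s - v) \<bullet> (f s - v) = (20/101)\<^sup>2 * (s * s) + (2/101)\<^sup>2"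
      using n w(2) by (simp add: inner_diff_left inner_diff_right inner_commute[of w v] power2_eq_square)
    then have "(f s - v) \<bullet> (f s - v) \<le> (1/5)\<^sup>2" using that by (simp add: power2_eq_square)
    then have "(norm (f s - v))\<^sup>2 \<le> (1/5)\<^sup>2" unfolding power2_norm_eq_inner .
    then show ?thesis by (rule power2_le_imp_le) simp
  qed
  \<comment> \<open>Otherwise the two squares exceed \<open>2 * (99/100)\<^sup>2\<close> in total.
    The mixed terms cancel in the sum, which by Bessel's inequality is at most
    \<open>2 * (99/101)\<^sup>2\<close>.\<close>
  have "\<bar>p \<bullet> f 1\<bar> \<le> 99 / 100 \<or> \<bar>p \<bullet> f (-1)\<bar> \<le> 99 / 100"
  proof (rule ccontr)
    assume no: "\<not> ?thesis"
    have "(99/100)\<^sup>2 < \<bar>p \<bullet> f 1\<bar>\<^sup>2" "(99/100)\<^sup>2 < \<bar>p \<bullet> f (-1)\<bar>\<^sup>2" using no by (intro power_strict_mono; simp)+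
    then have "2 * (99/100)\<^sup>2 < (p \<bullet> f 1)\<^sup>2 + (p \<bullet> f (-1))\<^sup>2" by simp
    also have "\<dots> = 2 * ((99/101)\<^sup>2 * (p \<bullet> v)\<^sup>2 + (20/101)\<^sup>2 * (p \<bullet> w)\<^sup>2)"
      by (simp add: f_def inner_add_right power2_eq_square algebra_simps)
    also have "\<dots> \<le> 2 * ((99/101)\<^sup>2 * ((p \<bullet> v)\<^sup>2 + (p \<bullet> w)\<^sup>2))"
    proof -
      have "(20/101)\<^sup>2 * (p \<bullet> w)\<^sup>2 \<le> (99/101)\<^sup>2 * (p \<bullet> w)\<^sup>2"
        by (intro mult_right_mono) (simp_all add: power2_eq_square)
      then show ?thesis by (simp add: distrib_left)
    qed
    also have "\<dots> \<le> 2 * ((99/101)\<^sup>2 * 1)"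
      using bessel_two[OF p v w] by (intro mult_left_mono) auto
    finally show False by (simp add: power2_eq_square)
  qed
  then show ?thesis using f1[of 1] f2[of 1] f1[of "-1"] f2[of "-1"] by auto
qed

text \<open>The Gram matrix of \<open>p\<close> and \<open>q\<close> has smallest eigenvalue 1 - |p
  \<bullet> q|, which is at least 1 / 200.\<close>

lemma norm_transversal_ge:
  fixes p q :: "'a::real_inner"
  assumes "norm p = 1" "norm q = 1" "\<bar>p \<bullet> q\<bar> \<le> 199 / 200"
  shows "(\<alpha>\<^sup>2 + \<beta>\<^sup>2) / 200 \<le> (norm (\<alpha> *\<^sub>R p + \<beta> *\<^sub>R q))\<^sup>2"
proof -
  have n: "p \<bullet> p = 1" "q \<bullet> q = 1" using assms by (simp_all add: norm_eq_1)
  have eq: "(norm (\<alpha> *\<^sub>R p + \<beta> *\<^sub>R q))\<^sup>2 = \<alpha>\<^sup>2 + \<beta>\<^sup>2 + 2 * (\<alpha> * \<beta> * (p \<bullet> q))"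
    unfolding power2_norm_eq_inner using n by (simp add: inner_add_left inner_add_right inner_commute[of q p] power2_eq_square algebra_simps)
  have "2 * \<bar>\<alpha> * \<beta>\<bar> \<le> \<alpha>\<^sup>2 + \<beta>\<^sup>2"
    using sum_squares_bound[of "\<bar>\<alpha>\<bar>" "\<bar>\<beta>\<bar>"] by (simp add: abs_mult)
  then have "2 * \<bar>\<alpha> * \<beta>\<bar> * \<bar>p \<bullet> q\<bar> \<le> (\<alpha>\<^sup>2 + \<beta>\<^sup>2) * (199/200)"
    using assms(3) by (intro mult_mono) auto
  moreover have "- (2 * \<bar>\<alpha> * \<beta>\<bar> * \<bar>p \<bullet> q\<bar>) \<le> 2 * (\<alpha> * \<beta> * (p \<bullet> q))"
  proof -
    have "\<bar>2 * (\<alpha> * \<beta> * (p \<bullet> q))\<bar> = 2 * \<bar>\<alpha> * \<beta>\<bar> * \<bar>p \<bullet> q\<bar>" by (simp add: abs_mult)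
    then show ?thesis by linarith
  qed
  moreover have "s / 200 \<le> s + z" if "y \<le> s * (199 / 200)" "- y \<le> z" for s y z :: real using that by linarith
  ultimately show ?thesis unfolding eq by blast
qed

text \<open>The denominator is 3840 = 480 * 8: at least (\<rho> / 480) squared disjoint unit balls
  of good centres are found, and \<rho> = L / 8.\<close>

definition hit_const :: "'a::euclidean_space itself \<Rightarrow> real" where
  "hit_const _ = unit_ball_vol (DIM('a)) / 3840\<^sup>2"

text \<open>The unit balls around a two-dimensional lattice of points \<open>f ab\<close>, spanned
  by \<open>p\<close> and \<open>q\<close>, consist of centres whose sticks hit the given one.
  Transversality keeps these balls disjoint: spacing 30 gives squared distances at least 900 / 200,
  which exceeds 4. As \<open>q\<close> is nearly the direction \<open>v\<close> from
  \<open>x\<close> to \<open>c\<close>, the lattice lies near \<open>c\<close>.\<close>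

lemma volume_hitting:
  fixes x p q c v :: "'a::euclidean_space"
  assumes p: "norm p = 1" and q: "norm q = 1" and v: "norm v = 1"
    and pq: "\<bar>p \<bullet> q\<bar> \<le> 199 / 200" and qv: "norm (q - v) \<le> 41 / 200"
    and \<rho>: "8 \<le> \<rho>" and r: "\<rho> \<le> r" "r \<le> 3 * \<rho>" and c: "c = x + r *\<^sub>R v" and L: "L = 8 * \<rho>"
    and Am: "A \<in> sets lborel"
    and A: "\<And>x' t s. dist x' c < \<rho> \<Longrightarrow> \<bar>t\<bar> \<le> L / 2 \<Longrightarrow> \<bar>s\<bar> \<le> L / 2 \<Longrightarrow>
      dist (x + t *\<^sub>R p) (x' + s *\<^sub>R q) < 1 \<Longrightarrow> x' \<in> A"
  shows "ennreal (hit_const TYPE('a) * L\<^sup>2) \<le> emeasure lborel A"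
proof -
  define N where "N = nat \<lfloor>\<rho> / 480\<rfloor>"
  define f where "f ab = x + (30 * real (fst ab)) *\<^sub>R p + (r + 30 * real (snd ab)) *\<^sub>R q" for ab
  let ?I = "{..N} \<times> {..N}"
  have "real N = of_int \<lfloor>\<rho> / 480\<rfloor>" using \<rho> by (simp add: N_def)
  then have N: "real N \<le> \<rho> / 480" "\<rho> / 480 \<le> real N + 1" using floor_correct[of "\<rho> / 480"] by linarith+
  have sep: "2 \<le> dist (f ab) (f ab')" if "ab \<noteq> ab'" for ab ab'
  proof -
    let ?\<alpha> = "30 * (real (fst ab) - real (fst ab'))" and ?\<beta> = "30 * (real (snd ab) - real (snd ab'))"
    have one: "1 \<le> (real a - real a')\<^sup>2" if "a \<noteq> a'" for a a' :: nat
    proof -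
      have "1 \<le> \<bar>real a - real a'\<bar>" using that by linarith
      then have "1\<^sup>2 \<le> \<bar>real a - real a'\<bar>\<^sup>2" by (intro power_mono) auto
      then show ?thesis by simp
    qed
    have "1 \<le> (real (fst ab) - real (fst ab'))\<^sup>2 + (real (snd ab) - real (snd ab'))\<^sup>2"
    proof (cases "fst ab = fst ab'")
      case True
      then have "snd ab \<noteq> snd ab'" using that by (auto simp: prod_eq_iff)
      then show ?thesis using one[of "snd ab" "snd ab'"] by (simp add: add_increasing)
    next
      case False
      then show ?thesis using one[of "fst ab" "fst ab'"] by (simp add: add_increasing2)
    qed
    moreover have "?\<alpha>\<^sup>2 = 900 * (real (fst ab) - real (fst ab'))\<^sup>2" "?\<beta>\<^sup>2 = 900 * (real (snd ab) - real (snd ab'))\<^sup>2"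
      by (subst power_mult_distrib, simp)+
    ultimately have "900 \<le> ?\<alpha>\<^sup>2 + ?\<beta>\<^sup>2" by linarith
    then have "900 / 200 \<le> (?\<alpha>\<^sup>2 + ?\<beta>\<^sup>2) / 200" by (rule divide_right_mono) simp
    also have "\<dots> \<le> (norm (?\<alpha> *\<^sub>R p + ?\<beta> *\<^sub>R q))\<^sup>2" by (rule norm_transversal_ge[OF p q pq])
    finally have "900 / 200 \<le> (norm (?\<alpha> *\<^sub>R p + ?\<beta> *\<^sub>R q))\<^sup>2" .
    moreover have "f ab - f ab' = ?\<alpha> *\<^sub>R p + ?\<beta> *\<^sub>R q" by (simp add: f_def algebra_simps)
    ultimately have "2\<^sup>2 \<le> (dist (f ab) (f ab'))\<^sup>2" by (simp add: dist_norm)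
    then show ?thesis by (rule power2_le_imp_le) simp
  qed
  then have inj: "inj_on f ?I" unfolding inj_on_def using dist_self by (metis not_numeral_le_zero)
  have sub: "(\<Union>t\<in>f ` ?I. ball t 1) \<subseteq> A"
  proof
    fix x' assume "x' \<in> (\<Union>t\<in>f ` ?I. ball t 1)"
    then obtain a b where ab: "a \<le> N" "b \<le> N" "dist (f (a, b)) x' < 1" by auto
    have a: "30 * real a \<le> \<rho> / 16" "30 * real b \<le> \<rho> / 16" using ab N by linarith+
    show "x' \<in> A"
    \<comment> \<open>Going \<open>30 * real a\<close> along \<open>p\<close> from \<open>x\<close>,
      and \<open>r + 30 * real b\<close> backwards along \<open>q\<close> from \<open>x'\<close>,
      leads to points as close as \<open>f (a, b)\<close> and \<open>x'\<close>. The centre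
      \<open>x'\<close> is within (1/8 + 123/200) \<rho> + 1 of \<open>c\<close>, which is less than
      \<rho> because 1 \<le> \<rho> / 8.\<close>
    proof (rule A[of x' "30 * real a" "- (r + 30 * real b)"])
      have "f (a, b) - c = (30 * real a) *\<^sub>R p + (30 * real b) *\<^sub>R q + r *\<^sub>R (q - v)"
        by (simp add: f_def c algebra_simps)
      then have "norm (f (a, b) - c) \<le> norm ((30 * real a) *\<^sub>R p) + norm ((30 * real b) *\<^sub>R q) + norm (r *\<^sub>R (q - v))"
        by (metis (no_types, lifting) add_right_mono norm_triangle_ineq order_trans)
      also have "\<dots> \<le> \<rho> / 16 + \<rho> / 16 + 3 * \<rho> * (41 / 200)"
      proof (intro add_mono)
        have "r * norm (q - v) \<le> 3 * \<rho> * (41 / 200)" using r \<rho> qv by (intro mult_mono) auto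
        then show "norm (r *\<^sub>R (q - v)) \<le> 3 * \<rho> * (41 / 200)" using r \<rho> by simp
      qed (use a p q in auto)
      finally have "dist (f (a, b)) c \<le> \<rho> / 16 + \<rho> / 16 + 3 * \<rho> * (41 / 200)" by (simp add: dist_norm)
      then show "dist x' c < \<rho>" using ab(3) \<rho> dist_triangle[of x' c "f (a, b)"] by (simp add: dist_commute)
      show "\<bar>30 * real a\<bar> \<le> L / 2" using a \<rho> by (simp add: L)
      show "\<bar>- (r + 30 * real b)\<bar> \<le> L / 2" using a \<rho> r by (simp add: L)
      have eq: "x + (30 * real a) *\<^sub>R p - (x' + (- (r + 30 * real b)) *\<^sub>R q) = f (a, b) - x'"
        by (simp add: f_def algebra_simps)
      show "dist (x + (30 * real a) *\<^sub>R p) (x' + (- (r + 30 * real b)) *\<^sub>R q) < 1"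
        unfolding dist_norm eq using ab(3) by (simp only: dist_norm)
    qed
  qed
  have "hit_const TYPE('a) * L\<^sup>2 = (\<rho> / 480) * (\<rho> / 480) * unit_ball_vol (DIM('a))"
    by (simp add: hit_const_def L power2_eq_square)
  also have "\<dots> \<le> (real N + 1) * (real N + 1) * unit_ball_vol (DIM('a))"
    using N \<rho> by (intro mult_right_mono mult_mono) auto
  also have "\<dots> = measure lborel (\<Union>t\<in>f ` ?I. ball t 1)"
  proof -
    have "2 * 1 \<le> dist s t" if st: "s \<in> f ` ?I" "t \<in> f ` ?I" "s \<noteq> t" for s t
    proof -
      obtain ab ab' where "s = f ab" "t = f ab'" using st by blast
      then show ?thesis using sep[of ab ab'] st(3) by auto
    qed
    then have "measure lborel (\<Union>t\<in>f ` ?I. ball t 1) = card (f ` ?I) * (unit_ball_vol (DIM('a)) * 1 ^ DIM('a))"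
      by (intro measure_separated_balls) auto
    then show ?thesis using inj by (simp add: card_image card_cartesian_product algebra_simps)
  qed
  finally have "ennreal (hit_const TYPE('a) * L\<^sup>2) \<le> ennreal (measure lborel (\<Union>t\<in>f ` ?I. ball t 1))"
    by (rule ennreal_leI)
  also have "\<dots> = emeasure lborel (\<Union>t\<in>f ` ?I. ball t 1)"
  proof (rule emeasure_eq_ennreal_measure[symmetric])
    have "bounded (\<Union>t\<in>f ` ?I. ball t 1)" by (intro bounded_UN) auto
    from emeasure_bounded_finite[OF this]
    show "emeasure lborel (\<Union>t\<in>f ` ?I. ball t 1) \<noteq> top" by simp
  qed
  also have "\<dots> \<le> emeasure lborel A" by (intro emeasure_mono sub Am)
  finally show ?thesis .
qed

text \<open>The midpoint of the two axis points is within 1 of both axes.\<close>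

lemma sticks_meet:
  fixes x x' :: "'a::euclidean_space"
  assumes L: "0 \<le> L" and t: "\<bar>t\<bar> \<le> L / 2" and s: "\<bar>s\<bar> \<le> L / 2"
    and d: "dist (x + t *\<^sub>R p) (x' + s *\<^sub>R q) \<le> 2"
  shows "stick L x p \<inter> stick L x' q \<noteq> {}"
proof -
  let ?m = "midpoint (x + t *\<^sub>R p) (x' + s *\<^sub>R q)"
  have "dist ?m (x + t *\<^sub>R p) \<le> 1" "dist ?m (x' + s *\<^sub>R q) \<le> 1" using d by (simp_all add: dist_midpoint)
  then have "?m \<in> stick L x p" "?m \<in> stick L x' q" unfolding stick_iff[OF L] using t s by blast+
  then show ?thesis by blast
qed

lemma finite_net:
  fixes S :: "'b::heine_borel set"
  assumes "bounded S" "0 < h"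
  shows "\<exists>d N. \<forall>z\<in>S. \<exists>i<(N::nat). dist z (d i) < h"
proof -
  have "compact (closure S)" using assms(1) by simp
  then obtain k where k: "finite k" "closure S \<subseteq> (\<Union>x\<in>k. ball x h)"
    using assms(2) unfolding compact_eq_totally_bounded by blast
  obtain f where f: "bij_betw f {0..<card k} k" using ex_bij_betw_nat_finite[OF k(1)] by blast
  have "\<exists>i<card k. dist z (f i) < h" if "z \<in> S" for z
  proof -
    have "z \<in> (\<Union>x\<in>k. ball x h)" using that k(2) closure_subset by blast
    then obtain x where "x \<in> k" "dist z x < h" by (auto simp: dist_commute)
    moreover have "k = f ` {0..<card k}" using f by (simp add: bij_betw_def)
    ultimately show ?thesis by (metis (no_types, lifting) atLeastLessThan_iff imageE)
  qed
  then show ?thesis by blast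
qed

section \<open>Percolation on the planar grid of balls\<close>

locale spread_direction = direction +
  assumes dim2: "2 \<le> DIM('a)"
    and cap: "\<And>r. 0 < r \<Longrightarrow> \<exists>c>0. \<forall>u\<in>sphere (0::'a) 1. c \<le> measure \<Theta> (sphere 0 1 \<inter> ball u r)"
begin

text \<open>The radius 1 / 200 is the margin between 99 / 100, the transversality of the chosen
  direction, and 199 / 200, the one demanded by \<open>volume_hitting\<close>.\<close>

definition cap_const :: real where
  "cap_const = (SOME c. 0 < c \<and> (\<forall>u\<in>sphere (0::'a) 1. c \<le> measure \<Theta> (sphere 0 1 \<inter> ball u (1/200))))"

lemma cap_const: "0 < cap_const" "u \<in> sphere (0::'a) 1 \<Longrightarrow> cap_const \<le> measure \<Theta> (sphere 0 1 \<inter> ball u (1/200))"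
proof -
  have "\<exists>c. 0 < c \<and> (\<forall>u\<in>sphere (0::'a) 1. c \<le> measure \<Theta> (sphere 0 1 \<inter> ball u (1/200)))"
    using cap[of "1/200"] by auto
  from someI_ex[OF this]
  show "0 < cap_const" "u \<in> sphere (0::'a) 1 \<Longrightarrow> cap_const \<le> measure \<Theta> (sphere 0 1 \<inter> ball u (1/200))"
    unfolding cap_const_def by auto
qed

text \<open>Directions \<open>q\<close> within 1 / 200 of the transversal \<open>v'\<close> satisfy
  both conditions of \<open>volume_hitting\<close>: 99/100 + 1/200 = 199/200 and 1/5 + 1/200 =
  41/200. The volume for each of them is integrated over this cap, whose mass is at least
  \<open>cap_const\<close>.\<close>

lemma hit_mass:
  fixes x p c :: 'a
  assumes u: "0 \<le> u" and \<rho>: "8 \<le> \<rho>" and L: "L = 8 * \<rho>" and p: "norm p = 1"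
    and xc: "\<rho> \<le> dist x c" "dist x c \<le> 3 * \<rho>"
    and Am: "A \<in> sets (stick_intensity \<Theta> u)"
    and A: "\<And>x' q t s. norm q = 1 \<Longrightarrow> dist x' c < \<rho> \<Longrightarrow> \<bar>t\<bar> \<le> L / 2 \<Longrightarrow> \<bar>s\<bar> \<le> L / 2 \<Longrightarrow>
      dist (x + t *\<^sub>R p) (x' + s *\<^sub>R q) < 1 \<Longrightarrow> (x', q) \<in> A"
  shows "ennreal (u * (hit_const TYPE('a) * L\<^sup>2 * cap_const)) \<le> emeasure (stick_intensity \<Theta> u) A"
proof -
  define r where "r = dist x c"
  define v where "v = (c - x) /\<^sub>R r"
  have r: "\<rho> \<le> r" "r \<le> 3 * \<rho>" "0 < r" using xc \<rho> by (auto simp: r_def)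
  have v: "norm v = 1" "c = x + r *\<^sub>R v" using r(3) by (auto simp: v_def r_def dist_norm norm_minus_commute)
  obtain v' where v': "norm v' = 1" "norm (v' - v) \<le> 1 / 5" "\<bar>p \<bullet> v'\<bar> \<le> 99 / 100"
    using transversal_direction[OF dim2 p v(1)] by blast
  let ?D = "sphere 0 1 \<inter> ball v' (1/200)"
  have D: "?D \<in> sets \<Theta>" unfolding sets_\<Theta> by (auto simp: sets_restrict_space)
  have g0: "0 \<le> hit_const TYPE('a) * L\<^sup>2" by (simp add: hit_const_def)
  have slice: "ennreal (hit_const TYPE('a) * L\<^sup>2) \<le> emeasure lborel ((\<lambda>x. (x, q)) -` A)" if q: "q \<in> ?D" for q
  proof (rule volume_hitting[OF p _ v(1) _ _ \<rho> r(1,2) v(2) L])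
    have n: "norm (q - v') \<le> 1/200" using q by (simp add: dist_norm norm_minus_commute)
    show "norm q = 1" using q by simp
    have "p \<bullet> q = p \<bullet> v' + p \<bullet> (q - v')" by (simp add: inner_diff_right)
    moreover have "\<bar>p \<bullet> (q - v')\<bar> \<le> 1/200" using Cauchy_Schwarz_ineq2[of p "q - v'"] n p by simp
    ultimately show "\<bar>p \<bullet> q\<bar> \<le> 199 / 200" using v'(3) by linarith
    show "norm (q - v) \<le> 41 / 200" using norm_triangle_ineq[of "q - v'" "v' - v"] n v'(2) by simp
    show "(\<lambda>x. (x, q)) -` A \<in> sets lborel" using Am unfolding stick_intensity_def by (intro sets_Pair2) simp
    show "x' \<in> (\<lambda>x. (x, q)) -` A" if "dist x' c < \<rho>" "\<bar>t\<bar> \<le> L / 2" "\<bar>s\<bar> \<le> L / 2" "dist (x + t *\<^sub>R p) (x' + s *\<^sub>R q) < 1" for x' t s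
      using A[of q x' t s] that q by simp
  qed
  have "ennreal (hit_const TYPE('a) * L\<^sup>2 * cap_const) \<le> ennreal (hit_const TYPE('a) * L\<^sup>2 * measure \<Theta> ?D)"
    using cap_const(2)[of v'] v'(1) g0 by (intro ennreal_leI mult_left_mono) auto
  also have "\<dots> = (\<integral>\<^sup>+q. ennreal (hit_const TYPE('a) * L\<^sup>2) * indicator ?D q \<partial>\<Theta>)"
    using D g0 by (subst nn_integral_cmult_indicator) (auto simp: ennreal_mult \<Theta>.emeasure_eq_measure)
  also have "\<dots> \<le> (\<integral>\<^sup>+q. emeasure lborel ((\<lambda>x. (x, q)) -` A) \<partial>\<Theta>)"
    using slice by (intro nn_integral_mono) (auto simp: indicator_def)
  finally have "ennreal u * ennreal (hit_const TYPE('a) * L\<^sup>2 * cap_const) \<le> emeasure (stick_intensity \<Theta> u) A"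
    unfolding emeasure_intensity[OF Am] by (rule mult_left_mono) simp
  then show ?thesis using u by (simp add: ennreal_mult')
qed

lemma emeasure_intensity_slab_finite:
  assumes "A \<in> sets (stick_intensity \<Theta> u)" "A \<subseteq> ball c \<rho> \<times> UNIV"
  shows "emeasure (stick_intensity \<Theta> u) A < \<infinity>"
proof -
  have "emeasure (stick_intensity \<Theta> u) A \<le> ennreal u * emeasure lborel (ball c \<rho>)"
    using assms by (intro emeasure_intensity_le emeasure_mono) auto
  also have "\<dots> < \<infinity>" using emeasure_lborel_ball_finite[of c \<rho>] by (simp add: ennreal_mult_less_top)
  finally show ?thesis .
qed

lemma AE_percolates:
  assumes P: "poisson_point_process P (stick_intensity \<Theta> u) (\<lambda>\<omega>. \<omega>)"
    and u: "0 < u" and L: "64 \<le> L" and large: "ln 324 \<le> u * (hit_const TYPE('a) * L\<^sup>2 * cap_const)"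
  shows "AE \<omega> in P. percolates (covered_set L \<omega>)"
proof -
  let ?\<mu> = "stick_intensity \<Theta> u"
  interpret ppp P ?\<mu> by (rule ppp.intro[OF P])
  \<comment> \<open>With L = 8 \<rho> a stick reaches L / 2 = 4 \<rho> from its centre, beyond the
    largest distance 3 \<rho> from a point of one ball to the centre of an adjacent one. L \<ge> 64
    makes unit distances small against \<rho>.\<close>
  define \<rho> where "\<rho> = L / 8"
  have \<rho>: "8 \<le> \<rho>" "L = 8 * \<rho>" using L by (auto simp: \<rho>_def)
  have L0: "0 \<le> L" using L by simp
  obtain e1 e2 :: 'a where e: "e1 \<in> Basis" "e2 \<in> Basis" "e1 \<noteq> e2"
  proof -
    have "\<not> card (Basis :: 'a set) \<le> Suc 0" using dim2 by simp
    then show thesis using that card_le_Suc0_iff_eq[OF finite_Basis] by blast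
  qed
  have ee: "e1 \<bullet> e1 = 1" "e2 \<bullet> e2 = 1" "e1 \<bullet> e2 = 0" "e2 \<bullet> e1 = 0" "norm e1 = 1" "norm e2 = 1"
    using e by (auto simp: inner_Basis)
  define ctr where "ctr v = (2 * \<rho> * real (fst v)) *\<^sub>R e1 + (2 * \<rho> * real (snd v)) *\<^sub>R e2" for v :: "nat \<times> nat"
  have ctr1: "ctr v \<bullet> e1 = 2 * \<rho> * real (fst v)" "ctr v \<bullet> e2 = 2 * \<rho> * real (snd v)" for v
    by (simp_all add: ctr_def inner_add_left ee)
  have ctr_ge: "2 * \<rho> \<le> dist (ctr v) (ctr w)" if "v \<noteq> w" for v w
  proof -
    have one: "2 * \<rho> \<le> \<bar>2 * \<rho> * real a - 2 * \<rho> * real b\<bar>" if "a \<noteq> b" for a b :: nat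
    proof -
      have "2 * \<rho> * 1 \<le> 2 * \<rho> * \<bar>real a - real b\<bar>" using that \<rho> by (intro mult_left_mono) linarith+
      also have "\<dots> = \<bar>2 * \<rho> * real a - 2 * \<rho> * real b\<bar>" using \<rho> by (simp add: abs_mult flip: right_diff_distrib)
      finally show ?thesis by simp
    qed
    have i1: "\<bar>(ctr v - ctr w) \<bullet> b\<bar> \<le> dist (ctr v) (ctr w)" if "b \<in> Basis" for b
      using Basis_le_norm[OF that, of "ctr v - ctr w"] by (simp add: dist_norm)
    show ?thesis
    proof (cases "fst v = fst w")
      case True
      then have "snd v \<noteq> snd w" using that by (auto simp: prod_eq_iff)
      then show ?thesis using one[of "snd v" "snd w"] i1[OF e(2)] by (simp add: inner_diff_left ctr1)
    next
      case False
      then show ?thesis using one[of "fst v" "fst w"] i1[OF e(1)] by (simp add: inner_diff_left ctr1)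
    qed
  qed
  have ctr_nbr: "dist (ctr v) (ctr w) = 2 * \<rho>" if "nbr v w" for v w
  proof -
    have "ctr v - ctr w = (2 * \<rho>) *\<^sub>R e1 \<or> ctr v - ctr w = - ((2 * \<rho>) *\<^sub>R e1) \<or>
        ctr v - ctr w = (2 * \<rho>) *\<^sub>R e2 \<or> ctr v - ctr w = - ((2 * \<rho>) *\<^sub>R e2)"
      using that unfolding nbr_def ctr_def by (auto simp: algebra_simps)
    then show ?thesis using \<rho> ee unfolding dist_norm by auto
  qed
  define S where "S v = ball (ctr v) \<rho> \<times> sphere (0::'a) 1" for v
  have S_eq: "S v = (ball (ctr v) \<rho> \<times> UNIV) \<inter> space ?\<mu>" for v by (auto simp: S_def space_intensity)
  have Sm: "S v \<in> sets ?\<mu>" for v unfolding S_eq by (intro open_in_intensity open_Times) auto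
  have Sdisj: "S v \<inter> S w = {}" if "v \<noteq> w" for v w
  proof (rule ccontr)
    assume "S v \<inter> S w \<noteq> {}"
    then obtain y where "dist (ctr v) y < \<rho>" "dist (ctr w) y < \<rho>" by (auto simp: S_def)
    then show False using ctr_ge[OF that] dist_triangle2[of "ctr v" "ctr w" y] by linarith
  qed
  \<comment> \<open>Within a cell an axis point moves by at most 1 / 2, so axis points less than 1
    apart stay within 1/2 + 1 + 1/2 = 2, where the sticks still meet.\<close>
  define h where "h = 1 / (8 * L)"
  have h: "0 < h" "(1 + L / 2) * (2 * h) \<le> 1 / 2" using L by (auto simp: h_def field_simps)
  have "\<forall>v. \<exists>d N. \<forall>z\<in>S v. \<exists>i<(N::nat). dist z (d i) < h"
  proof
    fix v
    have "bounded (S v)" unfolding S_def by (intro bounded_Times bounded_ball bounded_sphere)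
    then show "\<exists>d N. \<forall>z\<in>S v. \<exists>i<(N::nat). dist z (d i) < h" using h by (intro finite_net) auto
  qed
  from choice[OF this] obtain d where "\<forall>v. \<exists>N. \<forall>z\<in>S v. \<exists>i<(N::nat). dist z (d v i) < h" by blast
  from choice[OF this] obtain N where dN: "\<And>v z. z \<in> S v \<Longrightarrow> \<exists>i<(N v::nat). dist z (d v i) < h" by blast
  define Cl where "Cl Q = cell (d (fst Q)) h (S (fst Q)) (snd Q)" for Q :: "(nat \<times> nat) \<times> nat"
  have Clm: "Cl Q \<in> sets ?\<mu>" for Q unfolding Cl_def by (intro cell_in_sets Sm open_in_intensity)
  have ClS: "Cl Q \<subseteq> S (fst Q)" for Q by (auto simp: Cl_def cell_def)
  have Cldisj: "disjoint_family_on Cl I" for I :: "((nat \<times> nat) \<times> nat) set"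
    unfolding disjoint_family_on_def
  proof (intro ballI impI)
    fix Q Q' :: "(nat \<times> nat) \<times> nat" assume "Q \<noteq> Q'"
    then consider "fst Q \<noteq> fst Q'" | "fst Q = fst Q'" "snd Q \<noteq> snd Q'" by (auto simp: prod_eq_iff)
    then show "Cl Q \<inter> Cl Q' = {}"
    proof cases
      case 1 then show ?thesis using ClS[of Q] ClS[of Q'] Sdisj by blast
    next
      case 2 then show ?thesis using disjoint_cell[of "d (fst Q)" h "S (fst Q)"]
        unfolding Cl_def disjoint_family_on_def by auto
    qed
  qed
  have Clcov: "\<exists>i<N v. z \<in> Cl (v, i)" if z: "z \<in> S v" for v z
  proof -
    obtain i where "i < N v" "dist z (d v i) < h" using dN[OF z] by blast
    then obtain j where "j \<le> i" "z \<in> cell (d v) h (S v) j" using cell_cover[OF z] by blast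
    then show ?thesis using \<open>i < N v\<close> by (intro exI[of _ j]) (auto simp: Cl_def)
  qed
  have Clfin: "emeasure ?\<mu> A < \<infinity>" if "A \<in> sets ?\<mu>" "A \<subseteq> S v" for A v
    using that by (intro emeasure_intensity_slab_finite[where c = "ctr v" and \<rho> = \<rho>]) (auto simp: S_def)
  let ?st = "\<lambda>z. stick L (fst z) (snd z)"
  \<comment> \<open>Only nonempty cells are kept, so that each supplies a stick from which the
    hitting bound can start.\<close>
  define B where "B v = {v} \<times> {i. i < N v \<and> Cl (v, i) \<noteq> {}}" for v
  define occ where "occ \<omega> = {Q. snd Q < N (fst Q) \<and> \<omega> \<inter> Cl Q \<noteq> {}}" for \<omega>
  \<comment> \<open>Universal in both sticks: whichever points occupy the two cells, their sticks
    overlap.\<close>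
  define a :: "(nat \<times> nat) \<times> nat \<Rightarrow> (nat \<times> nat) \<times> nat \<Rightarrow> bool" where "a Q Q' \<longleftrightarrow> (\<forall>z\<in>Cl Q. \<forall>z'\<in>Cl Q'. ?st z \<inter> ?st z' \<noteq> {})" for Q Q' :: "(nat \<times> nat) \<times> nat"
  have Bf: "finite (B v)" for v by (auto simp: B_def)
  have Bocc: "Q \<in> occ \<omega> \<longleftrightarrow> \<omega> \<inter> Cl Q \<noteq> {}" if "Q \<in> B v" for Q v \<omega>
    using that by (auto simp: B_def occ_def)
  \<comment> \<open>The cells with \<open>R\<close> contain all centres and directions in the ball
    of \<open>w\<close> that hit the given stick. Their union therefore has mass at least ln 324 and
    is vacant with probability at most 1 / 324.\<close>
  have key: "prob {\<omega>\<in>space P. occ \<omega> \<inter> B w \<inter> {Q'. R Q'} = {}} \<le> 1 / 324"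
    if zx: "norm p = 1" "\<rho> \<le> dist x (ctr w)" "dist x (ctr w) \<le> 3 * \<rho>"
      and R: "\<And>Q' x' q t s. Q' \<in> B w \<Longrightarrow> (x', q) \<in> Cl Q' \<Longrightarrow> \<bar>t\<bar> \<le> L / 2 \<Longrightarrow> \<bar>s\<bar> \<le> L / 2 \<Longrightarrow>
        dist (x + t *\<^sub>R p) (x' + s *\<^sub>R q) < 1 \<Longrightarrow> R Q'" for x p w R
  proof -
    define U where "U = (\<Union>Q'\<in>{Q'\<in>B w. R Q'}. Cl Q')"
    have Um: "U \<in> sets ?\<mu>" unfolding U_def using Bf Clm by (intro sets.finite_UN) auto
    have US: "U \<subseteq> S w"
    proof -
      have "Cl Q' \<subseteq> S w" if "Q' \<in> B w" for Q' using ClS[of Q'] that by (auto simp: B_def)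
      then show ?thesis unfolding U_def by blast
    qed
    have fin: "emeasure ?\<mu> U < \<infinity>" using Um US by (rule Clfin)
    have "ennreal (u * (hit_const TYPE('a) * L\<^sup>2 * cap_const)) \<le> emeasure ?\<mu> U"
    proof (rule hit_mass[OF less_imp_le[OF u] \<rho> zx Um])
      fix x' q :: 'a and t s
      assume q: "norm q = 1" "dist x' (ctr w) < \<rho>" and ts: "\<bar>t\<bar> \<le> L / 2" "\<bar>s\<bar> \<le> L / 2" "dist (x + t *\<^sub>R p) (x' + s *\<^sub>R q) < 1"
      have "(x', q) \<in> S w" using q by (simp add: S_def dist_commute)
      then obtain i where i: "i < N w" "(x', q) \<in> Cl (w, i)" using Clcov by blast
      then have iB: "(w, i) \<in> B w" by (auto simp: B_def)
      then have "R (w, i)" using R[OF iB i(2) ts] by blast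
      then show "(x', q) \<in> U" unfolding U_def using iB i(2) by blast
    qed
    then have "ennreal (ln 324) \<le> ennreal (measure ?\<mu> U)"
      using large fin by (simp add: emeasure_eq_ennreal_measure less_top)
    then have m: "ln 324 \<le> measure ?\<mu> U" by (subst (asm) ennreal_le_iff) auto
    have "{\<omega>\<in>space P. occ \<omega> \<inter> B w \<inter> {Q'. R Q'} = {}} = {\<omega>\<in>space P. \<omega> \<inter> U = {}}"
    proof (rule Collect_cong, rule conj_cong[OF refl])
      fix \<omega>
      have "occ \<omega> \<inter> B w \<inter> {Q'. R Q'} = {} \<longleftrightarrow> (\<forall>Q'\<in>B w. R Q' \<longrightarrow> Q' \<notin> occ \<omega>)" by blast
      also have "\<dots> \<longleftrightarrow> (\<forall>Q'\<in>B w. R Q' \<longrightarrow> \<omega> \<inter> Cl Q' = {})" using Bocc by blast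
      also have "\<dots> \<longleftrightarrow> \<omega> \<inter> U = {}" unfolding U_def by blast
      finally show "(occ \<omega> \<inter> B w \<inter> {Q'. R Q'} = {}) = (\<omega> \<inter> U = {})" .
    qed
    then have "prob {\<omega>\<in>space P. occ \<omega> \<inter> B w \<inter> {Q'. R Q'} = {}} = exp (- measure ?\<mu> U)"
      using prob_empty[OF Um fin] by simp
    also have "\<dots> \<le> exp (- ln 324)" using m by simp
    also have "\<dots> = 1 / 324" by (simp add: exp_minus)
    finally show ?thesis .
  qed
  have "AE \<omega> in P. \<exists>Q\<in>occ \<omega>. \<forall>k. \<exists>v Q'. k \<le> fst v \<and> Q' \<in> occ \<omega> \<inter> B v \<and> joined a (occ \<omega>) Q Q'"
  proof (rule AE_infinite_cluster[where \<epsilon> = "1 / 324"])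
    show "finite (B v)" for v by (rule Bf)
    show "{\<omega>\<in>space P. Q \<in> occ \<omega>} \<in> events" for Q
      unfolding occ_def using sets.sets_Collect_neg[OF empty_event[OF Clm[of Q]]]
      by (cases "snd Q < N (fst Q)") simp_all
    show "prob {\<omega>\<in>space P. occ \<omega> \<inter> B w = {}} \<le> 1 / 324" for w
    proof -
      \<comment> \<open>That a ball contains the centre of some stick is an instance of the hitting
        bound, for a fictitious stick in direction \<open>e1\<close> centred at an adjacent grid
        point.\<close>
      have nb: "nbr (fst w + 1, snd w) w" by (simp add: nbr_def)
      have "prob {\<omega>\<in>space P. occ \<omega> \<inter> B w \<inter> {Q'. True} = {}} \<le> 1 / 324"
        by (rule key[of e1 "ctr (fst w + 1, snd w)"]) (use ee ctr_nbr[OF nb] \<rho> in auto)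
      then show ?thesis by simp
    qed
    show "prob {\<omega>\<in>space P. occ \<omega> \<inter> B w \<inter> {Q'. a Q Q'} = {}} \<le> 1 / 324" if vw: "nbr v w" "Q \<in> B v" for v w Q
    proof -
      obtain z0 where z0: "z0 \<in> Cl Q" using vw(2) by (auto simp: B_def)
      have z0S: "z0 \<in> S v" using z0 ClS[of Q] vw(2) by (auto simp: B_def)
      then have z0d: "dist (fst z0) (ctr v) < \<rho>" "norm (snd z0) = 1" by (auto simp: S_def dist_commute)
      have 1: "\<rho> \<le> dist (fst z0) (ctr w)" "dist (fst z0) (ctr w) \<le> 3 * \<rho>"
        using z0d(1) ctr_nbr[OF vw(1)] dist_triangle[of "ctr v" "ctr w" "fst z0"] dist_triangle[of "fst z0" "ctr w" "ctr v"]
        by (simp_all add: dist_commute)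
      show ?thesis
      proof (rule key[OF z0d(2) 1])
        fix Q' x' q t s
        assume Q': "Q' \<in> B w" "(x', q) \<in> Cl Q'" and ts: "\<bar>t\<bar> \<le> L / 2" "\<bar>s\<bar> \<le> L / 2"
          and close: "dist (fst z0 + t *\<^sub>R snd z0) (x' + s *\<^sub>R q) < 1"
        show "a Q Q'" unfolding a_def
        proof (intro ballI)
          fix z z' assume z: "z \<in> Cl Q" "z' \<in> Cl Q'"
          have half: "(1 + L / 2) * e \<le> 1 / 2" if "e < 2 * h" for e
            using mult_left_mono[of e "2 * h" "1 + L / 2"] that h(2) L by linarith
          have "dist (fst z + t *\<^sub>R snd z) (fst z0 + t *\<^sub>R snd z0) \<le> 1 / 2"
            using axis_point_dist[OF ts(1), of z z0] half[of "dist z z0"] cell_diameter[of z _ h _ _ z0] z(1) z0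
            unfolding Cl_def by (meson order_trans)
          moreover have "dist (x' + s *\<^sub>R q) (fst z' + s *\<^sub>R snd z') \<le> 1 / 2"
            using axis_point_dist[OF ts(2), of "(x', q)" z'] half[of "dist (x', q) z'"] cell_diameter[of "(x', q)" _ h _ _ z'] z(2) Q'(2)
            unfolding Cl_def fst_conv snd_conv by (meson order_trans)
          ultimately have "dist (fst z + t *\<^sub>R snd z) (fst z' + s *\<^sub>R snd z') \<le> 2"
            using close dist_triangle[of "fst z + t *\<^sub>R snd z" "fst z' + s *\<^sub>R snd z'" "fst z0 + t *\<^sub>R snd z0"]
              dist_triangle[of "fst z0 + t *\<^sub>R snd z0" "fst z' + s *\<^sub>R snd z'" "x' + s *\<^sub>R q"] by linarith
          then show "?st z \<inter> ?st z' \<noteq> {}" by (rule sticks_meet[OF L0 ts])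
        qed
      qed
    qed
    show "prob {\<omega>\<in>space P. \<forall>v\<in>V. occ \<omega> \<inter> B v = Y v} = (\<Prod>v\<in>V. prob {\<omega>\<in>space P. occ \<omega> \<inter> B v = Y v})" if V: "finite V" for V Y
    proof (cases "\<forall>v\<in>V. Y v \<subseteq> B v")
      case False
      then obtain v0 where v0: "v0 \<in> V" "\<not> Y v0 \<subseteq> B v0" by blast
      then have e1: "{\<omega>\<in>space P. \<forall>v\<in>V. occ \<omega> \<inter> B v = Y v} = {}" "{\<omega>\<in>space P. occ \<omega> \<inter> B v0 = Y v0} = {}" by blast+
      have "prob {\<omega>\<in>space P. occ \<omega> \<inter> B v0 = Y v0} = 0" unfolding e1(2) by simp
      then have "(\<Prod>v\<in>V. prob {\<omega>\<in>space P. occ \<omega> \<inter> B v = Y v}) = 0"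
        using v0(1) V by (intro prod_zero) (auto intro!: bexI[of _ v0])
      then show ?thesis unfolding e1(1) by simp
    next
      case True
      \<comment> \<open>\<open>e Q\<close> demands that the cell be vacant. Prescribed traces become
        vacancy patterns of disjoint cells, which are independent.\<close>
      define e where "e Q \<longleftrightarrow> Q \<notin> Y (fst Q)" for Q :: "(nat \<times> nat) \<times> nat"
      have fstB: "fst Q = v" if "Q \<in> B v" for Q v using that by (auto simp: B_def)
      have eq: "occ \<omega> \<inter> B v = Y v \<longleftrightarrow> (\<forall>Q\<in>B v. (\<omega> \<inter> Cl Q = {}) = e Q)" if v: "v \<in> V" for v \<omega>
      proof -
        have "occ \<omega> \<inter> B v = Y v \<longleftrightarrow> (\<forall>Q\<in>B v. Q \<in> occ \<omega> \<longleftrightarrow> Q \<in> Y v)" using True v by blast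
        also have "\<dots> \<longleftrightarrow> (\<forall>Q\<in>B v. (\<omega> \<inter> Cl Q = {}) = e Q)"
          using Bocc[of _ v \<omega>] fstB[of _ v] unfolding e_def by (intro ball_cong refl) auto
        finally show ?thesis .
      qed
      let ?p = "\<lambda>Q. prob {\<omega>\<in>space P. (\<omega> \<inter> Cl Q = {}) = e Q}"
      have "{\<omega>\<in>space P. \<forall>v\<in>V. occ \<omega> \<inter> B v = Y v} = {\<omega>\<in>space P. \<forall>Q\<in>(\<Union>v\<in>V. B v). (\<omega> \<inter> Cl Q = {}) = e Q}"
        using eq by auto
      then have "prob {\<omega>\<in>space P. \<forall>v\<in>V. occ \<omega> \<inter> B v = Y v} = (\<Prod>Q\<in>(\<Union>v\<in>V. B v). ?p Q)"
        using V Bf Clm Cldisj by (simp only:) (intro indep_empty, auto)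
      also have "\<dots> = (\<Prod>v\<in>V. \<Prod>Q\<in>B v. ?p Q)"
        using V Bf fstB by (intro prod.UNION_disjoint) (blast | force)+
      also have "\<dots> = (\<Prod>v\<in>V. prob {\<omega>\<in>space P. occ \<omega> \<inter> B v = Y v})"
      proof (intro prod.cong refl)
        fix v assume v: "v \<in> V"
        have "{\<omega>\<in>space P. occ \<omega> \<inter> B v = Y v} = {\<omega>\<in>space P. \<forall>Q\<in>B v. (\<omega> \<inter> Cl Q = {}) = e Q}" using eq[OF v] by blast
        then show "(\<Prod>Q\<in>B v. ?p Q) = prob {\<omega>\<in>space P. occ \<omega> \<inter> B v = Y v}"
          using indep_empty[OF Bf Clm Cldisj, of v e] by simp
      qed
      finally show ?thesis .
    qed
  qed simp_all
  then show ?thesis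
  proof eventually_elim
    case (elim \<omega>)
    then obtain Q where Q: "Q \<in> occ \<omega>" "\<And>k. \<exists>v Q'. k \<le> fst v \<and> Q' \<in> occ \<omega> \<inter> B v \<and> joined a (occ \<omega>) Q Q'" by blast
    have "\<forall>Q. \<exists>z. Q \<in> occ \<omega> \<longrightarrow> z \<in> \<omega> \<and> z \<in> Cl Q" by (auto simp: occ_def)
    from choice[OF this] obtain z where z: "\<And>Q. Q \<in> occ \<omega> \<Longrightarrow> z Q \<in> \<omega>" "\<And>Q. Q \<in> occ \<omega> \<Longrightarrow> z Q \<in> Cl Q" by blast
    let ?cs = "covered_set L \<omega>"
    have st_sub: "?st (z Q) \<subseteq> ?cs" if "Q \<in> occ \<omega>" for Q
      using z(1)[OF that] unfolding covered_set_def by (cases "z Q") (auto intro!: bexI[of _ "z Q"])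
    have fst_st: "fst w \<in> ?st w" for w :: "'a \<times> 'a"
      unfolding stick_iff[OF L0] using L0 by (intro exI[of _ 0]) simp
    have comp: "connected_component ?cs (fst (z Q)) (fst (z Q'))" if "joined a (occ \<omega>) Q Q'" for Q'
      using that unfolding joined_def
    proof (induction rule: equivclp_induct)
      case base
      show ?case using Q(1) st_sub[OF Q(1)] fst_st by (auto simp: connected_component_refl_eq)
    next
      case (step Q1 Q2)
      have o: "Q1 \<in> occ \<omega>" "Q2 \<in> occ \<omega>" using step(2) by auto
      have "a Q1 Q2 \<or> a Q2 Q1" using step(2) by auto
      then have "?st (z Q1) \<inter> ?st (z Q2) \<noteq> {}" using z(2)[OF o(1)] z(2)[OF o(2)] unfolding a_def by blast
      then have "connected (?st (z Q1) \<union> ?st (z Q2))" by (intro connected_Un connected_stick L0) auto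
      moreover have "?st (z Q1) \<union> ?st (z Q2) \<subseteq> ?cs" using st_sub o by blast
      ultimately have "connected_component ?cs (fst (z Q1)) (fst (z Q2))"
        using fst_st unfolding connected_component_def by blast
      then show ?case using step(3) connected_component_trans by blast
    qed
    let ?K = "connected_component_set ?cs (fst (z Q))"
    have "fst (z Q) \<in> ?cs" using st_sub[OF Q(1)] fst_st by blast
    then have "?K \<in> components ?cs" by (auto simp: components_def)
    moreover have "\<not> bounded ?K"
    proof
      assume "bounded ?K"
      then obtain b where b: "\<And>y. y \<in> ?K \<Longrightarrow> norm y \<le> b" by (auto simp: bounded_iff)
      obtain k :: nat where k: "b < real k" using reals_Archimedean2 by blast
      \<comment> \<open>The grid point has norm at least 2 \<rho> (k + 1) and the centre of the
        stick is within \<rho> of it, so the norm of that centre exceeds \<rho> (2k + 1) \<ge>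
        k.\<close>
      obtain v Q' where Q': "Suc k \<le> fst v" "Q' \<in> occ \<omega> \<inter> B v" "joined a (occ \<omega>) Q Q'" using Q(2) by blast
      have "fst (z Q') \<in> ?K" using comp[OF Q'(3)] by simp
      then have n: "norm (fst (z Q')) \<le> b" by (rule b)
      have "z Q' \<in> S v" using z(2)[of Q'] ClS[of Q'] Q'(2) by (auto simp: B_def)
      then have "dist (ctr v) (fst (z Q')) < \<rho>" by (auto simp: S_def)
      moreover have "norm (ctr v) \<le> dist (ctr v) (fst (z Q')) + norm (fst (z Q'))"
        using norm_triangle_sub[of "ctr v" "fst (z Q')"] by (simp add: dist_norm)
      moreover have "2 * \<rho> * real (fst v) \<le> norm (ctr v)"
        using Basis_le_norm[OF e(1), of "ctr v"] by (simp add: ctr1)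
      moreover have "\<rho> * real (Suc k) \<le> \<rho> * real (fst v)" using Q'(1) \<rho> by (intro mult_left_mono) auto
      moreover have "real k \<le> \<rho> * real k" using \<rho> by (simp add: mult_le_cancel_right1)
      ultimately have "real k \<le> b" using n \<rho> by (simp add: algebra_simps)
      then show False using k by simp
    qed
    ultimately show ?case unfolding percolates_def by blast
  qed
qed

text \<open>\<open>poisson_law\<close> selects by \<open>SOME\<close>, so existence gives access to
  its properties. Shells of centres times all directions serve as pieces of positive finite mass,
  and the centre \<open>fst\<close> as the map with null fibres.\<close>

lemma poisson_law_intensity:
  assumes u: "0 < u"
  shows "poisson_point_process (poisson_law (stick_intensity \<Theta> u)) (stick_intensity \<Theta> u) (\<lambda>\<omega>. \<omega>)"
proof -
  let ?\<mu> = "stick_intensity \<Theta> u"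
  define A where "A n = ball (0::'a) (real (Suc n)) - ball 0 (real n)" for n
  define B where "B n = A n \<times> sphere (0::'a) 1" for n
  have B_eq: "B n = (ball 0 (real (Suc n)) \<times> UNIV \<inter> space ?\<mu>) - (ball 0 (real n) \<times> UNIV \<inter> space ?\<mu>)" for n
    by (auto simp: B_def A_def space_intensity)
  have Bm: "B n \<in> sets ?\<mu>" for n unfolding B_eq by (intro sets.Diff open_in_intensity open_Times) auto
  have em: "emeasure ?\<mu> (B n) = ennreal u * emeasure lborel (A n)" for n
  proof -
    have "(\<integral>\<^sup>+p. emeasure lborel ((\<lambda>x. (x, p)) -` B n) \<partial>\<Theta>) = (\<integral>\<^sup>+p. emeasure lborel (A n) \<partial>\<Theta>)"
      by (intro nn_integral_cong arg_cong2[where f = emeasure]) (auto simp: B_def space_\<Theta>)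
    then show ?thesis unfolding emeasure_intensity[OF Bm] by (simp add: \<Theta>.emeasure_space_1)
  qed
  have Apos: "0 < emeasure lborel (A n)" for n
  proof -
    have "measure lborel (A n) = measure lborel (ball (0::'a) (real (Suc n))) - measure lborel (ball (0::'a) (real n))"
      unfolding A_def using emeasure_lborel_ball_finite[of "0::'a" "real (Suc n)"]
      by (intro measure_Diff) (auto simp: less_top intro!: subset_ball)
    also have "\<dots> = unit_ball_vol (real DIM('a)) * (real (Suc n) ^ DIM('a) - real n ^ DIM('a))"
      by (simp add: content_ball right_diff_distrib)
    also have "\<dots> > 0" by (intro mult_pos_pos) (auto intro!: power_strict_mono)
    finally have "emeasure lborel (A n) \<noteq> 0" by (auto simp: measure_def)
    then show ?thesis by (simp add: zero_less_iff_neq_zero)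
  qed
  have "\<exists>P. poisson_point_process P ?\<mu> (\<lambda>\<omega>. \<omega>)"
  proof (rule poisson_point_process_exists[where f = "fst :: 'a \<times> 'a \<Rightarrow> 'a" and B = B])
    have "fst \<in> lborel \<Otimes>\<^sub>M \<Theta> \<rightarrow>\<^sub>M (borel :: 'a measure)" by (intro measurable_compose[OF measurable_fst]) simp
    then show "fst \<in> borel_measurable ?\<mu>" by (simp add: stick_intensity_def cong: measurable_cong_sets)
    show "B n \<in> sets ?\<mu>" for n by (rule Bm)
    show "disjoint_family B"
    proof -
      have "A i \<inter> A j = {}" if "i < j" for i j
      proof -
        have "real (Suc i) \<le> real j" using that by simp
        then show ?thesis by (auto simp: A_def)
      qed
      then have "A i \<inter> A j = {}" if "i \<noteq> j" for i j using that by (metis Int_commute linorder_neq_iff)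
      then show ?thesis unfolding disjoint_family_on_def B_def by blast
    qed
    show "(\<Union>n. B n) = space ?\<mu>"
    proof -
      have "\<exists>n. x \<in> A n" for x :: 'a
      proof (intro exI[of _ "nat \<lfloor>norm x\<rfloor>"])
        show "x \<in> A (nat \<lfloor>norm x\<rfloor>)" unfolding A_def by (simp add: not_less) linarith
      qed
      then show ?thesis unfolding space_intensity B_def by blast
    qed
    show "0 < emeasure ?\<mu> (B n)" for n unfolding em using u Apos[of n] by (simp add: ennreal_zero_less_mult_iff)
    show "emeasure ?\<mu> (B n) < \<infinity>" for n
      by (rule emeasure_intensity_slab_finite[OF Bm, of n 0 "real (Suc n)"]) (auto simp: B_def A_def)
    show "emeasure ?\<mu> {z\<in>space ?\<mu>. fst z = y} = 0" for y
    proof -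
      have eq: "{z\<in>space ?\<mu>. fst z = y} = space ?\<mu> - ((- {y}) \<times> UNIV \<inter> space ?\<mu>)" by auto
      have m: "{z\<in>space ?\<mu>. fst z = y} \<in> sets ?\<mu>"
        unfolding eq by (intro sets.Diff sets.top open_in_intensity open_Times) auto
      have "emeasure ?\<mu> {z\<in>space ?\<mu>. fst z = y} \<le> ennreal u * 0"
      proof (rule emeasure_intensity_le[OF m])
        fix p :: 'a
        have "emeasure lborel ((\<lambda>x. (x, p)) -` {z\<in>space ?\<mu>. fst z = y}) \<le> emeasure lborel {y}"
          by (intro emeasure_mono) auto
        then show "emeasure lborel ((\<lambda>x. (x, p)) -` {z\<in>space ?\<mu>. fst z = y}) \<le> 0" by simp
      qed
      then show ?thesis by simp
    qed
  qed
  from someI_ex[OF this] show ?thesis unfolding poisson_law_def .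
qed

text \<open>Below \<open>c / L\<^sup>2\<close> the covered set almost surely does not percolate,
  which on a probability space excludes almost sure percolation; so every intensity in the infimum
  is at least this large. The value \<open>C / L\<^sup>2\<close> itself takes part in the infimum.
  The maximum with 2c in \<open>C\<close> secures c < C.\<close>

theorem critical_intensity_bounds:
  "\<exists>c C :: real. 0 < c \<and> c < C \<and> (\<forall>L\<ge>64. ereal (c / L\<^sup>2) \<le> critical_intensity \<Theta> L \<and> critical_intensity \<Theta> L \<le> ereal (C / L\<^sup>2))"
proof -
  define c where "c = 1 / (crossing_const :: real)"
  define g where "g = hit_const TYPE('a) * cap_const"
  define C where "C = max (ln 324 / g) (2 * c)"
  have cc: "0 < (crossing_const :: real)" by (simp add: crossing_const_def)
  have c0: "0 < c" using cc by (simp add: c_def)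
  have g0: "0 < g" using cap_const(1) by (simp add: g_def hit_const_def)
  have C: "c < C" "0 < C" using c0 by (auto simp: C_def)
  have "ln 324 / g * g \<le> C * g" using g0 by (intro mult_right_mono) (auto simp: C_def)
  then have Cg: "ln 324 \<le> C * g" using g0 by simp
  have "ereal (c / L\<^sup>2) \<le> critical_intensity \<Theta> L \<and> critical_intensity \<Theta> L \<le> ereal (C / L\<^sup>2)" if L: "64 \<le> L" for L
  proof
    have L2: "0 < L\<^sup>2" using L by simp
    show "ereal (c / L\<^sup>2) \<le> critical_intensity \<Theta> L"
      unfolding critical_intensity_def
    proof (rule Inf_greatest, clarify)
      fix u :: real
      assume u: "0 < u" and perc: "AE \<omega> in poisson_law (stick_intensity \<Theta> u). percolates (covered_set L \<omega>)"
      note P = poisson_law_intensity[OF u]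
      interpret ppp "poisson_law (stick_intensity \<Theta> u)" "stick_intensity \<Theta> u" by (rule ppp.intro[OF P])
      have "c / L\<^sup>2 \<le> u"
      proof (rule ccontr)
        assume "\<not> c / L\<^sup>2 \<le> u"
        then have "u * L\<^sup>2 < c" using L2 by (simp add: field_simps)
        then have "u * L\<^sup>2 * crossing_const < c * crossing_const" using cc by (rule mult_strict_right_mono)
        then have "u * (crossing_const * L\<^sup>2) < 1" using cc by (simp add: c_def mult.commute mult.left_commute)
        then have "AE \<omega> in poisson_law (stick_intensity \<Theta> u). \<not> percolates (covered_set L \<omega>)"
          using L by (intro AE_not_percolates[OF P u]) auto
        with perc have "AE \<omega> in poisson_law (stick_intensity \<Theta> u). False" by eventually_elim simp
        then show False by simp
      qed
      then show "ereal (c / L\<^sup>2) \<le> ereal u" by simp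
    qed
    have u: "0 < C / L\<^sup>2" using C L2 by simp
    have "AE \<omega> in poisson_law (stick_intensity \<Theta> (C / L\<^sup>2)). percolates (covered_set L \<omega>)"
    proof (rule AE_percolates[OF poisson_law_intensity[OF u] u L])
      have "C / L\<^sup>2 * (hit_const TYPE('a) * L\<^sup>2 * cap_const) = C * g" using L2 by (simp add: g_def)
      then show "ln 324 \<le> C / L\<^sup>2 * (hit_const TYPE('a) * L\<^sup>2 * cap_const)" using Cg by simp
    qed
    then show "critical_intensity \<Theta> L \<le> ereal (C / L\<^sup>2)"
      unfolding critical_intensity_def using u by (intro Inf_lower) auto
  qed
  then show ?thesis using c0 C(1) by blast
qed

end

theorem theorem1p1:
  assumes "DIM('a::euclidean_space) \<ge> 2"
  shows "\<exists>c C :: real. 0 < c \<and> c < C \<and>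
    (\<exists>L0 :: real. \<forall>L\<ge>L0.
      ereal (c / L\<^sup>2) \<le> critical_intensity_uniform TYPE('a) L \<and>
      critical_intensity_uniform TYPE('a) L \<le> ereal (C / L\<^sup>2))"
proof -
  interpret spread_direction "uniform_sphere :: 'a measure"
  proof (intro spread_direction.intro direction.intro spread_direction_axioms.intro)
    show "sets (uniform_sphere :: 'a measure) = sets (restrict_space borel (sphere 0 1))"
      by (rule sets_uniform_sphere)
    show "prob_space (uniform_sphere :: 'a measure)" by (rule prob_space_uniform_sphere[OF assms])
    show "\<exists>c>0. \<forall>u\<in>sphere (0::'a) 1. c \<le> measure uniform_sphere (sphere 0 1 \<inter> ball u r)" if "0 < r" for r
      by (rule uniform_sphere_cap[OF assms that])
  qed (rule assms)
  obtain c C where "0 < c" "c < C"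
    "\<forall>L\<ge>64. ereal (c / L\<^sup>2) \<le> critical_intensity (uniform_sphere :: 'a measure) L \<and>
      critical_intensity (uniform_sphere :: 'a measure) L \<le> ereal (C / L\<^sup>2)"
    using critical_intensity_bounds by (elim exE conjE)
  then show ?thesis unfolding critical_intensity_uniform_def
    by (intro exI[of _ c] exI[of _ C] conjI exI[of _ 64])
qed

end
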